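(* Let $s,t$ be fixed positive integers, let $\kappa:[0,1]\times[-\pi,\pi]\to\mathbb C^{s\times t}$ be measurable, and let $\{A_n\}_n\sim_{\rm GLT}\kappa$, where $A_n$ has size $2ns\times 2nt$. Let $\{H_n\}_n$ be the generalized locally Hankel (GLH) sequence associated with $\{A_n\}_n$, that is, $H_n=K_n(W_n\otimes I_t)$, where $K_n$ is the bottom left $ns\times nt$ block of $A_n$. Then $\{H_n\}_n\sim_\sigma0$ and $\{H_n\}_n\sim_{\rm GLT}O_{s,t}$.
   Context: Conventions. A sequence of matrices is a sequence $\{A_n\}_n$, where $n$ varies in some infinite subset of $\mathbb N$ and $A_n$ is a complex matrix whose two dimensions both tend to $\infty$ as $n\to\infty$. All measure-theoretic terminology refers to Lebesgue measure; a matrix-valued function is measurable (continuous a.e., in $L^1$, etc.) if all its components are. $\|\cdot\|$ is the operator norm induced by the Euclidean norm, $x\wedge y=\min(x,y)$, $I_s$ is the $s\times s$ identity matrix, $O_{s,t}$ is the $s\times t$ zero matrix (also viewed as a constant function on $[0,1]\times[-\pi,\pi]$), $\otimes$ is the Kronecker product $X\otimes Y=[X_{ij}Y]_{i,j}$, and $W_n$ is the $n\times n$ flip matrix, with entries $1$ in positions $(i,n+1-i)$, $i=1,\ldots,n$, and $0$ elsewhere. GLH sequences. Let $\{A_n\}_n\sim_{\rm GLT}\kappa$ with $A_n$ of size $2ns\times2nt$. Partition $A_n$ into a $2\times2$ block matrix with blocks of size $ns\times nt$, and let $\mathop{\rm blockdiag}_{n,n}^{s,t}(A_n)$ be obtained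 from $A_n$ by setting to zero the two off-diagonal blocks. Write $$A_n-\mathop{\rm blockdiag}_{n,n}^{s,t}(A_n)=\begin{bmatrix}O & J_n\\ K_n & O\end{bmatrix}$$ and set $H_n=K_n(W_n\otimes I_t)$. Then $\{H_n\}_n$ is by definition a generalized locally Hankel (GLH) sequence. Zero distribution. For a sequence of matrices $\{Z_n\}_n$ with $Z_n$ of size $p_n\times q_n$ and singular values $\sigma_i(Z_n)$, $i=1,\ldots,p_n\wedge q_n$, $\{Z_n\}_n\sim_\sigma0$ means that $\lim_{n\to\infty}\frac1{p_n\wedge q_n}\sum_{i=1}^{p_n\wedge q_n}F(\sigma_i(Z_n))=F(0)$ for all $F\in C_c(\mathbb R)$, where $C_c(\mathbb R)$ is the space of continuous complex-valued functions on $\mathbb R$ with bounded support. Toeplitz and diagonal sampling matrices. For $f:[-\pi,\pi]\to\mathbb C^{s\times t}$ in $L^1([-\pi,\pi])$, let $f_k=\frac1{2\pi}\int_{-\pi}^{\pi}f(\theta)e^{-{\rm i}k\theta}\,d\theta\in\mathbb C^{s\times t}$, $k\in\mathbb Z$, and $T_m(f)=[f_{i-j}]_{i,j=1}^m\in\mathbb C^{ms\times mt}$. For $a:[0,1]\to\mathbb C^{s\times t}$, $D_m(a)$ is the $ms\times mt$ block diagonal matrix with diagonal blocks $a(i/m)$, $i=1,\ldots,m$. Approximating class of sequences (a.c.s.). Let $\{X_n\}_n$ be a sequence of matrices with $X_n$ of size $p_n\times q_n$, and for each $m$ let $\{B_{n,m}\}_n$ be a sequence of matrices with $B_{n,m}$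 of size $p_n\times q_n$. Write $\{B_{n,m}\}_n\xrightarrow{\rm a.c.s.}\{X_n\}_n$ if for every $m$ there exists $n_m$ such that, for $n\ge n_m$, $X_n=B_{n,m}+R_{n,m}+N_{n,m}$ with ${\rm rank}(R_{n,m})\le c(m)(p_n\wedge q_n)$ and $\|N_{n,m}\|\le\omega(m)$, where $n_m,c(m),\omega(m)$ depend only on $m$ and $\lim_{m\to\infty}c(m)=\lim_{m\to\infty}\omega(m)=0$. GLT sequences. Let $\{X_n\}_n$ be a sequence of matrices with $X_n$ of size $d_ns\times d_nt$ for fixed positive integers $s,t$ and some positive integer sequence $d_n\to\infty$, and let $\kappa:[0,1]\times[-\pi,\pi]\to\mathbb C^{s\times t}$ be measurable. Then $\{X_n\}_n\sim_{\rm GLT}\kappa$ (i.e. $\{X_n\}_n$ is a generalized locally Toeplitz sequence with symbol $\kappa$) means that there exist functions $a_{i,m},f_{i,m}$, $i=1,\ldots,N_m$, such that: $a_{i,m}:[0,1]\to\mathbb C$ is continuous a.e. and $f_{i,m}:[-\pi,\pi]\to\mathbb C^{s\times t}$ is in $L^1([-\pi,\pi])$; $\sum_{i=1}^{N_m}a_{i,m}(x)f_{i,m}(\theta)\to\kappa(x,\theta)$ a.e. on $[0,1]\times[-\pi,\pi]$ as $m\to\infty$; and $\bigl\{\sum_{i=1}^{N_m}D_{d_n}(a_{i,m}I_s)T_{d_n}(f_{i,m})\bigr\}_n\xrightarrow{\rm a.c.s.}\{X_n\}_n$. (For $\{A_n\}_n$ above one has $d_n=2n$; for $\{H_n\}_n$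 one has $d_n=n$.) *)

theory Defs
  imports
    "HOL-Analysis.Analysis"
    "Jordan_Normal_Form.Schur_Decomposition"
    "Jordan_Normal_Form.DL_Rank"
begin

unbundle no vec_syntax
hide_const (open)
  Finite_Cartesian_Product.mat Finite_Cartesian_Product.row Finite_Cartesian_Product.column
  Finite_Cartesian_Product.rows Finite_Cartesian_Product.columns
  Finite_Cartesian_Product.vec Determinants.det Cartesian_Space.rank
  Finite_Cartesian_Product.transpose

text \<open>Matrices are 0-indexed: position \<open>(i,j)\<close> below is position \<open>(i+1,j+1)\<close> in the usual
  numbering. A sequence of matrices is indexed by the elements of an infinite set \<open>I\<close> of naturals;
  its values outside \<open>I\<close> are irrelevant.\<close>

definition along :: "nat set \<Rightarrow> nat filter" where
  "along I = inf sequentially (principal I)"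

definition matrix_seq :: "nat set \<Rightarrow> (nat \<Rightarrow> complex mat) \<Rightarrow> bool" where
  "matrix_seq I A \<longleftrightarrow> infinite I \<and>
     filterlim (\<lambda>n. dim_row (A n)) at_top (along I) \<and>
     filterlim (\<lambda>n. dim_col (A n)) at_top (along I)"

definition kronecker :: "complex mat \<Rightarrow> complex mat \<Rightarrow> complex mat" where
  "kronecker X Y = mat (dim_row X * dim_row Y) (dim_col X * dim_col Y)
     (\<lambda>(i,j). X $$ (i div dim_row Y, j div dim_col Y) * Y $$ (i mod dim_row Y, j mod dim_col Y))"

definition flip_mat :: "nat \<Rightarrow> complex mat" where
  "flip_mat n = mat n n (\<lambda>(i,j). if i + j + 1 = n then 1 else 0)"

definition euclid_norm :: "complex vec \<Rightarrow> real" where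
  "euclid_norm v = L2_set (\<lambda>i. cmod (v $ i)) {..<dim_vec v}"

definition op_norm :: "complex mat \<Rightarrow> real" where
  "op_norm A = (SUP v \<in> {v \<in> carrier_vec (dim_col A). euclid_norm v \<le> 1}. euclid_norm (A *\<^sub>v v))"

definition mat_rank :: "complex mat \<Rightarrow> nat" where
  "mat_rank A = vec_space.rank (dim_row A) A"

text \<open>The smaller of the two Gram matrices is used, so that a \<open>p \<times> q\<close> matrix has
  exactly \<open>min p q\<close> singular values, counted with multiplicity.\<close>

definition singular_values :: "complex mat \<Rightarrow> real multiset" where
  "singular_values A = image_mset (\<lambda>z. sqrt (Re z))
     (proots (char_poly (if dim_col A \<le> dim_row A then mat_adjoint A * A else A * mat_adjoint A)))"

definition zero_distributed :: "nat set \<Rightarrow> (nat \<Rightarrow> complex mat) \<Rightarrow> bool" where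
  "zero_distributed I Z \<longleftrightarrow> matrix_seq I Z \<and>
     (\<forall>F :: real \<Rightarrow> complex. continuous_on UNIV F \<longrightarrow> bounded {x. F x \<noteq> 0} \<longrightarrow>
        ((\<lambda>n. (\<Sum>\<sigma>\<in>#singular_values (Z n). F \<sigma>) / of_nat (min (dim_row (Z n)) (dim_col (Z n))))
           \<longlongrightarrow> F 0) (along I))"

definition fourier_coeff :: "nat \<Rightarrow> nat \<Rightarrow> (real \<Rightarrow> complex mat) \<Rightarrow> int \<Rightarrow> complex mat" where
  "fourier_coeff s t f k = mat s t
     (\<lambda>(i,j). 1 / (2 * of_real pi) *
        integral\<^sup>L (lebesgue_on {-pi..pi}) (\<lambda>\<theta>. f \<theta> $$ (i,j) * exp (- \<i> * of_int k * of_real \<theta>)))"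

text \<open>The \<open>(a,b)\<close> block of size \<open>s \<times> t\<close> is \<open>fourier_coeff s t f (a - b)\<close>.\<close>

definition toeplitz_mat :: "nat \<Rightarrow> nat \<Rightarrow> nat \<Rightarrow> (real \<Rightarrow> complex mat) \<Rightarrow> complex mat" where
  "toeplitz_mat s t m f = mat (m * s) (m * t)
     (\<lambda>(i,j). fourier_coeff s t f (int (i div s) - int (j div t)) $$ (i mod s, j mod t))"

definition diag_sampling_mat :: "nat \<Rightarrow> (real \<Rightarrow> complex mat) \<Rightarrow> complex mat" where
  "diag_sampling_mat m a = diag_block_mat (map (\<lambda>i. a (real i / real m)) [1..<m+1])"

text \<open>Componentwise, because matrices of varying size do not form a
  \<open>comm_monoid_add\<close> type and \<open>sum\<close> is unavailable.\<close>

definition mat_sum :: "nat \<Rightarrow> nat \<Rightarrow> (nat \<Rightarrow> complex mat) \<Rightarrow> nat set \<Rightarrow> complex mat" where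
  "mat_sum p q M S = mat p q (\<lambda>ij. \<Sum>k\<in>S. M k $$ ij)"

text \<open>\<open>B m n\<close> is the matrix \<open>B\<^sub>n\<^sub>,\<^sub>m\<close>.\<close>

definition is_acs :: "nat set \<Rightarrow> (nat \<Rightarrow> nat \<Rightarrow> complex mat) \<Rightarrow> (nat \<Rightarrow> complex mat) \<Rightarrow> bool" where
  "is_acs I B X \<longleftrightarrow>
     matrix_seq I X \<and>
     (\<forall>m. \<forall>n\<in>I. B m n \<in> carrier_mat (dim_row (X n)) (dim_col (X n))) \<and>
     (\<exists>(n0 :: nat \<Rightarrow> nat) (c :: nat \<Rightarrow> real) (\<omega> :: nat \<Rightarrow> real).
        c \<longlonglongrightarrow> 0 \<and> \<omega> \<longlonglongrightarrow> 0 \<and>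
        (\<forall>m. \<forall>n\<in>I. n \<ge> n0 m \<longrightarrow>
          (\<exists>R N. R \<in> carrier_mat (dim_row (X n)) (dim_col (X n)) \<and>
                 N \<in> carrier_mat (dim_row (X n)) (dim_col (X n)) \<and>
                 X n = B m n + R + N \<and>
                 real (mat_rank R) \<le> c m * real (min (dim_row (X n)) (dim_col (X n))) \<and>
                 op_norm N \<le> \<omega> m)))"

abbreviation symbol_domain :: "(real \<times> real) set" where
  "symbol_domain \<equiv> {0..1} \<times> {-pi..pi}"

definition measurable_symbol :: "nat \<Rightarrow> nat \<Rightarrow> (real \<times> real \<Rightarrow> complex mat) \<Rightarrow> bool" where
  "measurable_symbol s t \<kappa> \<longleftrightarrow>
     (\<forall>p\<in>symbol_domain. \<kappa> p \<in> carrier_mat s t) \<and>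
     (\<forall>i<s. \<forall>j<t. (\<lambda>p. \<kappa> p $$ (i,j)) \<in> borel_measurable (lebesgue_on symbol_domain))"

definition continuous_ae :: "(real \<Rightarrow> complex) \<Rightarrow> bool" where
  "continuous_ae a \<longleftrightarrow> (AE x in lebesgue_on {0..1}. continuous (at x within {0..1}) a)"

definition L1_matrix :: "nat \<Rightarrow> nat \<Rightarrow> (real \<Rightarrow> complex mat) \<Rightarrow> bool" where
  "L1_matrix s t f \<longleftrightarrow>
     (\<forall>\<theta>\<in>{-pi..pi}. f \<theta> \<in> carrier_mat s t) \<and>
     (\<forall>i<s. \<forall>j<t. integrable (lebesgue_on {-pi..pi}) (\<lambda>\<theta>. f \<theta> $$ (i,j)))"

text \<open>\<open>glt I d s t X \<kappa>\<close>: the sequence of \<open>d n * s \<times> d n * t\<close> matrices \<open>X n\<close>, \<open>n \<in> I\<close>, is a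
  generalized locally Toeplitz sequence with symbol \<open>\<kappa>\<close>. In \<open>a m i\<close> and \<open>f m i\<close> the index \<open>i\<close>
  runs over \<open>{1..Nm m}\<close>.\<close>

definition glt :: "nat set \<Rightarrow> (nat \<Rightarrow> nat) \<Rightarrow> nat \<Rightarrow> nat \<Rightarrow> (nat \<Rightarrow> complex mat) \<Rightarrow>
    (real \<times> real \<Rightarrow> complex mat) \<Rightarrow> bool" where
  "glt I d s t X \<kappa> \<longleftrightarrow>
     0 < s \<and> 0 < t \<and> infinite I \<and>
     (\<forall>n\<in>I. 0 < d n) \<and> filterlim d at_top (along I) \<and>
     (\<forall>n\<in>I. X n \<in> carrier_mat (d n * s) (d n * t)) \<and>
     measurable_symbol s t \<kappa> \<and>
     (\<exists>(Nm :: nat \<Rightarrow> nat) (a :: nat \<Rightarrow> nat \<Rightarrow> real \<Rightarrow> complex) (f :: nat \<Rightarrow> nat \<Rightarrow> real \<Rightarrow> complex mat).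
        (\<forall>m. \<forall>i\<in>{1..Nm m}. continuous_ae (a m i) \<and> L1_matrix s t (f m i)) \<and>
        (AE (x,\<theta>) in lebesgue_on symbol_domain. \<forall>k<s. \<forall>l<t.
           (\<lambda>m. mat_sum s t (\<lambda>i. a m i x \<cdot>\<^sub>m f m i \<theta>) {1..Nm m} $$ (k,l))
             \<longlonglongrightarrow> \<kappa> (x,\<theta>) $$ (k,l)) \<and>
        is_acs I
          (\<lambda>m n. mat_sum (d n * s) (d n * t)
             (\<lambda>i. diag_sampling_mat (d n) (\<lambda>x. a m i x \<cdot>\<^sub>m 1\<^sub>m s) * toeplitz_mat s t (d n) (f m i))
             {1..Nm m})
          X)"

definition bottom_left_block :: "nat \<Rightarrow> nat \<Rightarrow> nat \<Rightarrow> complex mat \<Rightarrow> complex mat" where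
  "bottom_left_block s t n A = (case split_block A (n * s) (n * t) of (_, _, K, _) \<Rightarrow> K)"

definition glh_mat :: "nat \<Rightarrow> nat \<Rightarrow> nat \<Rightarrow> complex mat \<Rightarrow> complex mat" where
  "glh_mat s t n A = bottom_left_block s t n A * kronecker (flip_mat n) (1\<^sub>m t)"

end

theory Submission
  imports Defs
begin

text \<open>Call a matrix sequence vanishing if, for every \<open>\<epsilon> > 0\<close>, its \<open>n\<close>-th member is eventually a matrix
  of rank at most \<open>\<epsilon> n\<close> plus one of norm at most \<open>\<epsilon>\<close>. For a vanishing sequence all but
  \<open>\<epsilon> n\<close> singular values are at most \<open>\<epsilon>\<close>, and the zero matrices form an a.c.s. for it; so it
  suffices that the bottom left block of \<open>A\<^sub>n\<close> vanishes, and by the a.c.s. hypothesis this reduces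
  to the corners of \<open>D\<^sub>2\<^sub>n(a I\<^sub>s) T\<^sub>2\<^sub>n(f)\<close>. The corner of \<open>T\<^sub>2\<^sub>n(f)\<close> contains only the coefficients
  \<open>f\<^sub>k\<close> with \<open>k > 0\<close>. Split \<open>f = g + h\<close> with \<open>g\<close> bounded and \<open>h\<close> small in \<open>L\<^sup>1\<close>. By Bessel's
  inequality for \<open>g\<close> the corner for \<open>g\<close> has squared Frobenius norm \<open>o(n)\<close>; the corner for \<open>h\<close> has
  trace norm \<open>O(n \<parallel>h\<parallel>\<^sub>1)\<close>. Hence the trace norm of the corner for \<open>f\<close> is \<open>o(n)\<close>, which makes it
  vanishing. The diagonal factor is harmless because \<open>a\<close>, being continuous almost everywhere,
  exceeds a large bound at only few sample points.\<close>

subsection \<open>Splitting a matrix into low rank plus small norm\<close>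

text \<open>A symbol that is merely integrable need not have square-summable coefficients, so
  Bessel's inequality cannot be applied to it directly, while the integral estimate alone only gives
  a trace norm O(n). Each half of the splitting repairs the defect of the other, and the trace norm
  is the common scale on which both estimates can be added. It is used in dual form, through
  pairings with orthonormal families: this makes it subadditive by the triangle inequality, lets it
  be estimated under the integral sign, and allows a maximality argument to convert it into rank
  plus norm. The diagonal factor is applied only after this conversion. The samples of an unbounded
  coefficient can inflate a trace norm arbitrarily, whereas a row with a large sample costs just one
  unit of rank. Matrices are functions on index sets, so that passing to a corner or flipping block
  columns is only a change of index sets.\<close>

definition orthonormal_on :: "'a set \<Rightarrow> nat \<Rightarrow> (nat \<Rightarrow> 'a \<Rightarrow> complex) \<Rightarrow> bool" where
  "orthonormal_on S K u \<longleftrightarrow>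
     (\<forall>k<K. \<forall>l<K. (\<Sum>i\<in>S. u k i * cnj (u l i)) = (if k = l then 1 else 0))"

definition sq_norm_on :: "'a set \<Rightarrow> ('a \<Rightarrow> complex) \<Rightarrow> real" where
  "sq_norm_on S x = (\<Sum>i\<in>S. (cmod (x i))\<^sup>2)"

text \<open>Bilinear rather than sesquilinear. Conjugation preserves norms and orthonormality, so
  bounds over all vectors or all orthonormal families are unaffected.\<close>

definition bilin :: "'a set \<Rightarrow> 'b set \<Rightarrow> ('a \<Rightarrow> 'b \<Rightarrow> complex) \<Rightarrow> ('a \<Rightarrow> complex) \<Rightarrow> ('b \<Rightarrow> complex) \<Rightarrow> complex" where
  "bilin S T M x y = (\<Sum>i\<in>S. \<Sum>j\<in>T. x i * M i j * y j)"

text \<open>For an orthonormal family, the orthogonal projection of \<open>x\<close> onto the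
  complement of its span.\<close>

definition residual :: "'a set \<Rightarrow> nat \<Rightarrow> (nat \<Rightarrow> 'a \<Rightarrow> complex) \<Rightarrow> ('a \<Rightarrow> complex) \<Rightarrow> 'a \<Rightarrow> complex" where
  "residual S K u x i = x i - (\<Sum>k<K. (\<Sum>l\<in>S. x l * cnj (u k l)) * u k i)"

lemma sq_norm_on_nonneg [simp]: "0 \<le> sq_norm_on S x"
  by (simp add: sq_norm_on_def sum_nonneg)

lemma of_real_sq_norm_on: "of_real (sq_norm_on S x) = (\<Sum>i\<in>S. x i * cnj (x i))"
  by (simp add: sq_norm_on_def complex_norm_square del: of_real_power)

lemma sq_norm_on_scale: "sq_norm_on S (\<lambda>i. c * x i) = (cmod c)\<^sup>2 * sq_norm_on S x"
  by (simp add: sq_norm_on_def norm_mult power_mult_distrib sum_distrib_left)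

lemma orthonormal_on_sq_norm:
  assumes "orthonormal_on S K u" "k < K" shows "sq_norm_on S (u k) = 1"
proof -
  have "of_real (sq_norm_on S (u k)) = (1::complex)"
    unfolding of_real_sq_norm_on using assms by (simp add: orthonormal_on_def)
  then show ?thesis by (metis of_real_eq_1_iff)
qed

lemma orthonormal_on_cnj:
  assumes "orthonormal_on S K u" shows "orthonormal_on S K (\<lambda>k i. cnj (u k i))"
  unfolding orthonormal_on_def
proof (intro allI impI)
  fix k l assume "k < K" "l < K"
  then have "(\<Sum>i\<in>S. u l i * cnj (u k i)) = (if l = k then 1 else 0)"
    using assms by (auto simp: orthonormal_on_def)
  then show "(\<Sum>i\<in>S. cnj (u k i) * cnj (cnj (u l i))) = (if k = l then 1 else 0)"
    by (auto simp: mult.commute)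
qed

lemma residual_orthogonal:
  assumes "orthonormal_on S K u" "l < K"
  shows "(\<Sum>i\<in>S. residual S K u x i * cnj (u l i)) = 0"
proof -
  have "(\<Sum>i\<in>S. residual S K u x i * cnj (u l i)) =
     (\<Sum>i\<in>S. x i * cnj (u l i)) - (\<Sum>i\<in>S. \<Sum>k<K. (\<Sum>j\<in>S. x j * cnj (u k j)) * u k i * cnj (u l i))"
    by (simp add: residual_def left_diff_distrib sum_subtractf sum_distrib_right)
  also have "(\<Sum>i\<in>S. \<Sum>k<K. (\<Sum>j\<in>S. x j * cnj (u k j)) * u k i * cnj (u l i)) =
     (\<Sum>k<K. (\<Sum>j\<in>S. x j * cnj (u k j)) * (\<Sum>i\<in>S. u k i * cnj (u l i)))"
    by (subst sum.swap) (simp add: sum_distrib_left mult.assoc)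
  also have "\<dots> = (\<Sum>k<K. (\<Sum>j\<in>S. x j * cnj (u k j)) * (if k = l then 1 else 0))"
    using assms by (intro sum.cong) (auto simp: orthonormal_on_def)
  also have "\<dots> = (\<Sum>j\<in>S. x j * cnj (u l j))"
    using assms by (simp add: if_distrib[of "\<lambda>z. _ * z"] sum.delta cong: if_cong)
  finally show ?thesis by simp
qed

text \<open>Pythagoras. The identity gives more than Bessel's inequality: it also decides when a
  residual vanishes, on which the completion to a basis rests.\<close>

lemma sq_norm_residual:
  assumes "orthonormal_on S K u"
  shows "sq_norm_on S (residual S K u x) =
    sq_norm_on S x - (\<Sum>k<K. (cmod (\<Sum>i\<in>S. x i * cnj (u k i)))\<^sup>2)"
proof -
  define c where "c k = (\<Sum>i\<in>S. x i * cnj (u k i))" for k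
  let ?r = "residual S K u x"
  have r: "?r i = x i - (\<Sum>k<K. c k * u k i)" for i by (simp add: residual_def c_def)
  have "(\<Sum>i\<in>S. ?r i * cnj (?r i)) =
      (\<Sum>i\<in>S. ?r i * cnj (x i)) - (\<Sum>i\<in>S. ?r i * cnj (\<Sum>k<K. c k * u k i))"
    by (subst (2) r) (simp add: right_diff_distrib sum_subtractf)
  also have "(\<Sum>i\<in>S. ?r i * cnj (\<Sum>k<K. c k * u k i)) = (\<Sum>k<K. cnj (c k) * (\<Sum>i\<in>S. ?r i * cnj (u k i)))"
    by (simp add: sum_distrib_left) (subst sum.swap, simp add: mult_ac)
  also have "\<dots> = 0" using residual_orthogonal[OF assms] by simp
  also have "(\<Sum>i\<in>S. ?r i * cnj (x i)) = (\<Sum>i\<in>S. x i * cnj (x i)) - (\<Sum>i\<in>S. \<Sum>k<K. c k * u k i * cnj (x i))"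
    by (simp add: r left_diff_distrib sum_subtractf sum_distrib_right)
  also have "(\<Sum>i\<in>S. \<Sum>k<K. c k * u k i * cnj (x i)) = (\<Sum>k<K. c k * cnj (c k))"
    by (subst sum.swap) (simp add: c_def sum_distrib_left mult_ac)
  finally have "complex_of_real (sq_norm_on S ?r) = of_real (sq_norm_on S x - (\<Sum>k<K. (cmod (c k))\<^sup>2))"
    by (simp add: of_real_sq_norm_on complex_norm_square del: of_real_power)
  then show ?thesis by (simp only: of_real_eq_iff c_def)
qed

lemma sq_norm_residual_le:
  "orthonormal_on S K u \<Longrightarrow> sq_norm_on S (residual S K u x) \<le> sq_norm_on S x"
  by (simp add: sq_norm_residual sum_nonneg)

text \<open>The pairing carries no conjugate, as in \<open>bilin\<close>; hence the passage through
  the conjugate family.\<close>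

lemma bessel_on:
  assumes "orthonormal_on S K u"
  shows "(\<Sum>k<K. (cmod (\<Sum>i\<in>S. x i * u k i))\<^sup>2) \<le> sq_norm_on S x"
  using sq_norm_residual[OF orthonormal_on_cnj[OF assms], of x]
    sq_norm_on_nonneg[of S "residual S K (\<lambda>k i. cnj (u k i)) x"] by simp

text \<open>Bessel's inequality for the coordinate vector at \<open>i\<close>.\<close>

lemma orthonormal_on_sum_sq_le:
  assumes "orthonormal_on S K u" "finite S" "i \<in> S"
  shows "(\<Sum>k<K. (cmod (u k i))\<^sup>2) \<le> 1"
  using bessel_on[OF assms(1), of "\<lambda>l. if l = i then 1 else 0"] assms(2,3)
  by (simp add: sq_norm_on_def if_distrib[of "\<lambda>z. z * _"] if_distrib[of cmod]
       if_distrib[of "\<lambda>z. z ^ 2"] sum.delta cong: if_cong)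

text \<open>The squared entries are summed by members and by coordinates. Together with the bound 1
  per coordinate this stands in for dimension theory: it bounds the size of a family, finds a
  coordinate vector outside an incomplete one, and recognizes a basis.\<close>

lemma orthonormal_on_card_eq:
  assumes "orthonormal_on S K u"
  shows "real K = (\<Sum>i\<in>S. \<Sum>k<K. (cmod (u k i))\<^sup>2)"
proof -
  have "real K = (\<Sum>k<K. sq_norm_on S (u k))" using orthonormal_on_sq_norm[OF assms] by simp
  then show ?thesis unfolding sq_norm_on_def by (subst sum.swap) simp
qed

lemma orthonormal_on_card_le:
  assumes "orthonormal_on S K u" "finite S" shows "K \<le> card S"
proof -
  have "real K \<le> (\<Sum>i\<in>S. 1)"
    unfolding orthonormal_on_card_eq[OF assms(1)]
    by (intro sum_mono) (use orthonormal_on_sum_sq_le[OF assms] in auto)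
  then show ?thesis by simp
qed

lemma orthonormal_on_extend:
  assumes u: "orthonormal_on S K u" and x: "sq_norm_on S x = 1"
    and orth: "\<And>k. k < K \<Longrightarrow> (\<Sum>i\<in>S. x i * cnj (u k i)) = 0"
  shows "orthonormal_on S (Suc K) (u(K := x))"
proof -
  have xx: "(\<Sum>i\<in>S. x i * cnj (x i)) = 1" using of_real_sq_norm_on[of S x] x by simp
  have orth': "(\<Sum>i\<in>S. u k i * cnj (x i)) = 0" if "k < K" for k
    using arg_cong[OF orth[OF that], of cnj] by (simp add: mult.commute)
  show ?thesis
    unfolding orthonormal_on_def using u orth orth' xx
    by (auto simp: less_Suc_eq orthonormal_on_def)
qed

section \<open>Trace norm, rank and operator norm of matrices over index sets\<close>

lemma bilin_cong:
  assumes "\<And>i. i \<in> S \<Longrightarrow> x i = x' i" "\<And>j. j \<in> T \<Longrightarrow> y j = y' j"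
    "\<And>i j. i \<in> S \<Longrightarrow> j \<in> T \<Longrightarrow> M i j = M' i j"
  shows "bilin S T M x y = bilin S T M' x' y'"
  unfolding bilin_def using assms by (intro sum.cong) auto

lemma bilin_scale: "bilin S T M (\<lambda>i. a * x i) (\<lambda>j. b * y j) = a * b * bilin S T M x y"
  by (simp add: bilin_def sum_distrib_left mult_ac)

lemma bilin_add: "bilin S T (\<lambda>i j. M i j + N i j) x y = bilin S T M x y + bilin S T N x y"
  by (simp add: bilin_def sum.distrib ring_distribs)

text \<open>The trace norm, i.e. the sum of the singular values, in dual form: it is the supremum of
  these sums of pairings.\<close>

definition trace_bound :: "'a set \<Rightarrow> 'b set \<Rightarrow> real \<Rightarrow> ('a \<Rightarrow> 'b \<Rightarrow> complex) \<Rightarrow> bool" where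
  "trace_bound S T \<tau> M \<longleftrightarrow> (\<forall>K u v. orthonormal_on S K u \<longrightarrow> orthonormal_on T K v \<longrightarrow>
      (\<Sum>k<K. cmod (bilin S T M (u k) (v k))) \<le> \<tau>)"

text \<open>Summands may vanish, so \<open>r\<close> is only an upper bound for the rank.\<close>

definition low_rank :: "'a set \<Rightarrow> 'b set \<Rightarrow> nat \<Rightarrow> ('a \<Rightarrow> 'b \<Rightarrow> complex) \<Rightarrow> bool" where
  "low_rank S T r M \<longleftrightarrow> (\<exists>x y. \<forall>i\<in>S. \<forall>j\<in>T. M i j = (\<Sum>k<r. x k i * y k j))"

text \<open>For \<omega> \<ge> 0 this says that the operator norm is at most \<omega>. The
  formulation through the form treats rows and columns alike, which makes adjoints easy.\<close>

definition norm_bound :: "'a set \<Rightarrow> 'b set \<Rightarrow> real \<Rightarrow> ('a \<Rightarrow> 'b \<Rightarrow> complex) \<Rightarrow> bool" where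
  "norm_bound S T \<omega> M \<longleftrightarrow>
     (\<forall>x y. cmod (bilin S T M x y) \<le> \<omega> * sqrt (sq_norm_on S x) * sqrt (sq_norm_on T y))"

definition rank_norm_split :: "'a set \<Rightarrow> 'b set \<Rightarrow> nat \<Rightarrow> real \<Rightarrow> ('a \<Rightarrow> 'b \<Rightarrow> complex) \<Rightarrow> bool" where
  "rank_norm_split S T r \<omega> M \<longleftrightarrow>
     (\<exists>N. low_rank S T r (\<lambda>i j. M i j - N i j) \<and> norm_bound S T \<omega> N)"

lemma trace_boundD:
  "trace_bound S T \<tau> M \<Longrightarrow> orthonormal_on S K u \<Longrightarrow> orthonormal_on T K v \<Longrightarrow>
     (\<Sum>k<K. cmod (bilin S T M (u k) (v k))) \<le> \<tau>"
  by (simp add: trace_bound_def)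

lemma trace_bound_mono: "trace_bound S T \<tau> M \<Longrightarrow> \<tau> \<le> \<tau>' \<Longrightarrow> trace_bound S T \<tau>' M"
  unfolding trace_bound_def by force

lemma trace_bound_cong:
  assumes "\<And>i j. i \<in> S \<Longrightarrow> j \<in> T \<Longrightarrow> M i j = M' i j"
  shows "trace_bound S T \<tau> M = trace_bound S T \<tau> M'"
proof -
  have "bilin S T M = bilin S T M'" by (simp add: fun_eq_iff bilin_def assms cong: sum.cong)
  then show ?thesis by (simp add: trace_bound_def)
qed

lemma trace_bound_add:
  assumes "trace_bound S T a M" "trace_bound S T b N"
  shows "trace_bound S T (a + b) (\<lambda>i j. M i j + N i j)"
  unfolding trace_bound_def bilin_add
proof (intro allI impI)
  fix K u v assume uv: "orthonormal_on S K u" "orthonormal_on T K v"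
  have "(\<Sum>k<K. cmod (bilin S T M (u k) (v k) + bilin S T N (u k) (v k))) \<le>
     (\<Sum>k<K. cmod (bilin S T M (u k) (v k))) + (\<Sum>k<K. cmod (bilin S T N (u k) (v k)))"
    unfolding sum.distrib[symmetric] by (intro sum_mono norm_triangle_ineq)
  then show "(\<Sum>k<K. cmod (bilin S T M (u k) (v k) + bilin S T N (u k) (v k))) \<le> a + b"
    using trace_boundD[OF assms(1) uv] trace_boundD[OF assms(2) uv] by linarith
qed

lemma trace_bound_sum:
  assumes "finite L" "\<And>l. l \<in> L \<Longrightarrow> trace_bound S T (a l) (M l)"
  shows "trace_bound S T (\<Sum>l\<in>L. a l) (\<lambda>i j. \<Sum>l\<in>L. M l i j)"
  using assms
proof (induction rule: finite_induct)
  case empty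
  then show ?case by (simp add: trace_bound_def bilin_def)
next
  case (insert l L)
  then show ?case using trace_bound_add[of S T "a l" "M l"] by simp
qed

lemma low_rank_cong:
  assumes "\<And>i j. i \<in> S \<Longrightarrow> j \<in> T \<Longrightarrow> M i j = M' i j"
  shows "low_rank S T r M = low_rank S T r M'"
  by (simp add: low_rank_def assms cong: ball_cong)

lemma low_rank_sum_products: "low_rank S T r (\<lambda>i j. \<Sum>k<r. x k i * y k j)"
  unfolding low_rank_def by blast

text \<open>Any finite set may label the products, such as a disjoint union, a set of rows or a set
  of column vectors; the surplus terms up to \<open>r\<close> are filled with zeros.\<close>

lemma low_rankI:
  assumes "finite L" "card L \<le> r" "\<And>i j. i \<in> S \<Longrightarrow> j \<in> T \<Longrightarrow> M i j = (\<Sum>l\<in>L. x l i * y l j)"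
  shows "low_rank S T r M"
proof -
  obtain h where h: "bij_betw h {..<card L} L"
    using ex_bij_betw_nat_finite[OF assms(1)] by (auto simp: atLeast0LessThan)
  let ?x = "\<lambda>k i. if k < card L then x (h k) i else 0" and ?y = "\<lambda>k. y (h k)"
  have "M i j = (\<Sum>k<r. ?x k i * ?y k j)" if "i \<in> S" "j \<in> T" for i j
  proof -
    have "M i j = (\<Sum>k<card L. x (h k) i * y (h k) j)"
      using assms(3)[OF that] sum.reindex_bij_betw[OF h, of "\<lambda>l. x l i * y l j"] by simp
    also have "\<dots> = (\<Sum>k<card L. ?x k i * ?y k j)" by simp
    also have "\<dots> = (\<Sum>k<r. ?x k i * ?y k j)"
      using assms(2) by (intro sum.mono_neutral_left) auto
    finally show ?thesis .
  qed
  then show ?thesis unfolding low_rank_def by (intro exI[of _ ?x] exI[of _ ?y]) blast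
qed

lemma low_rank_add:
  assumes "low_rank S T a M" "low_rank S T b N"
  shows "low_rank S T (a + b) (\<lambda>i j. M i j + N i j)"
proof -
  obtain x y x' y' where
    M: "\<And>i j. i \<in> S \<Longrightarrow> j \<in> T \<Longrightarrow> M i j = (\<Sum>k<a. x k i * y k j)" and
    N: "\<And>i j. i \<in> S \<Longrightarrow> j \<in> T \<Longrightarrow> N i j = (\<Sum>k<b. x' k i * y' k j)"
    using assms unfolding low_rank_def by blast
  show ?thesis
  proof (rule low_rankI[where L = "{..<a} <+> {..<b}" and x = "case_sum x x'" and y = "case_sum y y'"])
    show "M i j + N i j = (\<Sum>l\<in>{..<a} <+> {..<b}. case_sum x x' l i * case_sum y y' l j)"
      if "i \<in> S" "j \<in> T" for i j
      using that by (simp add: M N sum.Plus)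
  qed (simp_all add: card_Plus)
qed

lemma norm_bound_add:
  assumes "norm_bound S T a M" "norm_bound S T b N"
  shows "norm_bound S T (a + b) (\<lambda>i j. M i j + N i j)"
  unfolding norm_bound_def bilin_add
proof (intro allI)
  fix x y
  show "cmod (bilin S T M x y + bilin S T N x y) \<le> (a + b) * sqrt (sq_norm_on S x) * sqrt (sq_norm_on T y)"
    using assms[unfolded norm_bound_def, rule_format, of x y]
      norm_triangle_ineq[of "bilin S T M x y" "bilin S T N x y"]
    by (simp add: ring_distribs)
qed

lemma norm_bound_mono: assumes "norm_bound S T a M" "a \<le> b" shows "norm_bound S T b M"
  unfolding norm_bound_def
proof (intro allI)
  fix x y
  have "a * (sqrt (sq_norm_on S x) * sqrt (sq_norm_on T y)) \<le> b * (sqrt (sq_norm_on S x) * sqrt (sq_norm_on T y))"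
    using assms(2) by (intro mult_right_mono) auto
  then show "cmod (bilin S T M x y) \<le> b * sqrt (sq_norm_on S x) * sqrt (sq_norm_on T y)"
    using assms(1)[unfolded norm_bound_def, rule_format, of x y] by (simp add: mult.assoc)
qed

lemma rank_norm_split_cong:
  assumes "\<And>i j. i \<in> S \<Longrightarrow> j \<in> T \<Longrightarrow> M i j = M' i j"
  shows "rank_norm_split S T r \<omega> M = rank_norm_split S T r \<omega> M'"
  by (simp add: rank_norm_split_def low_rank_def assms cong: ball_cong)

lemma rank_norm_splitI:
  assumes "low_rank S T r R" "norm_bound S T \<omega> N"
    "\<And>i j. i \<in> S \<Longrightarrow> j \<in> T \<Longrightarrow> M i j = R i j + N i j"
  shows "rank_norm_split S T r \<omega> M"
proof -
  have "low_rank S T r (\<lambda>i j. M i j - N i j)"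
    using assms(1) by (subst low_rank_cong[where M' = R]) (simp_all add: assms(3))
  then show ?thesis using assms(2) unfolding rank_norm_split_def by blast
qed

lemma rank_norm_split_add:
  assumes "rank_norm_split S T r a M" "rank_norm_split S T s b N"
  shows "rank_norm_split S T (r + s) (a + b) (\<lambda>i j. M i j + N i j)"
proof -
  obtain A B where "low_rank S T r (\<lambda>i j. M i j - A i j)" "norm_bound S T a A"
    "low_rank S T s (\<lambda>i j. N i j - B i j)" "norm_bound S T b B"
    using assms unfolding rank_norm_split_def by blast
  then show ?thesis
    by (intro rank_norm_splitI[OF low_rank_add norm_bound_add]) (auto simp: algebra_simps)
qed

lemma sq_norm_on_image:
  assumes "inj_on f S" shows "sq_norm_on (f ` S) x = sq_norm_on S (\<lambda>i. x (f i))"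
  by (simp add: sq_norm_on_def sum.reindex[OF assms])

text \<open>Along injections one obtains a submatrix with permuted rows and columns. Vectors on the
  small index sets are transported to the large ones and extended by zero, which changes neither
  their norms nor the value of the form. This covers both the restriction to a corner and the
  flip.\<close>

lemma rank_norm_split_reindex:
  fixes f :: "'c \<Rightarrow> 'a" and g :: "'d \<Rightarrow> 'b"
  assumes "finite S" "finite T" "inj_on f S'" "inj_on g T'" "f ` S' \<subseteq> S" "g ` T' \<subseteq> T"
    and "rank_norm_split S T r \<omega> M"
  shows "rank_norm_split S' T' r \<omega> (\<lambda>i j. M (f i) (g j))"
proof -
  obtain N where R: "low_rank S T r (\<lambda>i j. M i j - N i j)" and N: "norm_bound S T \<omega> N"
    using assms(7) unfolding rank_norm_split_def by blast
  define R where "R i j = M i j - N i j" for i j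
  have "low_rank S' T' r (\<lambda>i j. R (f i) (g j))"
  proof -
    obtain x y where "\<forall>i\<in>S. \<forall>j\<in>T. R i j = (\<Sum>k<r. x k i * y k j)"
      using R unfolding low_rank_def R_def[symmetric] by blast
    then show ?thesis using assms(5,6) unfolding low_rank_def
      by (intro exI[of _ "\<lambda>k i. x k (f i)"] exI[of _ "\<lambda>k j. y k (g j)"]) (simp add: image_subset_iff)
  qed
  moreover have "norm_bound S' T' \<omega> (\<lambda>i j. N (f i) (g j))"
    unfolding norm_bound_def
  proof (intro allI)
    fix x :: "'c \<Rightarrow> complex" and y :: "'d \<Rightarrow> complex"
    define x' where "x' i = (if i \<in> f ` S' then x (inv_into S' f i) else 0)" for i
    define y' where "y' j = (if j \<in> g ` T' then y (inv_into T' g j) else 0)" for j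
    have x': "x' (f i) = x i" if "i \<in> S'" for i using that assms(3) by (simp add: x'_def)
    have y': "y' (g j) = y j" if "j \<in> T'" for j using that assms(4) by (simp add: y'_def)
    have nx: "sq_norm_on S x' = sq_norm_on S' x"
    proof -
      have "sq_norm_on S x' = sq_norm_on (f ` S') x'"
        unfolding sq_norm_on_def using assms(1,5)
        by (intro sum.mono_neutral_right) (auto simp: x'_def)
      also have "\<dots> = sq_norm_on S' x"
        unfolding sq_norm_on_image[OF assms(3)] using x' by (simp add: sq_norm_on_def)
      finally show ?thesis .
    qed
    have ny: "sq_norm_on T y' = sq_norm_on T' y"
    proof -
      have "sq_norm_on T y' = sq_norm_on (g ` T') y'"
        unfolding sq_norm_on_def using assms(2,6)
        by (intro sum.mono_neutral_right) (auto simp: y'_def)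
      also have "\<dots> = sq_norm_on T' y"
        unfolding sq_norm_on_image[OF assms(4)] using y' by (simp add: sq_norm_on_def)
      finally show ?thesis .
    qed
    have "bilin S T N x' y' = (\<Sum>i\<in>f ` S'. \<Sum>j\<in>T. x' i * N i j * y' j)"
      unfolding bilin_def using assms(1,5)
      by (intro sum.mono_neutral_right) (auto simp: x'_def)
    also have "\<dots> = (\<Sum>i\<in>f ` S'. \<Sum>j\<in>g ` T'. x' i * N i j * y' j)"
      using assms(2,6) by (intro sum.cong refl sum.mono_neutral_right) (auto simp: y'_def)
    also have "\<dots> = bilin S' T' (\<lambda>i j. N (f i) (g j)) x y"
      unfolding bilin_def sum.reindex[OF assms(3)] sum.reindex[OF assms(4)] using x' y' by simp
    finally show "cmod (bilin S' T' (\<lambda>i j. N (f i) (g j)) x y)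
        \<le> \<omega> * sqrt (sq_norm_on S' x) * sqrt (sq_norm_on T' y)"
      using N[unfolded norm_bound_def, rule_format, of x' y'] by (simp add: nx ny)
  qed
  ultimately show ?thesis by (rule rank_norm_splitI) (simp add: R_def)
qed

section \<open>From a trace norm bound to low rank plus small norm\<close>

lemma cauchy_schwarz_on:
  "cmod (\<Sum>i\<in>S. x i * y i) \<le> sqrt (sq_norm_on S x) * sqrt (sq_norm_on S y)"
proof -
  have "cmod (\<Sum>i\<in>S. x i * y i) \<le> (\<Sum>i\<in>S. cmod (x i) * cmod (y i))"
    by (rule order_trans[OF norm_sum]) (simp add: norm_mult)
  also have "\<dots> \<le> L2_set (\<lambda>i. cmod (x i)) S * L2_set (\<lambda>i. cmod (y i)) S"
    using L2_set_mult_ineq[of "\<lambda>i. cmod (x i)" "\<lambda>i. cmod (y i)" S] by simp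
  finally show ?thesis by (simp add: L2_set_def sq_norm_on_def)
qed

text \<open>After normalization, \<open>x\<close> and \<open>y\<close> prolong the two families by
  one member. By maximality some pairing of the longer families is at most \<delta>; the old
  pairings exceed \<delta>, so it is the new one.\<close>

lemma norm_bound_orthogonal_complement:
  assumes max: "\<And>u' v'. orthonormal_on S (Suc K) u' \<Longrightarrow> orthonormal_on T (Suc K) v' \<Longrightarrow>
      \<exists>k<Suc K. cmod (bilin S T M (u' k) (v' k)) \<le> \<delta>"
    and u: "orthonormal_on S K u" and v: "orthonormal_on T K v"
    and big: "\<And>k. k < K \<Longrightarrow> cmod (bilin S T M (u k) (v k)) > \<delta>"
    and x: "\<And>k. k < K \<Longrightarrow> (\<Sum>i\<in>S. x i * cnj (u k i)) = 0"
    and y: "\<And>k. k < K \<Longrightarrow> (\<Sum>i\<in>T. y i * cnj (v k i)) = 0"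
    and fin: "finite S" "finite T"
  shows "cmod (bilin S T M x y) \<le> \<delta> * sqrt (sq_norm_on S x) * sqrt (sq_norm_on T y)"
proof (cases "sq_norm_on S x = 0 \<or> sq_norm_on T y = 0")
  case True
  then have "(\<forall>i\<in>S. x i = 0) \<or> (\<forall>j\<in>T. y j = 0)"
    using fin by (auto simp: sq_norm_on_def sum_nonneg_eq_0_iff)
  then have "bilin S T M x y = 0" by (auto simp: bilin_def)
  then show ?thesis using True by auto
next
  case False
  define a where "a = sqrt (sq_norm_on S x)"
  define b where "b = sqrt (sq_norm_on T y)"
  have "sq_norm_on S x > 0" "sq_norm_on T y > 0"
    using False sq_norm_on_nonneg[of S x] sq_norm_on_nonneg[of T y] by linarith+
  then have ab: "a > 0" "b > 0" "a\<^sup>2 = sq_norm_on S x" "b\<^sup>2 = sq_norm_on T y"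
    by (auto simp: a_def b_def)
  define x' where "x' i = of_real (1 / a) * x i" for i
  define y' where "y' i = of_real (1 / b) * y i" for i
  have "orthonormal_on S (Suc K) (u(K := x'))"
  proof (rule orthonormal_on_extend[OF u])
    show "sq_norm_on S x' = 1" unfolding x'_def sq_norm_on_scale using ab
      by (simp add: norm_divide power_divide flip: ab(3))
    show "(\<Sum>i\<in>S. x' i * cnj (u k i)) = 0" if "k < K" for k
      using x[OF that] by (simp add: x'_def mult.assoc flip: sum_divide_distrib)
  qed
  moreover have "orthonormal_on T (Suc K) (v(K := y'))"
  proof (rule orthonormal_on_extend[OF v])
    show "sq_norm_on T y' = 1" unfolding y'_def sq_norm_on_scale using ab
      by (simp add: norm_divide power_divide flip: ab(4))
    show "(\<Sum>i\<in>T. y' i * cnj (v k i)) = 0" if "k < K" for k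
      using y[OF that] by (simp add: y'_def mult.assoc flip: sum_divide_distrib)
  qed
  ultimately obtain k where k: "k < Suc K" "cmod (bilin S T M ((u(K := x')) k) ((v(K := y')) k)) \<le> \<delta>"
    using max by blast
  have "k = K" using k big[of k] by (cases "k = K") auto
  then have "cmod (bilin S T M x' y') \<le> \<delta>" using k by simp
  moreover have "bilin S T M x' y' = of_real (1 / a) * of_real (1 / b) * bilin S T M x y"
    unfolding x'_def y'_def by (rule bilin_scale)
  ultimately have "cmod (bilin S T M x y) / (a * b) \<le> \<delta>"
    using ab by (simp add: norm_mult norm_divide)
  then show ?thesis using ab by (simp add: a_def[symmetric] b_def[symmetric] divide_simps mult_ac)
qed

text \<open>A maximal pair of orthonormal families whose members are all paired above the threshold
  \<open>\<delta>\<close> has at most \<open>\<tau> / \<delta>\<close> members; on its orthogonal complement the form is bounded by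
  \<open>\<delta>\<close>. This replaces the singular value decomposition.\<close>

lemma rank_norm_split_of_trace_bound:
  assumes M: "trace_bound S T \<tau> M" and "\<delta> > 0" and fin: "finite S" "finite T"
  obtains r where "rank_norm_split S T r \<delta> M" "real r * \<delta> \<le> 2 * \<tau>"
proof -
  define P where "P K \<longleftrightarrow> (\<exists>u v. orthonormal_on S K u \<and> orthonormal_on T K v \<and>
      (\<forall>k<K. cmod (bilin S T M (u k) (v k)) > \<delta>))" for K
  have P0: "P 0" by (auto simp: P_def orthonormal_on_def)
  have "K < Suc (card S)" if "P K" for K
    using that orthonormal_on_card_le[OF _ fin(1)] by (auto simp: P_def less_Suc_eq_le)
  then obtain K where K: "P K" and maxK: "\<And>L. P L \<Longrightarrow> L \<le> K"
    using ex_has_greatest_nat[of P 0 "\<lambda>k. k" "Suc (card S)"] P0 by blast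
  obtain u v where u: "orthonormal_on S K u" and v: "orthonormal_on T K v" and
    big: "\<And>k. k < K \<Longrightarrow> cmod (bilin S T M (u k) (v k)) > \<delta>"
    using K unfolding P_def by blast
  have max: "\<exists>k<Suc K. cmod (bilin S T M (u' k) (v' k)) \<le> \<delta>"
    if "orthonormal_on S (Suc K) u'" "orthonormal_on T (Suc K) v'" for u' v'
    using that maxK[of "Suc K"] unfolding P_def by (meson Suc_n_not_le_n not_le)
  have "real K * \<delta> = (\<Sum>k<K. \<delta>)" by simp
  also have "\<dots> \<le> (\<Sum>k<K. cmod (bilin S T M (u k) (v k)))"
    by (intro sum_mono) (use big in \<open>auto intro: less_imp_le\<close>)
  also have "\<dots> \<le> \<tau>" by (rule trace_boundD[OF M u v])
  finally have Kd: "real K * \<delta> \<le> \<tau>" .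
  \<comment> \<open>From here on \<open>P\<close> is a matrix: acting on row vectors,
    \<open>P\<close> and \<open>Q\<close> are the projections \<open>residual\<close>. Thus
    \<open>N\<close> is the compression of \<open>M\<close> to the complements of the two families,
    and its form at \<open>x\<close>, \<open>y\<close> is that of \<open>M\<close> at their
    residuals.\<close>
  define P where "P i i' = (if i = i' then 1 else 0) - (\<Sum>k<K. cnj (u k i) * u k i')" for i i'
  define Q where "Q j j' = (if j = j' then 1 else 0) - (\<Sum>k<K. cnj (v k j) * v k j')" for j j'
  define N where "N i j = (\<Sum>i'\<in>S. \<Sum>j'\<in>T. P i i' * M i' j' * Q j j')" for i j
  have Px: "(\<Sum>i\<in>S. x i * P i i') = residual S K u x i'" if "i' \<in> S" for x i'
  proof -
    have "(\<Sum>i\<in>S. x i * P i i') = (\<Sum>i\<in>S. if i = i' then x i else 0) - (\<Sum>i\<in>S. \<Sum>k<K. x i * cnj (u k i) * u k i')"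
      unfolding sum_subtractf[symmetric]
      by (intro sum.cong refl) (simp add: P_def right_diff_distrib sum_distrib_left mult.assoc)
    also have "(\<Sum>i\<in>S. if i = i' then x i else 0) = x i'" using that fin by simp
    finally show ?thesis unfolding residual_def by (subst (asm) sum.swap) (simp add: sum_distrib_right)
  qed
  have Qy: "(\<Sum>j\<in>T. y j * Q j j') = residual T K v y j'" if "j' \<in> T" for y j'
  proof -
    have "(\<Sum>i\<in>T. y i * Q i j') = (\<Sum>i\<in>T. if i = j' then y i else 0) - (\<Sum>i\<in>T. \<Sum>k<K. y i * cnj (v k i) * v k j')"
      unfolding sum_subtractf[symmetric]
      by (intro sum.cong refl) (simp add: Q_def right_diff_distrib sum_distrib_left mult.assoc)
    also have "(\<Sum>i\<in>T. if i = j' then y i else 0) = y j'" using that fin by simp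
    finally show ?thesis unfolding residual_def by (subst (asm) sum.swap) (simp add: sum_distrib_right)
  qed
  have N: "norm_bound S T \<delta> N"
    unfolding norm_bound_def
  proof (intro allI)
    fix x y
    let ?x = "residual S K u x" and ?y = "residual T K v y"
    have "bilin S T N x y = (\<Sum>i\<in>S. \<Sum>j\<in>T. \<Sum>i'\<in>S. \<Sum>j'\<in>T. (x i * P i i') * M i' j' * (y j * Q j j'))"
      by (simp add: bilin_def N_def sum_distrib_left sum_distrib_right mult_ac)
    also have "\<dots> = (\<Sum>i\<in>S. \<Sum>i'\<in>S. \<Sum>j'\<in>T. \<Sum>j\<in>T. (x i * P i i') * M i' j' * (y j * Q j j'))"
      by (intro sum.cong refl, subst sum.swap, intro sum.cong refl sum.swap)
    also have "\<dots> = (\<Sum>i'\<in>S. \<Sum>j'\<in>T. \<Sum>i\<in>S. \<Sum>j\<in>T. (x i * P i i') * M i' j' * (y j * Q j j'))"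
      by (subst sum.swap, intro sum.cong refl sum.swap)
    also have "\<dots> = (\<Sum>i'\<in>S. \<Sum>j'\<in>T. (\<Sum>i\<in>S. x i * P i i') * M i' j' * (\<Sum>j\<in>T. y j * Q j j'))"
      by (simp only: sum_distrib_right) (simp only: sum_distrib_left)
    also have "\<dots> = bilin S T M ?x ?y"
      unfolding bilin_def by (intro sum.cong refl) (simp add: Px Qy)
    finally have "cmod (bilin S T N x y) = cmod (bilin S T M ?x ?y)" by simp
    also have "\<dots> \<le> \<delta> * sqrt (sq_norm_on S ?x) * sqrt (sq_norm_on T ?y)"
      by (rule norm_bound_orthogonal_complement[OF max u v big])
         (use residual_orthogonal[OF u] residual_orthogonal[OF v] fin in auto)
    also have "\<dots> \<le> \<delta> * sqrt (sq_norm_on S x) * sqrt (sq_norm_on T y)"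
      using sq_norm_residual_le[OF u] sq_norm_residual_le[OF v] \<open>\<delta> > 0\<close>
      by (intro mult_mono) auto
    finally show "cmod (bilin S T N x y) \<le> \<delta> * sqrt (sq_norm_on S x) * sqrt (sq_norm_on T y)" .
  qed
  \<comment> \<open>In matrix notation \<open>N\<close> is P M Q' with Q' the transpose of
    \<open>Q\<close>, and M - P M Q' = (1 - P) M + P M (1 - Q'). The two summands are
    \<open>R1\<close> and \<open>R2\<close>. Each has rank at most \<open>K\<close>, whence the
    factor 2 in front of \<tau>.\<close>
  define R1 where "R1 i j = (\<Sum>k<K. cnj (u k i) * (\<Sum>i'\<in>S. u k i' * M i' j))" for i j
  define R2 where "R2 i j = (\<Sum>k<K. (\<Sum>i'\<in>S. \<Sum>j'\<in>T. P i i' * M i' j' * v k j') * cnj (v k j))" for i j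
  have R12: "M i j = R1 i j + R2 i j + N i j" if i: "i \<in> S" and j: "j \<in> T" for i j
  proof -
    have "N i j = (\<Sum>i'\<in>S. \<Sum>j'\<in>T. P i i' * M i' j' * (if j = j' then 1 else 0)) -
        (\<Sum>i'\<in>S. \<Sum>j'\<in>T. \<Sum>k<K. P i i' * M i' j' * v k j' * cnj (v k j))"
      unfolding N_def Q_def right_diff_distrib sum_subtractf sum_distrib_left by (simp only: mult_ac)
    moreover have "(\<Sum>i'\<in>S. \<Sum>j'\<in>T. \<Sum>k<K. P i i' * M i' j' * v k j' * cnj (v k j)) = R2 i j"
    proof -
      have "(\<Sum>i'\<in>S. \<Sum>j'\<in>T. \<Sum>k<K. P i i' * M i' j' * v k j' * cnj (v k j)) =
        (\<Sum>i'\<in>S. \<Sum>k<K. \<Sum>j'\<in>T. P i i' * M i' j' * v k j' * cnj (v k j))"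
        by (intro sum.cong refl sum.swap)
      also have "\<dots> = (\<Sum>k<K. \<Sum>i'\<in>S. \<Sum>j'\<in>T. P i i' * M i' j' * v k j' * cnj (v k j))"
        by (rule sum.swap)
      finally show ?thesis by (simp add: R2_def sum_distrib_right)
    qed
    moreover have "(\<Sum>i'\<in>S. \<Sum>j'\<in>T. P i i' * M i' j' * (if j = j' then 1 else 0)) = (\<Sum>i'\<in>S. P i i' * M i' j)"
    proof (intro sum.cong refl)
      fix i' assume "i' \<in> S"
      have "(\<Sum>j'\<in>T. P i i' * M i' j' * (if j = j' then 1 else 0)) = (\<Sum>j'\<in>T. if j = j' then P i i' * M i' j' else 0)"
        by (intro sum.cong refl) simp
      then show "(\<Sum>j'\<in>T. P i i' * M i' j' * (if j = j' then 1 else 0)) = P i i' * M i' j"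
        using fin j by simp
    qed
    moreover have "(\<Sum>i'\<in>S. P i i' * M i' j) = (\<Sum>i'\<in>S. (if i = i' then 1 else 0) * M i' j) -
        (\<Sum>i'\<in>S. \<Sum>k<K. cnj (u k i) * u k i' * M i' j)"
      by (simp only: P_def left_diff_distrib sum_subtractf sum_distrib_right)
    moreover have "(\<Sum>i'\<in>S. (if i = i' then 1 else 0) * M i' j) = M i j"
    proof -
      have "(\<Sum>i'\<in>S. (if i = i' then 1 else 0) * M i' j) = (\<Sum>i'\<in>S. if i = i' then M i' j else 0)"
        by (intro sum.cong refl) simp
      then show ?thesis using fin i by simp
    qed
    moreover have "(\<Sum>i'\<in>S. \<Sum>k<K. cnj (u k i) * u k i' * M i' j) = R1 i j"
      by (subst sum.swap) (simp add: R1_def sum_distrib_left mult.assoc)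
    ultimately show ?thesis by (simp only:) simp
  qed
  have R: "low_rank S T K R1" "low_rank S T K R2"
    using low_rank_sum_products[of S T K "\<lambda>k i. cnj (u k i)" "\<lambda>k j. \<Sum>i'\<in>S. u k i' * M i' j"]
      low_rank_sum_products[of S T K "\<lambda>k i. \<Sum>i'\<in>S. \<Sum>j'\<in>T. P i i' * M i' j' * v k j'" "\<lambda>k j. cnj (v k j)"]
    by (simp_all add: R1_def[abs_def] R2_def[abs_def])
  have "rank_norm_split S T (K + K) \<delta> M"
    using low_rank_add[OF R] N by (rule rank_norm_splitI) (rule R12)
  moreover have "real (K + K) * \<delta> \<le> 2 * \<tau>" using Kd by (simp add: ring_distribs)
  ultimately show thesis by (rule that)
qed

text \<open>Every pairing is at most the length of \<open>M\<close> applied to \<open>v k\<close>,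
  and by Bessel in each row the squares of these lengths sum to at most \<open>F\<close>.
  Cauchy-Schwarz over \<open>k\<close> would now give the root of \<open>card S * F\<close>; the
  free parameter \<delta> replaces the root by an expression linear in \<open>F\<close>, so that
  o(n) for \<open>F\<close> passes to the trace norm at once.\<close>

lemma trace_bound_frobenius:
  assumes fin: "finite S" "finite T" and "\<delta> > 0"
    and F: "(\<Sum>i\<in>S. \<Sum>j\<in>T. (cmod (M i j))\<^sup>2) \<le> F"
  shows "trace_bound S T (\<delta> * real (card S) + F / \<delta>) M"
  unfolding trace_bound_def
proof (intro allI impI)
  fix K u v assume u: "orthonormal_on S K u" and v: "orthonormal_on T K v"
  define w where "w k i = (\<Sum>j\<in>T. M i j * v k j)" for k i
  have *: "cmod (bilin S T M (u k) (v k)) \<le> \<delta> + sq_norm_on S (w k) / \<delta>" if "k < K" for k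
  proof -
    define q where "q = sqrt (sq_norm_on S (w k))"
    have "bilin S T M (u k) (v k) = (\<Sum>i\<in>S. u k i * w k i)"
      by (simp add: bilin_def w_def sum_distrib_left mult.assoc)
    then have "cmod (bilin S T M (u k) (v k)) \<le> q"
      using cauchy_schwarz_on[of "u k" "w k" S] orthonormal_on_sq_norm[OF u that] by (simp add: q_def)
    \<comment> \<open>Amounts to q^2 - q \<delta> + \<delta>^2 \<ge> 0. Sharp constants are
      irrelevant for an o(n) bound.\<close>
    also have "q \<le> \<delta> + q\<^sup>2 / \<delta>"
    proof -
      have "0 \<le> (q - \<delta>)\<^sup>2 + q * \<delta>" using \<open>\<delta> > 0\<close> by (simp add: q_def)
      then show ?thesis using \<open>\<delta> > 0\<close> by (simp add: field_simps power2_eq_square)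
    qed
    finally show ?thesis by (simp add: q_def)
  qed
  have "(\<Sum>k<K. sq_norm_on S (w k)) = (\<Sum>i\<in>S. \<Sum>k<K. (cmod (\<Sum>j\<in>T. M i j * v k j))\<^sup>2)"
    unfolding sq_norm_on_def w_def by (rule sum.swap)
  also have "\<dots> \<le> (\<Sum>i\<in>S. sq_norm_on T (M i))"
    by (intro sum_mono bessel_on[OF v])
  also have "\<dots> \<le> F" using F by (simp add: sq_norm_on_def)
  finally have w: "(\<Sum>k<K. sq_norm_on S (w k)) \<le> F" .
  have "(\<Sum>k<K. cmod (bilin S T M (u k) (v k))) \<le> (\<Sum>k<K. \<delta> + sq_norm_on S (w k) / \<delta>)"
    by (intro sum_mono *) auto
  also have "\<dots> = \<delta> * real K + (\<Sum>k<K. sq_norm_on S (w k)) / \<delta>"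
    by (simp add: sum.distrib sum_divide_distrib)
  also have "\<dots> \<le> \<delta> * real (card S) + F / \<delta>"
    using w orthonormal_on_card_le[OF u fin(1)] \<open>\<delta> > 0\<close> by (intro add_mono mult_left_mono divide_right_mono) auto
  finally show "(\<Sum>k<K. cmod (bilin S T M (u k) (v k))) \<le> \<delta> * real (card S) + F / \<delta>" .
qed

subsection \<open>Sampling an almost everywhere continuous function\<close>

text \<open>Near a point of continuity \<open>a\<close> is bounded, so the points approached by
  arbitrarily large values form a null set. Shrinking open neighbourhoods of the sets of large
  values therefore have measure tending to 0. Every large sample puts a whole grid cell into such a
  neighbourhood, which turns the measure into a count.\<close>

lemma continuous_ae_sparsely_unbounded:
  assumes a: "continuous_ae a" and "\<epsilon> > 0"
  obtains B N where "B > 0"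
    "\<And>n. n \<ge> N \<Longrightarrow> real (card {i \<in> {1..n}. cmod (a (real i / real n)) > B}) \<le> \<epsilon> * real n"
proof -
  define Y where "Y m = {y \<in> {0..1}. cmod (a y) > real (Suc m)}" for m
  \<comment> \<open>The radius shrinks while the threshold in \<open>Y\<close> grows: a point in all
    \<open>E m\<close> is the limit of points \<open>y m\<close> at which \<open>a\<close> tends to
    infinity in modulus, hence a discontinuity.\<close>
  define E where "E m = (\<Union>y\<in>Y m. ball y (2 / real (Suc m)))" for m
  have E_open: "open (E m)" for m unfolding E_def by (intro open_UN ballI open_ball)
  then have E_sets: "range E \<subseteq> sets lebesgue" by (auto intro: borel_open)
  have E_dec: "decseq E"
    unfolding decseq_Suc_iff
  proof (intro allI subsetI)
    fix m x assume "x \<in> E (Suc m)"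
    then obtain y where y: "y \<in> Y (Suc m)" "dist y x < 2 / real (Suc (Suc m))" by (auto simp: E_def)
    have "2 / real (Suc (Suc m)) \<le> 2 / real (Suc m)" by (intro divide_left_mono) auto
    then show "x \<in> E m" using y by (auto simp: E_def Y_def intro!: bexI[of _ y])
  qed
  \<comment> \<open>Finite measure is what continuity of the measure along a decreasing sequence
    requires.\<close>
  have E_lm: "E m \<in> lmeasurable" for m
  proof (rule bounded_set_imp_lmeasurable)
    have "x \<in> cball 0 3" if x: "x \<in> E m" for x
    proof -
      obtain y where "0 \<le> y" "y \<le> 1" and y: "dist y x < 2 / real (Suc m)"
        using x by (auto simp: E_def Y_def)
      moreover have "2 / real (Suc m) \<le> 2" by (simp add: field_simps)
      ultimately show ?thesis by (auto simp: dist_real_def)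
    qed
    then show "bounded (E m)" by (meson bounded_cball bounded_subset subsetI)
  qed (use E_sets in auto)
  have "negligible (\<Inter>m. E m)"
  proof (rule negligible_subset)
    obtain N where "N \<in> null_sets (lebesgue_on {0..1})" "{x \<in> {0..1}. \<not> continuous (at x within {0..1}) a} \<subseteq> N"
      using a unfolding continuous_ae_def eventually_ae_filter by auto
    then show "negligible {x \<in> {0..1}. \<not> continuous (at x within {0..1}) a}"
      by (metis atLeastAtMost_borel negligible_iff_null_sets negligible_subset null_sets_restrict_space
          sets_completionI_sets sets_lborel)
    show "(\<Inter>m. E m) \<subseteq> {x \<in> {0..1}. \<not> continuous (at x within {0..1}) a}"
    proof
      fix x assume "x \<in> (\<Inter>m. E m)"
      then have "\<forall>m. \<exists>y\<in>Y m. dist y x < 2 / real (Suc m)" by (auto simp: E_def)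
      then obtain y where y: "\<And>m. y m \<in> Y m" "\<And>m. dist (y m) x < 2 / real (Suc m)" by metis
      have y01: "y m \<in> {0..1}" and big: "cmod (a (y m)) > real (Suc m)" for m
        using y(1)[of m] by (auto simp: Y_def)
      have lim: "y \<longlonglongrightarrow> x"
      proof (rule metric_tendsto_imp_tendsto)
        show "(\<lambda>m. 2 / real (Suc m)) \<longlonglongrightarrow> 0" by real_asymp
        show "\<forall>\<^sub>F m in sequentially. dist (y m) x \<le> dist (2 / real (Suc m)) 0"
          using y(2) by (auto simp: less_imp_le)
      qed
      have x01: "x \<in> {0..1}"
        by (rule closed_sequentially[OF closed_atLeastAtMost _ lim]) (use y01 in auto)
      have "\<not> continuous (at x within {0..1}) a"
      proof
        assume "continuous (at x within {0..1}) a"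
        then have "(\<lambda>m. a (y m)) \<longlonglongrightarrow> a x"
          using lim y01 unfolding continuous_within_sequentially by (auto simp: o_def)
        then have "Bseq (\<lambda>m. a (y m))" by (intro convergent_imp_Bseq convergentI)
        then obtain K where "\<And>m. cmod (a (y m)) \<le> K" unfolding Bseq_def by auto
        moreover obtain m where "K < real m" using reals_Archimedean2 by blast
        ultimately show False using big[of m] by (smt (verit) of_nat_Suc)
      qed
      with x01 show "x \<in> {x \<in> {0..1}. \<not> continuous (at x within {0..1}) a}" by simp
    qed
  qed
  moreover have "(\<lambda>m. measure lebesgue (E m)) \<longlonglongrightarrow> measure lebesgue (\<Inter>m. E m)"
    using fmeasurableD2[OF E_lm] by (intro Lim_measure_decseq E_sets E_dec) (simp only: infinity_ennreal_def not_False_eq_True)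
  ultimately have "(\<lambda>m. measure lebesgue (E m)) \<longlonglongrightarrow> 0"
    by (simp add: negligible_imp_measure0)
  then have "\<forall>\<^sub>F m in sequentially. measure lebesgue (E m) < \<epsilon>"
    using \<open>\<epsilon> > 0\<close> by (rule order_tendstoD)
  then obtain m where m: "measure lebesgue (E m) < \<epsilon>"
    unfolding eventually_sequentially by auto
  show thesis
  \<comment> \<open>For \<open>n \<ge> Suc m\<close> a grid cell has length at most
    \<open>1 / real (Suc m)\<close>, so it fits into the ball of radius
    \<open>2 / real (Suc m)\<close> around its sample point.\<close>
  proof (rule that[of "real (Suc m)" "Suc m"])
    fix n assume n: "n \<ge> Suc m"
    define J where "J = {i \<in> {1..n}. cmod (a (real i / real n)) > real (Suc m)}"
    \<comment> \<open>The open cell to the left of the sample point. Open cells are disjoint, so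
      their lengths add up to the number of large samples divided by \<open>n\<close>.\<close>
    define A where "A i = {(real i - 1) / real n <..< real i / real n}" for i :: nat
    have "n > 0" using n by simp
    have "(\<Union>i\<in>J. A i) \<subseteq> E m"
    proof
      fix x assume "x \<in> (\<Union>i\<in>J. A i)"
      then obtain i where i: "i \<in> J" "x \<in> A i" by blast
      have "dist (real i / real n) x < 1 / real n"
        using i(2) by (auto simp: A_def dist_real_def diff_divide_distrib abs_if)
      also have "\<dots> \<le> 2 / real (Suc m)" using n by (intro frac_le) auto
      finally have "x \<in> ball (real i / real n) (2 / real (Suc m))" by simp
      moreover have "real i / real n \<in> Y m" using i(1) by (auto simp: J_def Y_def)
      ultimately show "x \<in> E m" by (auto simp: E_def)
    qed
    moreover have "measure lebesgue (\<Union>i\<in>J. A i) = (\<Sum>i\<in>J. measure lebesgue (A i))"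
    proof (rule measure_finite_Union)
      show "disjoint_family_on A J"
        unfolding disjoint_family_on_def
      proof (intro ballI impI)
        fix i j :: nat assume "i \<noteq> j"
        then have "i < j \<or> j < i" by auto
        then have "real i \<le> real j - 1 \<or> real j \<le> real i - 1" by auto
        then have "real i / real n \<le> (real j - 1) / real n \<or> real j / real n \<le> (real i - 1) / real n"
          by (auto intro: divide_right_mono)
        then show "A i \<inter> A j = {}" unfolding A_def by auto
      qed
      show "emeasure lebesgue (A i) \<noteq> \<infinity>" for i
        unfolding infinity_ennreal_def A_def by (metis box_real(1) fmeasurableD2 lmeasurable_box)
    qed (auto simp: J_def A_def)
    moreover have "measure lebesgue (A i) = 1 / real n" for i
      using \<open>n > 0\<close> by (simp add: A_def diff_divide_distrib divide_right_mono)
    moreover have "(\<Union>i\<in>J. A i) \<in> sets lebesgue"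
      by (auto simp: A_def J_def intro!: sets.finite_UN)
    ultimately have "real (card J) / real n \<le> measure lebesgue (E m)"
      using measure_mono_fmeasurable[OF _ _ E_lm[of m], of "\<Union>i\<in>J. A i"] by simp
    then show "real (card J) \<le> \<epsilon> * real n"
      using mult_strict_right_mono[OF m, of "real n"] \<open>n > 0\<close>
      unfolding pos_divide_le_eq[OF of_nat_0_less_iff[THEN iffD2, OF \<open>n > 0\<close>]] by linarith
  qed (simp)
qed

subsection \<open>Fourier coefficients\<close>

abbreviation period_measure :: "real measure" where
  "period_measure \<equiv> lebesgue_on {-pi..pi}"

definition fourier :: "(real \<Rightarrow> complex) \<Rightarrow> int \<Rightarrow> complex" where
  "fourier g k = 1 / (2 * of_real pi) *
     integral\<^sup>L period_measure (\<lambda>\<theta>. g \<theta> * exp (- \<i> * of_int k * of_real \<theta>))"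

lemma cmod_exp_imaginary [simp]:
  "cmod (exp (- (\<i> * of_int k * of_real \<theta>))) = 1" "cmod (exp (\<i> * of_int k * of_real \<theta>)) = 1"
  by (simp_all add: norm_exp_eq_Re)

lemma integrable_mult_continuous_bounded:
  fixes g \<phi> :: "real \<Rightarrow> complex"
  assumes "integrable period_measure g" "continuous_on {-pi..pi} \<phi>" "\<And>\<theta>. cmod (\<phi> \<theta>) \<le> C"
  shows "integrable period_measure (\<lambda>\<theta>. g \<theta> * \<phi> \<theta>)"
proof (rule Bochner_Integration.integrable_bound)
  show "integrable period_measure (\<lambda>\<theta>. of_real C * g \<theta>)" using assms(1) by simp
  have "\<phi> \<in> borel_measurable period_measure"
    by (intro continuous_imp_measurable_on_sets_lebesgue assms(2)) auto
  then show "(\<lambda>\<theta>. g \<theta> * \<phi> \<theta>) \<in> borel_measurable period_measure" using assms(1) by measurable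
  have "0 \<le> C" using assms(3)[of 0] norm_ge_zero order_trans by blast
  then show "AE \<theta> in period_measure. cmod (g \<theta> * \<phi> \<theta>) \<le> cmod (of_real C * g \<theta>)"
    using assms(3) by (auto simp: norm_mult mult.commute[of "cmod (g _)"] intro!: mult_right_mono AE_I2)
qed

lemma integral_exp_period:
  "integral\<^sup>L period_measure (\<lambda>\<theta>. exp (\<i> * of_int k * of_real \<theta>)) = (if k = 0 then 2 * of_real pi else 0)"
proof -
  have int: "integrable period_measure (\<lambda>\<theta>. exp (\<i> * of_int k * of_real \<theta>))"
    by (intro continuous_imp_integrable_real continuous_intros)
  show ?thesis
  proof (cases "k = 0")
    case True
    then show ?thesis by (simp add: measure_restrict_space scaleR_conv_of_real)
  next
    case False
    let ?F = "\<lambda>\<theta>::real. exp (\<i> * of_int k * of_real \<theta>) / (\<i> * of_int k)"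
    have "((\<lambda>\<theta>. exp (\<i> * of_int k * of_real \<theta>)) has_integral (?F pi - ?F (- pi))) {-pi..pi}"
    proof (rule fundamental_theorem_of_calculus)
      fix x :: real
      have "((\<lambda>z. exp (\<i> * of_int k * z) / (\<i> * of_int k)) has_field_derivative exp (\<i> * of_int k * of_real x)) (at (of_real x))"
        using False by (auto intro!: derivative_eq_intros)
      then show "(?F has_vector_derivative exp (\<i> * of_int k * of_real x)) (at x within {-pi..pi})"
        using has_vector_derivative_real_field[of "\<lambda>z. exp (\<i> * of_int k * z) / (\<i> * of_int k)"]
        by (auto simp: o_def intro: has_vector_derivative_at_within)
    qed simp
    moreover have "?F pi - ?F (- pi) = 0"
    proof -
      have "exp (\<i> * of_int k * of_real pi) = exp (\<i> * of_int k * of_real (- pi) + of_int (2 * k) * (of_real pi * \<i>))"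
        by (simp add: algebra_simps)
      also have "\<dots> = exp (\<i> * of_int k * of_real (- pi))"
        using exp_plus_2pin[of "\<i> * of_int k * of_real (- pi)" k] by (simp add: algebra_simps)
      finally show ?thesis by simp
    qed
    ultimately have "integral {-pi..pi} (\<lambda>\<theta>. exp (\<i> * of_int k * of_real \<theta>)) = 0"
      by (metis integral_unique)
    then show ?thesis using False lebesgue_integral_eq_integral[OF int] by simp
  qed
qed

text \<open>The squared distance from \<open>g\<close> to its Fourier polynomial over
  \<open>L\<close> is nonnegative, and the mean of the squared modulus of \<open>g\<close> is at
  most the square of \<open>B\<close>. Finite sets \<open>L\<close> suffice, so no convergence of
  Fourier series is involved.\<close>

lemma fourier_bessel:
  assumes g: "integrable period_measure g" and B: "\<And>\<theta>. cmod (g \<theta>) \<le> B" and L: "finite L"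
  shows "(\<Sum>k\<in>L. (cmod (fourier g k))\<^sup>2) \<le> B\<^sup>2"
proof -
  define e where "e k \<theta> = exp (\<i> * of_int k * complex_of_real \<theta>)" for k :: int and \<theta> :: real
  have e_cont: "continuous_on {-pi..pi} (e k)" for k unfolding e_def by (intro continuous_intros)
  have e_norm: "cmod (e k \<theta>) = 1" for k \<theta> by (simp add: e_def)
  have e_cnj: "cnj (e k \<theta>) = exp (- \<i> * of_int k * of_real \<theta>)" for k \<theta>
    by (simp add: e_def exp_cnj)
  define c where "c = fourier g"
  have ge: "integral\<^sup>L period_measure (\<lambda>\<theta>. g \<theta> * cnj (e k \<theta>)) = 2 * of_real pi * c k" for k
    by (simp add: c_def fourier_def e_cnj)
  have ge_int: "integrable period_measure (\<lambda>\<theta>. g \<theta> * cnj (e k \<theta>))" for k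
    by (rule integrable_mult_continuous_bounded[OF g, of _ 1])
      (auto intro!: continuous_intros e_cont simp: e_norm)
  have ee: "e k \<theta> * cnj (e l \<theta>) = e (k - l) \<theta>" for k l \<theta>
    unfolding e_cnj unfolding e_def by (simp add: exp_add[symmetric] algebra_simps)
  have e_int: "integrable period_measure (e k)" for k
    by (intro continuous_imp_integrable_real e_cont)
  have e0: "integral\<^sup>L period_measure (e k) = (if k = 0 then 2 * of_real pi else 0)" for k
    unfolding e_def by (rule integral_exp_period)
  define p where "p \<theta> = (\<Sum>k\<in>L. c k * e k \<theta>)" for \<theta>
  have p_mult: "p \<theta> * z = (\<Sum>k\<in>L. c k * (e k \<theta> * z))"
    and cnj_p_mult: "z * cnj (p \<theta>) = (\<Sum>k\<in>L. cnj (c k) * (z * cnj (e k \<theta>)))" for z \<theta>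
    by (simp_all add: p_def sum_distrib_left sum_distrib_right mult_ac)
  have p_cont: "continuous_on {-pi..pi} p" unfolding p_def by (intro continuous_intros e_cont)
  have gc_int: "integrable period_measure (\<lambda>\<theta>. cnj (g \<theta>))" using g by simp
  have orth: "integral\<^sup>L period_measure (\<lambda>\<theta>. (g \<theta> - p \<theta>) * cnj (e l \<theta>)) = 0" if "l \<in> L" for l
  proof -
    have "(\<lambda>\<theta>. (g \<theta> - p \<theta>) * cnj (e l \<theta>)) = (\<lambda>\<theta>. g \<theta> * cnj (e l \<theta>) - (\<Sum>k\<in>L. c k * e (k - l) \<theta>))"
      by (simp add: fun_eq_iff p_def left_diff_distrib sum_distrib_right ee[symmetric] mult.assoc)
    then have "integral\<^sup>L period_measure (\<lambda>\<theta>. (g \<theta> - p \<theta>) * cnj (e l \<theta>)) =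
        2 * of_real pi * c l - (\<Sum>k\<in>L. c k * (if k = l then 2 * of_real pi else 0))"
      using ge_int e_int by (simp add: ge e0)
    also have "(\<Sum>k\<in>L. c k * (if k = l then 2 * of_real pi else 0)) = (\<Sum>k\<in>L. if k = l then c k * (2 * of_real pi) else 0)"
      by (intro sum.cong) auto
    also have "\<dots> = c l * (2 * of_real pi)" using L that by simp
    finally show ?thesis by simp
  qed
  have orth_int: "integrable period_measure (\<lambda>\<theta>. (g \<theta> - p \<theta>) * cnj (e l \<theta>))" for l
  proof (rule integrable_mult_continuous_bounded[of _ _ 1])
    show "integrable period_measure (\<lambda>\<theta>. g \<theta> - p \<theta>)"
      using g continuous_imp_integrable_real[OF p_cont] by auto
  qed (auto intro!: continuous_intros e_cont simp: e_norm)
  \<comment> \<open>Here boundedness enters: the square of the modulus is dominated by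
    \<open>B\<close> times the modulus, which is integrable.\<close>
  have gg_int: "integrable period_measure (\<lambda>\<theta>. (cmod (g \<theta>))\<^sup>2)"
  proof (rule Bochner_Integration.integrable_bound[of _ "\<lambda>\<theta>. B * cmod (g \<theta>)"])
    show "(\<lambda>\<theta>. (cmod (g \<theta>))\<^sup>2) \<in> borel_measurable period_measure" using g by measurable
    show "AE x in period_measure. norm ((cmod (g x))\<^sup>2) \<le> norm (B * cmod (g x))"
    proof (intro AE_I2)
      fix x
      have "cmod (g x) * cmod (g x) \<le> B * cmod (g x)" using B by (intro mult_right_mono) auto
      then show "norm ((cmod (g x))\<^sup>2) \<le> norm (B * cmod (g x))" by (simp add: power2_eq_square)
    qed
  qed (use g in auto)
  have ggc_int: "integrable period_measure (\<lambda>\<theta>. g \<theta> * cnj (g \<theta>))"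
    using integrable_of_real[OF gg_int, where 'a = complex] by (simp add: complex_norm_square del: of_real_power)
  have gcp_int: "integrable period_measure (\<lambda>\<theta>. cnj (g \<theta> * cnj (e k \<theta>)))" for k
    using ge_int[of k] by (rule integrable_cnj)
  have "integral\<^sup>L period_measure (\<lambda>\<theta>. (g \<theta> - p \<theta>) * cnj (p \<theta>)) =
      integral\<^sup>L period_measure (\<lambda>\<theta>. \<Sum>k\<in>L. cnj (c k) * ((g \<theta> - p \<theta>) * cnj (e k \<theta>)))"
    by (simp only: cnj_p_mult)
  also have "\<dots> = 0" using orth_int orth by simp
  finally have gp_p: "integral\<^sup>L period_measure (\<lambda>\<theta>. (g \<theta> - p \<theta>) * cnj (p \<theta>)) = 0" .
  have gp_p_int: "integrable period_measure (\<lambda>\<theta>. (g \<theta> - p \<theta>) * cnj (p \<theta>))"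
  proof -
    have "(\<lambda>\<theta>. (g \<theta> - p \<theta>) * cnj (p \<theta>)) = (\<lambda>\<theta>. \<Sum>k\<in>L. cnj (c k) * ((g \<theta> - p \<theta>) * cnj (e k \<theta>)))"
      by (simp only: cnj_p_mult)
    then show ?thesis using orth_int by simp
  qed
  have gp_g: "(\<lambda>\<theta>. (g \<theta> - p \<theta>) * cnj (g \<theta>)) =
      (\<lambda>\<theta>. g \<theta> * cnj (g \<theta>) - (\<Sum>k\<in>L. c k * cnj (g \<theta> * cnj (e k \<theta>))))"
    by (simp only: left_diff_distrib p_mult) (simp add: mult_ac)
  \<comment> \<open>The error \<open>g - p\<close> is orthogonal to \<open>p\<close>, so its squared
    norm equals its pairing with \<open>g\<close> alone.\<close>
  have "complex_of_real (integral\<^sup>L period_measure (\<lambda>\<theta>. (cmod (g \<theta> - p \<theta>))\<^sup>2)) =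
      integral\<^sup>L period_measure (\<lambda>\<theta>. (g \<theta> - p \<theta>) * cnj (g \<theta>) - (g \<theta> - p \<theta>) * cnj (p \<theta>))"
    unfolding integral_complex_of_real[symmetric]
    by (intro arg_cong[where f = "integral\<^sup>L period_measure"] ext)
      (simp add: complex_norm_square right_diff_distrib del: of_real_power)
  also have "\<dots> = integral\<^sup>L period_measure (\<lambda>\<theta>. (g \<theta> - p \<theta>) * cnj (g \<theta>))"
    using gp_p gp_p_int ggc_int gcp_int by (subst Bochner_Integration.integral_diff) (simp_all add: gp_g del: complex_cnj_mult complex_cnj_cnj)
  also have "\<dots> = integral\<^sup>L period_measure (\<lambda>\<theta>. g \<theta> * cnj (g \<theta>)) - (\<Sum>k\<in>L. c k * cnj (2 * of_real pi * c k))"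
    unfolding gp_g using ggc_int gcp_int
    by (simp add: ge[symmetric] integral_cnj del: complex_cnj_mult complex_cnj_cnj)
  also have "\<dots> = of_real (integral\<^sup>L period_measure (\<lambda>\<theta>. (cmod (g \<theta>))\<^sup>2) - 2 * pi * (\<Sum>k\<in>L. (cmod (c k))\<^sup>2))"
    by (simp add: complex_norm_square integral_complex_of_real[symmetric] sum_distrib_left mult_ac del: of_real_power)
  finally have "integral\<^sup>L period_measure (\<lambda>\<theta>. (cmod (g \<theta> - p \<theta>))\<^sup>2) =
      integral\<^sup>L period_measure (\<lambda>\<theta>. (cmod (g \<theta>))\<^sup>2) - 2 * pi * (\<Sum>k\<in>L. (cmod (c k))\<^sup>2)"
    by (simp only: of_real_eq_iff)
  moreover have "0 \<le> integral\<^sup>L period_measure (\<lambda>\<theta>. (cmod (g \<theta> - p \<theta>))\<^sup>2)" by simp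
  moreover have "integral\<^sup>L period_measure (\<lambda>\<theta>. (cmod (g \<theta>))\<^sup>2) \<le> integral\<^sup>L period_measure (\<lambda>\<theta>. B\<^sup>2)"
    using B by (intro integral_mono gg_int) (auto intro: power_mono)
  moreover have "integral\<^sup>L period_measure (\<lambda>\<theta>. B\<^sup>2) = 2 * pi * B\<^sup>2"
    by (simp add: measure_restrict_space)
  ultimately have "2 * pi * (\<Sum>k\<in>L. (cmod (c k))\<^sup>2) \<le> 2 * pi * B\<^sup>2" by linarith
  then show ?thesis by (simp add: c_def)
qed

text \<open>Truncation: values of modulus above a level are replaced by 0, and dominated convergence
  makes the error small for a high level.\<close>

lemma L1_bounded_approx:
  fixes f :: "real \<Rightarrow> complex"
  assumes f: "integrable M f" and "\<epsilon> > 0"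
  obtains g B where "integrable M g" "\<And>x. cmod (g x) \<le> B" "B > 0"
    "integral\<^sup>L M (\<lambda>x. cmod (f x - g x)) \<le> \<epsilon>"
proof -
  define g where "g n x = (if cmod (f x) \<le> real n then f x else 0)" for n x
  have g_meas: "g n \<in> borel_measurable M" for n
    unfolding g_def[abs_def] using f by measurable
  have "(\<lambda>n. integral\<^sup>L M (\<lambda>x. cmod (f x - g n x))) \<longlonglongrightarrow> integral\<^sup>L M (\<lambda>x. 0::real)"
  proof (rule integral_dominated_convergence[where w = "\<lambda>x. cmod (f x)"])
    show "AE x in M. (\<lambda>n. cmod (f x - g n x)) \<longlonglongrightarrow> 0"
    proof (intro AE_I2)
      fix x
      obtain n0 where "cmod (f x) \<le> real n0" using real_arch_simple by blast
      then have "\<forall>\<^sub>F n in sequentially. cmod (f x - g n x) = 0"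
        unfolding eventually_sequentially g_def by (intro exI[of _ n0]) auto
      then show "(\<lambda>n. cmod (f x - g n x)) \<longlonglongrightarrow> 0" by (rule tendsto_eventually)
    qed
    show "(\<lambda>x. cmod (f x - g n x)) \<in> borel_measurable M" for n
      using g_meas[of n] borel_measurable_integrable[OF f] by measurable
    show "AE x in M. norm (cmod (f x - g n x)) \<le> cmod (f x)" for n by (simp add: g_def)
    show "integrable M (\<lambda>x. cmod (f x))" using f by (rule integrable_norm)
  qed simp
  then have "\<forall>\<^sub>F n in sequentially. integral\<^sup>L M (\<lambda>x. cmod (f x - g n x)) < \<epsilon>"
    using \<open>\<epsilon> > 0\<close> by (simp add: order_tendstoD)
  then obtain n where n: "integral\<^sup>L M (\<lambda>x. cmod (f x - g n x)) < \<epsilon>"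
    unfolding eventually_sequentially by auto
  show thesis
  \<comment> \<open>The bound is \<open>real n + 1\<close> and not \<open>real n\<close>, so that it
    is positive even for \<open>n = 0\<close>.\<close>
  proof (rule that[of "g n" "real n + 1"])
    show "integrable M (g n)"
      by (rule Bochner_Integration.integrable_bound[OF f g_meas]) (simp add: g_def)
    show "cmod (g n x) \<le> real n + 1" for x by (simp add: g_def)
    show "integral\<^sup>L M (\<lambda>x. cmod (f x - g n x)) \<le> \<epsilon>" using n by simp
  qed simp
qed

subsection \<open>Corners of Toeplitz matrices\<close>

text \<open>Pairing the integral representation with orthonormal families and applying Bessel's
  inequality pointwise in \<open>\<theta>\<close> bounds the sum by the \<open>L\<^sup>1\<close> norm of the symbol.\<close>

lemma trace_bound_integral:
  assumes h: "integrable period_measure h" and fin: "finite S" "finite T"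
    and \<alpha>: "\<And>i. continuous_on {-pi..pi} (\<alpha> i)" "\<And>i \<theta>. cmod (\<alpha> i \<theta>) \<le> 1"
    and \<beta>: "\<And>j. continuous_on {-pi..pi} (\<beta> j)" "\<And>j \<theta>. cmod (\<beta> j \<theta>) \<le> 1"
  shows "trace_bound S T ((\<integral>\<theta>. cmod (h \<theta>) \<partial>period_measure) * real (card S + card T))
     (\<lambda>i j. 1 / (2 * of_real pi) * (\<integral>\<theta>. h \<theta> * (\<alpha> i \<theta> * \<beta> j \<theta>) \<partial>period_measure))"
  unfolding trace_bound_def
proof (intro allI impI)
  fix K u v assume u: "orthonormal_on S K u" and v: "orthonormal_on T K v"
  define M where "M i j = 1 / (2 * of_real pi) * (\<integral>\<theta>. h \<theta> * (\<alpha> i \<theta> * \<beta> j \<theta>) \<partial>period_measure)" for i j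
  \<comment> \<open>For fixed \<theta> the integrand is a matrix of rank one, so its form factors
    into the pairings \<open>U k \<theta>\<close> and \<open>V k \<theta>\<close>. Bessel bounds the
    sums of their squares by the numbers of rows and of columns, uniformly in \<theta>.\<close>
  define U where "U k \<theta> = (\<Sum>i\<in>S. \<alpha> i \<theta> * u k i)" for k \<theta>
  define V where "V k \<theta> = (\<Sum>j\<in>T. \<beta> j \<theta> * v k j)" for k \<theta>
  have prod_le: "cmod (\<alpha> i \<theta> * \<beta> j \<theta>) \<le> 1" for i j \<theta>
    unfolding norm_mult using \<alpha>(2) \<beta>(2) by (intro mult_le_one) auto
  have int: "integrable period_measure (\<lambda>\<theta>. h \<theta> * (\<alpha> i \<theta> * \<beta> j \<theta>))" for i j
    by (rule integrable_mult_continuous_bounded[OF h _ prod_le]) (intro continuous_intros \<alpha> \<beta>)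
  have bil: "bilin S T M (u k) (v k) = 1 / (2 * of_real pi) * (\<integral>\<theta>. h \<theta> * (U k \<theta> * V k \<theta>) \<partial>period_measure)" for k
  proof -
    have "h \<theta> * (U k \<theta> * V k \<theta>) = (\<Sum>i\<in>S. \<Sum>j\<in>T. u k i * v k j * (h \<theta> * (\<alpha> i \<theta> * \<beta> j \<theta>)))" for \<theta>
      by (simp only: U_def V_def sum_product) (simp add: sum_distrib_left mult_ac)
    then have "(\<integral>\<theta>. h \<theta> * (U k \<theta> * V k \<theta>) \<partial>period_measure) =
        (\<Sum>i\<in>S. \<Sum>j\<in>T. u k i * v k j * (\<integral>\<theta>. h \<theta> * (\<alpha> i \<theta> * \<beta> j \<theta>) \<partial>period_measure))"
      using int by simp
    then show ?thesis by (simp add: bilin_def M_def sum_distrib_left sum_divide_distrib mult_ac)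
  qed
  have UV_int: "integrable period_measure (\<lambda>\<theta>. h \<theta> * (U k \<theta> * V k \<theta>))" for k
  proof -
    have "(\<lambda>\<theta>. h \<theta> * (U k \<theta> * V k \<theta>)) = (\<lambda>\<theta>. \<Sum>i\<in>S. \<Sum>j\<in>T. u k i * v k j * (h \<theta> * (\<alpha> i \<theta> * \<beta> j \<theta>)))"
      by (simp only: U_def V_def sum_product) (simp add: sum_distrib_left mult_ac)
    then show ?thesis using int by simp
  qed
  have UV: "(\<Sum>k<K. cmod (U k \<theta>) * cmod (V k \<theta>)) \<le> real (card S + card T)" for \<theta>
  proof -
    have "(\<Sum>k<K. (cmod (U k \<theta>))\<^sup>2) \<le> sq_norm_on S (\<lambda>i. \<alpha> i \<theta>)"
      unfolding U_def by (rule bessel_on[OF u])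
    also have "\<dots> \<le> (\<Sum>i\<in>S. 1)" unfolding sq_norm_on_def
      using \<alpha>(2) by (intro sum_mono) (simp add: power_le_one)
    finally have U: "(\<Sum>k<K. (cmod (U k \<theta>))\<^sup>2) \<le> real (card S)" by simp
    have "(\<Sum>k<K. (cmod (V k \<theta>))\<^sup>2) \<le> sq_norm_on T (\<lambda>i. \<beta> i \<theta>)"
      unfolding V_def by (rule bessel_on[OF v])
    also have "\<dots> \<le> (\<Sum>i\<in>T. 1)" unfolding sq_norm_on_def
      using \<beta>(2) by (intro sum_mono) (simp add: power_le_one)
    finally have V: "(\<Sum>k<K. (cmod (V k \<theta>))\<^sup>2) \<le> real (card T)" by simp
    \<comment> \<open>A crude bound for the product; it is why the two cardinalities enter as a
      sum.\<close>
    have "x * y \<le> x\<^sup>2 + y\<^sup>2" if "0 \<le> x" "0 \<le> y" for x y :: real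
    proof -
      have "0 \<le> (x - y)\<^sup>2 + x * y" using that by simp
      then show ?thesis by (simp add: power2_diff)
    qed
    then have "(\<Sum>k<K. cmod (U k \<theta>) * cmod (V k \<theta>)) \<le> (\<Sum>k<K. (cmod (U k \<theta>))\<^sup>2 + (cmod (V k \<theta>))\<^sup>2)"
      by (intro sum_mono) simp
    then show ?thesis using U V by (simp add: sum.distrib)
  qed
  have "cmod (bilin S T M (u k) (v k)) \<le> (\<integral>\<theta>. cmod (h \<theta>) * (cmod (U k \<theta>) * cmod (V k \<theta>)) \<partial>period_measure)" for k
  proof -
    have "cmod (1 / (2 * of_real pi)) \<le> 1" using pi_ge_two by (simp add: norm_divide norm_mult)
    then have "cmod (bilin S T M (u k) (v k)) \<le> 1 * cmod (\<integral>\<theta>. h \<theta> * (U k \<theta> * V k \<theta>) \<partial>period_measure)"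
      unfolding bil norm_mult by (intro mult_right_mono) auto
    also have "\<dots> \<le> (\<integral>\<theta>. cmod (h \<theta> * (U k \<theta> * V k \<theta>)) \<partial>period_measure)"
      using integral_norm_bound by simp
    finally show ?thesis by (simp add: norm_mult)
  qed
  then have "(\<Sum>k<K. cmod (bilin S T M (u k) (v k))) \<le>
      (\<Sum>k<K. \<integral>\<theta>. cmod (h \<theta>) * (cmod (U k \<theta>) * cmod (V k \<theta>)) \<partial>period_measure)"
    by (intro sum_mono)
  also have "\<dots> = (\<integral>\<theta>. (\<Sum>k<K. cmod (h \<theta>) * (cmod (U k \<theta>) * cmod (V k \<theta>))) \<partial>period_measure)"
    using integrable_norm[OF UV_int] by (simp add: norm_mult)
  also have "\<dots> \<le> (\<integral>\<theta>. cmod (h \<theta>) * real (card S + card T) \<partial>period_measure)"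
  proof (rule integral_mono)
    show "integrable period_measure (\<lambda>\<theta>. \<Sum>k<K. cmod (h \<theta>) * (cmod (U k \<theta>) * cmod (V k \<theta>)))"
      using integrable_norm[OF UV_int] by (simp add: norm_mult)
    show "(\<Sum>k<K. cmod (h \<theta>) * (cmod (U k \<theta>) * cmod (V k \<theta>))) \<le> cmod (h \<theta>) * real (card S + card T)" for \<theta>
      unfolding sum_distrib_left[symmetric] by (intro mult_left_mono UV) simp
  qed (use h in auto)
  also have "\<dots> = (\<integral>\<theta>. cmod (h \<theta>) \<partial>period_measure) * real (card S + card T)" by simp
  finally show "(\<Sum>k<K. cmod (bilin S T M (u k) (v k))) \<le>
      (\<integral>\<theta>. cmod (h \<theta>) \<partial>period_measure) * real (card S + card T)" .
qed

text \<open>A matrix that is populated at a single position of each block has one relevant scalar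
  row per block row; this passes from scalar to block indices.\<close>

lemma sum_residue_class:
  fixes h :: "nat \<Rightarrow> real"
  assumes "a < s"
  shows "(\<Sum>i\<in>{n * s..<m * s}. if i mod s = a then h (i div s) else 0) = (\<Sum>p\<in>{n..<m}. h p)"
proof -
  have "(\<Sum>i\<in>{n * s..<m * s}. if i mod s = a then h (i div s) else 0) =
      (\<Sum>i\<in>{i \<in> {n * s..<m * s}. i mod s = a}. h (i div s))"
    by (rule sum.inter_filter[symmetric]) simp
  also have "\<dots> = (\<Sum>p\<in>{n..<m}. h p)"
  proof (rule sum.reindex_bij_witness[where i = "\<lambda>p. p * s + a" and j = "\<lambda>i. i div s"])
    fix p assume p: "p \<in> {n..<m}"
    have "p * s + a < Suc p * s" using assms by simp
    also have "\<dots> \<le> m * s" using p by (intro mult_le_mono1) auto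
    finally have "p * s + a < m * s" .
    moreover have "n * s \<le> p * s + a" using p by (intro trans_le_add1 mult_le_mono1) auto
    ultimately show "p * s + a \<in> {i \<in> {n * s..<m * s}. i mod s = a}" using assms by simp
    show "(p * s + a) div s = p" using assms by simp
  next
    fix i assume i: "i \<in> {i \<in> {n * s..<m * s}. i mod s = a}"
    then show "i div s * s + a = i" using div_mult_mod_eq[of i s] by simp
    show "i div s \<in> {n..<m}"
      using i assms by (auto simp: less_mult_imp_div_less less_eq_div_iff_mult_less_eq)
    show "h (i div s) = h (i div s)" ..
  qed
  finally show ?thesis .
qed

text \<open>Only the coefficients with positive index \<open>p - q\<close> enter below, each column contributing a
  window that moves off to infinity, except for a bounded number of columns.\<close>

lemma corner_sum_sublinear:
  fixes c :: "int \<Rightarrow> real"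
  assumes nn: "\<And>k. 0 \<le> c k" and C: "\<And>L. finite L \<Longrightarrow> (\<Sum>k\<in>L. c k) \<le> C" and "\<epsilon> > 0"
  obtains N where "\<And>n. n \<ge> N \<Longrightarrow> (\<Sum>p\<in>{n..<2 * n}. \<Sum>q<n. c (int p - int q)) \<le> \<epsilon> * real n"
proof -
  have C0: "0 \<le> C" using C[of "{}"] by simp
  have part: "(\<Sum>d\<in>D. c (int d)) \<le> C" if "finite D" for D
    using C[of "int ` D"] that by (simp add: sum.reindex)
  have "summable (\<lambda>d. c (int d))"
    using nn part by (intro summableI_nonneg_bounded[where x = C]) auto
  then obtain R where R: "\<And>m n. m \<ge> R \<Longrightarrow> norm (\<Sum>d\<in>{m..<n}. c (int d)) < \<epsilon> / 2"
    using half_gt_zero[OF \<open>\<epsilon> > 0\<close>] unfolding summable_Cauchy by blast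
  \<comment> \<open>Fewer than \<open>R\<close> columns can see coefficients with index below
    \<open>R\<close>, and each contributes at most \<open>C\<close>. From \<open>N\<close> on, this
    bounded total is absorbed into the second half of \<open>\<epsilon> * real n\<close>.\<close>
  obtain N :: nat where N: "real R * C < real N * (\<epsilon> / 2)"
    using ex_less_of_nat_mult[OF half_gt_zero[OF \<open>\<epsilon> > 0\<close>]] by blast
  show thesis
  proof (rule that[of N])
    fix n assume "n \<ge> N"
    \<comment> \<open>In column \<open>q\<close> the index runs from \<open>n - q\<close> upwards: a
      tail of the convergent series as soon as \<open>n - q \<ge> R\<close>.\<close>
    have col: "(\<Sum>p\<in>{n..<2 * n}. c (int p - int q)) \<le> \<epsilon> / 2 + (if n - q < R then C else 0)"
      if q: "q < n" for q
    proof -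
      have "(\<Sum>p\<in>{n..<2 * n}. c (int p - int q)) = (\<Sum>d\<in>{n - q..<2 * n - q}. c (int d))"
        using q by (intro sum.reindex_bij_witness[where i = "\<lambda>d. d + q" and j = "\<lambda>p. p - q"])
          (auto simp: of_nat_diff)
      also have "\<dots> \<le> \<epsilon> / 2 + (if n - q < R then C else 0)"
        using R[of "n - q" "2 * n - q"] part[of "{n - q..<2 * n - q}"] \<open>\<epsilon> > 0\<close> C0 by auto
      finally show ?thesis .
    qed
    have "(\<Sum>p\<in>{n..<2 * n}. \<Sum>q<n. c (int p - int q)) = (\<Sum>q<n. \<Sum>p\<in>{n..<2 * n}. c (int p - int q))"
      by (rule sum.swap)
    also have "\<dots> \<le> (\<Sum>q<n. \<epsilon> / 2 + (if n - q < R then C else 0))"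
      by (intro sum_mono col) simp
    also have "\<dots> = real n * (\<epsilon> / 2) + (\<Sum>q\<in>{q. q < n \<and> n - q < R}. C)"
      by (simp add: sum.distrib sum.If_cases lessThan_def Int_def)
    also have "\<dots> \<le> real n * (\<epsilon> / 2) + real R * C"
    proof -
      have "card {q. q < n \<and> n - q < R} \<le> card {n - R..<n}" by (intro card_mono) auto
      then have "card {q. q < n \<and> n - q < R} \<le> R" by simp
      then show ?thesis using C0 by (simp add: mult_right_mono)
    qed
    also have "\<dots> \<le> real n * (\<epsilon> / 2) + \<epsilon> / 2 * real n"
    proof -
      have "real N * (\<epsilon> / 2) \<le> real n * (\<epsilon> / 2)" using \<open>n \<ge> N\<close> \<open>\<epsilon> > 0\<close> by (intro mult_right_mono) auto
      then show ?thesis using N by (simp add: mult.commute)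
    qed
    finally show "(\<Sum>p\<in>{n..<2 * n}. \<Sum>q<n. c (int p - int q)) \<le> \<epsilon> * real n"
      by (simp add: field_simps)
  qed
qed

lemma fourier_diff:
  assumes "integrable period_measure f" "integrable period_measure g"
  shows "fourier (\<lambda>\<theta>. f \<theta> - g \<theta>) k = fourier f k - fourier g k"
proof -
  have "integrable period_measure (\<lambda>\<theta>. h \<theta> * exp (- \<i> * of_int k * of_real \<theta>))"
    if "integrable period_measure h" for h
    by (rule integrable_mult_continuous_bounded[OF that, of _ 1]) (auto intro!: continuous_intros)
  then show ?thesis using assms by (simp add: fourier_def left_diff_distrib right_diff_distrib diff_divide_distrib)
qed

text \<open>Treating one position \<open>(a, b)\<close> inside the blocks at a time, with zeros
  elsewhere, reduces a matrix-valued symbol to a scalar one.\<close>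

lemma trace_bound_corner_entry:
  assumes f: "integrable period_measure f" and "a < s" "b < t" and "\<epsilon> > 0"
  obtains N where "\<And>n. n \<ge> N \<Longrightarrow> trace_bound {n * s..<2 * n * s} {..<n * t} (\<epsilon> * real n)
    (\<lambda>i j. if i mod s = a \<and> j mod t = b then fourier f (int (i div s) - int (j div t)) else 0)"
proof -
  \<comment> \<open>Chosen to leave three shares of at most \<epsilon> / 3 per unit of
    \<open>n\<close>: the term \<open>\<delta> * card S\<close> of the Frobenius estimate, its term
    \<open>F / \<delta>\<close>, for which \<open>F\<close> is made as small as
    \<open>\<delta> * (\<epsilon> / 3) * real n\<close>, and the integral estimate for the
    remainder, where \<delta> is multiplied by \<open>n * s + n * t\<close>.\<close>
  define \<delta> where "\<delta> = \<epsilon> / (3 * real (s + t))"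
  have st: "0 < real s" "0 < real t" using \<open>a < s\<close> \<open>b < t\<close> by auto
  then have "\<delta> > 0" using \<open>\<epsilon> > 0\<close> by (simp add: \<delta>_def)
  obtain g B where g: "integrable period_measure g" and B: "\<And>x. cmod (g x) \<le> B" "B > 0"
    and fg: "(\<integral>\<theta>. cmod (f \<theta> - g \<theta>) \<partial>period_measure) \<le> \<delta>"
    using L1_bounded_approx[OF f \<open>\<delta> > 0\<close>] by blast
  have "\<delta> * (\<epsilon> / 3) > 0" using \<open>\<delta> > 0\<close> \<open>\<epsilon> > 0\<close> by simp
  then obtain N where N: "\<And>n. n \<ge> N \<Longrightarrow>
      (\<Sum>p\<in>{n..<2 * n}. \<Sum>q<n. (cmod (fourier g (int p - int q)))\<^sup>2) \<le> \<delta> * (\<epsilon> / 3) * real n"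
    using corner_sum_sublinear[of "\<lambda>k. (cmod (fourier g k))\<^sup>2", OF zero_le_power2 fourier_bessel[OF g B(1)]]
    by blast
  show thesis
  proof (rule that[of N])
    fix n assume "n \<ge> N"
    let ?S = "{n * s..<2 * n * s}" and ?T = "{..<n * t}"
    let ?E = "\<lambda>w i j. if i mod s = a \<and> j mod t = b then fourier w (int (i div s) - int (j div t)) else 0"
    have card: "card ?S = n * s" "card ?T = n * t" by (simp_all add: algebra_simps)
    have "(\<Sum>i\<in>?S. \<Sum>j\<in>?T. (cmod (?E g i j))\<^sup>2) =
        (\<Sum>i\<in>?S. if i mod s = a then (\<Sum>q<n. (cmod (fourier g (int (i div s) - int q)))\<^sup>2) else 0)"
    proof (intro sum.cong refl)
      fix i
      have "(\<Sum>j\<in>?T. (cmod (?E g i j))\<^sup>2) =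
          (\<Sum>j\<in>{0 * t..<n * t}. if j mod t = b then (if i mod s = a then (cmod (fourier g (int (i div s) - int (j div t))))\<^sup>2 else 0) else 0)"
        by (intro sum.cong) auto
      also have "\<dots> = (\<Sum>q\<in>{0..<n}. if i mod s = a then (cmod (fourier g (int (i div s) - int q)))\<^sup>2 else 0)"
        by (rule sum_residue_class[OF \<open>b < t\<close>])
      finally show "(\<Sum>j\<in>?T. (cmod (?E g i j))\<^sup>2) =
          (if i mod s = a then (\<Sum>q<n. (cmod (fourier g (int (i div s) - int q)))\<^sup>2) else 0)"
        by (simp add: atLeast0LessThan)
    qed
    also have "\<dots> = (\<Sum>p\<in>{n..<2 * n}. \<Sum>q<n. (cmod (fourier g (int p - int q)))\<^sup>2)"
      by (rule sum_residue_class[OF \<open>a < s\<close>])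
    also have "\<dots> \<le> \<delta> * (\<epsilon> / 3) * real n" by (rule N[OF \<open>n \<ge> N\<close>])
    finally have "(\<Sum>i\<in>?S. \<Sum>j\<in>?T. (cmod (?E g i j))\<^sup>2) \<le> \<delta> * (\<epsilon> / 3) * real n" .
    then have "trace_bound ?S ?T (\<delta> * real (card ?S) + \<delta> * (\<epsilon> / 3) * real n / \<delta>) (?E g)"
      by (rule trace_bound_frobenius[OF _ _ \<open>\<delta> > 0\<close>, rotated 2]) auto
    then have gE: "trace_bound ?S ?T (\<delta> * (real n * real s) + \<epsilon> / 3 * real n) (?E g)"
      using \<open>\<delta> > 0\<close> card by simp
    let ?h = "\<lambda>\<theta>. f \<theta> - g \<theta>"
    \<comment> \<open>The exponential of index p - q separates into a factor depending on the row
      and one depending on the column. Setting the factors to 0 off the residue classes keeps this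
      product form for the sparse matrix.\<close>
    let ?\<alpha> = "\<lambda>i \<theta>. if i mod s = a then exp (- (\<i> * of_int (int (i div s)) * of_real \<theta>)) else 0"
    let ?\<beta> = "\<lambda>j \<theta>. if j mod t = b then exp (\<i> * of_int (int (j div t)) * of_real \<theta>) else 0"
    have "trace_bound ?S ?T ((\<integral>\<theta>. cmod (?h \<theta>) \<partial>period_measure) * real (card ?S + card ?T))
        (\<lambda>i j. 1 / (2 * of_real pi) * (\<integral>\<theta>. ?h \<theta> * (?\<alpha> i \<theta> * ?\<beta> j \<theta>) \<partial>period_measure))"
    proof (rule trace_bound_integral)
      show "integrable period_measure ?h" using f g by simp
      show "continuous_on {- pi..pi} (?\<alpha> i)" for i
        by (cases "i mod s = a") (auto intro!: continuous_intros)
      show "continuous_on {- pi..pi} (?\<beta> i)" for i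
        by (cases "i mod t = b") (auto intro!: continuous_intros)
      show "cmod (?\<alpha> i \<theta>) \<le> 1" "cmod (?\<beta> i \<theta>) \<le> 1" for i \<theta>
        using cmod_exp_imaginary by (simp_all del: of_int_of_nat_eq)
    qed simp_all
    moreover have "1 / (2 * of_real pi) * (\<integral>\<theta>. ?h \<theta> * (?\<alpha> i \<theta> * ?\<beta> j \<theta>) \<partial>period_measure) = ?E ?h i j" for i j
    proof (cases "i mod s = a \<and> j mod t = b")
      case True
      then show ?thesis by (simp add: fourier_def exp_add[symmetric] algebra_simps)
    qed auto
    ultimately have hE: "trace_bound ?S ?T ((\<integral>\<theta>. cmod (?h \<theta>) \<partial>period_measure) * real (card ?S + card ?T)) (?E ?h)"
      by (simp only:)
    have sum_eq: "(\<lambda>i j. ?E g i j + ?E ?h i j) = ?E f"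
      by (intro ext) (simp add: fourier_diff[OF f g])
    have le: "\<delta> * (real n * real s) + \<epsilon> / 3 * real n +
        (\<integral>\<theta>. cmod (?h \<theta>) \<partial>period_measure) * real (card ?S + card ?T) \<le> \<epsilon> * real n"
    proof -
      have 1: "(\<integral>\<theta>. cmod (?h \<theta>) \<partial>period_measure) * real (card ?S + card ?T) \<le> \<delta> * real (n * s + n * t)"
        unfolding card by (intro mult_right_mono fg) simp
      have 2: "\<delta> * real (n * s + n * t) = \<epsilon> / 3 * real n"
        using st by (simp add: \<delta>_def field_simps)
      have 3: "\<delta> * (real n * real s) \<le> \<delta> * real (n * s + n * t)"
        using \<open>\<delta> > 0\<close> by (intro mult_left_mono) auto
      show ?thesis using 1 2 3 by linarith
    qed
    show "trace_bound ?S ?T (\<epsilon> * real n) (?E f)"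
      using trace_bound_mono[OF trace_bound_add[OF gE hE] le] unfolding sum_eq .
  qed
qed

lemma fourier_coeff_entry:
  "i < s \<Longrightarrow> j < t \<Longrightarrow> fourier_coeff s t f k $$ (i, j) = fourier (\<lambda>\<theta>. f \<theta> $$ (i, j)) k"
  by (simp add: fourier_coeff_def fourier_def)

lemma trace_bound_toeplitz_corner:
  assumes f: "L1_matrix s t f" and "0 < s" "0 < t" and "\<epsilon> > 0"
  obtains N where "\<And>n. n \<ge> N \<Longrightarrow> trace_bound {n * s..<2 * n * s} {..<n * t} (\<epsilon> * real n)
    (\<lambda>i j. toeplitz_mat s t (2 * n) f $$ (i, j))"
proof -
  let ?E = "\<lambda>ab i j. if i mod s = fst ab \<and> j mod t = snd ab
      then fourier (\<lambda>\<theta>. f \<theta> $$ ab) (int (i div s) - int (j div t)) else 0"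
  let ?L = "{..<s} \<times> {..<t}"
  \<comment> \<open>The \<open>s * t\<close> block positions share \<epsilon> equally.\<close>
  define \<delta> where "\<delta> = \<epsilon> / real (s * t)"
  have "\<delta> > 0" using assms by (simp add: \<delta>_def)
  define P where "P ab N \<longleftrightarrow>
    (\<forall>n\<ge>N. trace_bound {n * s..<2 * n * s} {..<n * t} (\<delta> * real n) (?E ab))" for ab N
  have "\<exists>N. P ab N" if "ab \<in> ?L" for ab
  proof -
    have int: "integrable period_measure (\<lambda>\<theta>. f \<theta> $$ ab)"
      using f that by (auto simp: L1_matrix_def)
    have ab: "fst ab < s" "snd ab < t" using that by auto
    show ?thesis
    proof (rule trace_bound_corner_entry[OF int ab \<open>\<delta> > 0\<close>])
      fix N assume N: "\<And>n. N \<le> n \<Longrightarrow> trace_bound {n * s..<2 * n * s} {..<n * t} (\<delta> * real n) (?E ab)"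
      show ?thesis unfolding P_def by (intro exI[of _ N] allI impI N)
    qed
  qed
  then obtain N where "\<And>ab. ab \<in> ?L \<Longrightarrow> P ab (N ab)" by metis
  then have N: "trace_bound {n * s..<2 * n * s} {..<n * t} (\<delta> * real n) (?E ab)"
    if "ab \<in> ?L" "n \<ge> N ab" for ab n
    using that unfolding P_def by blast
  show thesis
  proof (rule that[of "Max (N ` ?L)"])
    fix n assume n: "n \<ge> Max (N ` ?L)"
    have "n \<ge> N ab" if "ab \<in> ?L" for ab
      using n that by (meson Max_ge finite_SigmaI finite_imageI finite_lessThan imageI order_trans)
    then have "trace_bound {n * s..<2 * n * s} {..<n * t} (\<Sum>ab\<in>?L. \<delta> * real n) (\<lambda>i j. \<Sum>ab\<in>?L. ?E ab i j)"
      by (intro trace_bound_sum N) auto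
    moreover have "(\<Sum>ab\<in>?L. \<delta> * real n) = \<epsilon> * real n"
      using assms by (simp add: \<delta>_def)
    moreover have "trace_bound {n * s..<2 * n * s} {..<n * t} (\<epsilon> * real n) (\<lambda>i j. \<Sum>ab\<in>?L. ?E ab i j) =
        trace_bound {n * s..<2 * n * s} {..<n * t} (\<epsilon> * real n) (\<lambda>i j. toeplitz_mat s t (2 * n) f $$ (i, j))"
    proof (rule trace_bound_cong)
      fix i j assume i: "i \<in> {n * s..<2 * n * s}" and j: "j \<in> {..<n * t}"
      have "(\<Sum>ab\<in>?L. ?E ab i j) = (\<Sum>ab\<in>?L. if ab = (i mod s, j mod t)
          then fourier (\<lambda>\<theta>. f \<theta> $$ ab) (int (i div s) - int (j div t)) else 0)"
        by (intro sum.cong) auto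
      also have "\<dots> = fourier (\<lambda>\<theta>. f \<theta> $$ (i mod s, j mod t)) (int (i div s) - int (j div t))"
        using assms by simp
      also have "\<dots> = toeplitz_mat s t (2 * n) f $$ (i, j)"
        using i j assms by (simp add: toeplitz_mat_def fourier_coeff_entry)
      finally show "(\<Sum>ab\<in>?L. ?E ab i j) = toeplitz_mat s t (2 * n) f $$ (i, j)" .
    qed
    ultimately show "trace_bound {n * s..<2 * n * s} {..<n * t} (\<epsilon> * real n) (\<lambda>i j. toeplitz_mat s t (2 * n) f $$ (i, j))"
      by (simp only:)
  qed
qed

subsection \<open>Rank and operator norm\<close>

text \<open>A maximal independent set of columns has as many elements as the rank, and every column
  is a combination of it; the coefficients provide the second factor of each product.\<close>

lemma low_rank_of_mat_rank:
  assumes A: "A \<in> carrier_mat p q"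
  shows "low_rank {..<p} {..<q} (mat_rank A) (\<lambda>i j. A $$ (i, j))"
proof -
  interpret vec_space "TYPE(complex)" p .
  have cols: "set (cols A) \<subseteq> carrier_vec p" using A cols_dim by blast
  let ?P = "\<lambda>T. T \<subseteq> set (cols A) \<and> lin_indpt T"
  have "lin_indpt {}" by (simp add: lin_dep_def)
  then obtain U where fin: "finite U" and max: "maximal U ?P"
    using maximal_exists_superset[of "set (cols A)" ?P "{}"] by auto
  have U: "U \<subseteq> set (cols A)" "lin_indpt U" using max by (auto simp: maximal_def)
  have U_carrier: "U \<subseteq> carrier_vec p" using U cols by blast
  have in_span: "c \<in> span U" if c: "c \<in> set (cols A)" for c
  proof (rule ccontr)
    assume not_in: "c \<notin> span U"
    then have "c \<notin> U" using span_mem[OF U_carrier] by blast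
    moreover have "lin_indpt (U \<union> {c})"
      using lin_dep_iff_in_span[OF U_carrier U(2) _ \<open>c \<notin> U\<close>] not_in c cols by blast
    ultimately show False using max c U(1) unfolding maximal_def by blast
  qed
  have "\<exists>a. c = lincomb a U" if "c \<in> set (cols A)" for c
    using in_span[OF that] finite_span[OF fin U_carrier] by auto
  then obtain a where a: "\<And>c. c \<in> set (cols A) \<Longrightarrow> c = lincomb (a c) U" by metis
  have "mat_rank A = card U"
    using rank_card_indpt[OF A max] A by (simp add: mat_rank_def)
  then show ?thesis
  proof (intro low_rankI[OF fin, where x = "\<lambda>u i. u $ i" and y = "\<lambda>u j. a (col A j) u"])
    fix i j assume ij: "i \<in> {..<p}" "j \<in> {..<q}"
    then have "col A j \<in> set (cols A)" using A by (simp add: cols_def)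
    then have "col A j $ i = lincomb (a (col A j)) U $ i" using a by simp
    then show "A $$ (i, j) = (\<Sum>u\<in>U. u $ i * a (col A j) u)"
      using ij A lincomb_index[of i U "a (col A j)"] U_carrier by (simp add: mult.commute)
  qed simp
qed

text \<open>The converse direction, by subadditivity of the rank over matrices of rank at most
  one.\<close>

lemma mat_rank_sum_products_le:
  "mat_rank (mat p q (\<lambda>(i, j). \<Sum>k<r. x k i * y k j)) \<le> r"
proof (induction r)
  case 0
  have "mat p q (\<lambda>(i, j). \<Sum>k<0. x k i * y k j) = 0\<^sub>m p q" by (intro eq_matI) auto
  then show ?case using vec_space.rank_0I[of p q, where 'a = complex] by (simp only: mat_rank_def) simp
next
  case (Suc r)
  let ?M = "\<lambda>r. mat p q (\<lambda>(i, j). \<Sum>k<r. x k i * y k j)"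
  let ?R = "mat p q (\<lambda>(i, j). x r i * y r j)"
  have "?M (Suc r) = ?M r + ?R" by (intro eq_matI) auto
  then have "mat_rank (?M (Suc r)) \<le> vec_space.rank p (?M r) + vec_space.rank p ?R"
    using vec_space.rank_subadditive[of "?M r" p q ?R] by (simp add: mat_rank_def)
  moreover have "vec_space.rank p ?R \<le> 1"
    by (rule vec_space.rank_le_1_product_entries[of _ p q "x r" "y r"]) auto
  ultimately show ?case using Suc by (simp add: mat_rank_def)
qed

lemma euclid_norm_sq_norm: "euclid_norm v = sqrt (sq_norm_on {..<dim_vec v} (\<lambda>i. v $ i))"
  by (simp add: euclid_norm_def L2_set_def sq_norm_on_def)

lemma mult_mat_vec_entry:
  assumes "A \<in> carrier_mat p q" "v \<in> carrier_vec q" "i < p"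
  shows "(A *\<^sub>v v) $ i = (\<Sum>j<q. A $$ (i, j) * v $ j)"
  using assms by (simp add: scalar_prod_def atLeast0LessThan)

text \<open>The form is tested with the conjugate of the image vector, which produces its squared
  norm; one factor of the norm is then cancelled.\<close>

lemma norm_boundD_image:
  assumes N: "norm_bound S T \<omega> N" and "0 \<le> \<omega>"
  shows "sqrt (sq_norm_on S (\<lambda>i. \<Sum>j\<in>T. N i j * y j)) \<le> \<omega> * sqrt (sq_norm_on T y)"
proof -
  define w where "w i = (\<Sum>j\<in>T. N i j * y j)" for i
  define n where "n = sqrt (sq_norm_on S w)"
  have n0: "0 \<le> n" by (simp add: n_def)
  have zw: "(\<Sum>j\<in>T. z * N i j * y j) = z * w i" for z i
    by (simp add: w_def sum_distrib_left mult.assoc)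
  have "bilin S T N (\<lambda>i. cnj (w i)) y = (\<Sum>i\<in>S. w i * cnj (w i))"
    unfolding bilin_def zw by (simp add: mult.commute)
  also have "\<dots> = of_real (n\<^sup>2)" by (simp add: n_def of_real_sq_norm_on[symmetric])
  finally have "n\<^sup>2 = cmod (bilin S T N (\<lambda>i. cnj (w i)) y)" by (simp only: norm_of_real) simp
  also have "\<dots> \<le> \<omega> * sqrt (sq_norm_on S (\<lambda>i. cnj (w i))) * sqrt (sq_norm_on T y)"
    using N unfolding norm_bound_def by blast
  also have "sq_norm_on S (\<lambda>i. cnj (w i)) = sq_norm_on S w"
    unfolding sq_norm_on_def complex_mod_cnj ..
  finally have "n * n \<le> n * (\<omega> * sqrt (sq_norm_on T y))"
    by (simp add: n_def[symmetric] power2_eq_square mult_ac)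
  then have "n \<le> \<omega> * sqrt (sq_norm_on T y)"
    using n0 \<open>0 \<le> \<omega>\<close> by (cases "n = 0") auto
  then show ?thesis by (simp add: n_def w_def[abs_def])
qed

lemma op_norm_le:
  assumes A: "A \<in> carrier_mat p q" and N: "norm_bound {..<p} {..<q} \<omega> (\<lambda>i j. A $$ (i, j))" and "0 \<le> \<omega>"
  shows "op_norm A \<le> \<omega>"
  unfolding op_norm_def
proof (rule cSUP_least)
  show "{v \<in> carrier_vec (dim_col A). euclid_norm v \<le> 1} \<noteq> {}"
  proof -
    have "euclid_norm (0\<^sub>v (dim_col A)) \<le> 1" by (simp add: euclid_norm_def L2_set_def)
    then show ?thesis by (auto intro!: exI[of _ "0\<^sub>v (dim_col A)"])
  qed
  fix v assume "v \<in> {v \<in> carrier_vec (dim_col A). euclid_norm v \<le> 1}"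
  then have v: "v \<in> carrier_vec q" "euclid_norm v \<le> 1" using A by auto
  have "euclid_norm (A *\<^sub>v v) = sqrt (sq_norm_on {..<p} (\<lambda>i. \<Sum>j<q. A $$ (i, j) * v $ j))"
    using A mult_mat_vec_entry[OF A v(1)] by (simp add: euclid_norm_sq_norm sq_norm_on_def)
  also have "\<dots> \<le> \<omega> * sqrt (sq_norm_on {..<q} (\<lambda>j. v $ j))"
    by (rule norm_boundD_image[OF N \<open>0 \<le> \<omega>\<close>])
  also have "\<dots> = \<omega> * euclid_norm v" using v by (simp add: euclid_norm_sq_norm)
  also have "\<dots> \<le> \<omega> * 1" using v(2) \<open>0 \<le> \<omega>\<close> by (rule mult_left_mono)
  finally show "euclid_norm (A *\<^sub>v v) \<le> \<omega>" by simp
qed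

text \<open>A real supremum is informative only for a set that is bounded above; the Frobenius norm
  is a bound here.\<close>

lemma op_norm_bdd_above:
  assumes A: "A \<in> carrier_mat p q"
  shows "bdd_above ((\<lambda>v. euclid_norm (A *\<^sub>v v)) ` {v \<in> carrier_vec (dim_col A). euclid_norm v \<le> 1})"
proof (rule bdd_aboveI2)
  fix v assume "v \<in> {v \<in> carrier_vec (dim_col A). euclid_norm v \<le> 1}"
  then have v: "v \<in> carrier_vec q" "euclid_norm v \<le> 1" using A by auto
  have "sq_norm_on {..<p} (\<lambda>i. (A *\<^sub>v v) $ i) \<le> (\<Sum>i<p. sq_norm_on {..<q} (\<lambda>j. A $$ (i, j)))"
    unfolding sq_norm_on_def[of "{..<p}"]
  proof (rule sum_mono)
    fix i assume i: "i \<in> {..<p}"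
    have "cmod ((A *\<^sub>v v) $ i) \<le> sqrt (sq_norm_on {..<q} (\<lambda>j. A $$ (i, j))) * euclid_norm v"
      using cauchy_schwarz_on[of "\<lambda>j. A $$ (i, j)" "\<lambda>j. v $ j" "{..<q}"] i v
      by (simp only: mult_mat_vec_entry[OF A v(1)] lessThan_iff) (simp add: euclid_norm_sq_norm)
    also have "\<dots> \<le> sqrt (sq_norm_on {..<q} (\<lambda>j. A $$ (i, j))) * 1"
      using v(2) by (intro mult_left_mono) auto
    finally have "(cmod ((A *\<^sub>v v) $ i))\<^sup>2 \<le> (sqrt (sq_norm_on {..<q} (\<lambda>j. A $$ (i, j))))\<^sup>2"
      by (intro power_mono) auto
    then show "(cmod ((A *\<^sub>v v) $ i))\<^sup>2 \<le> sq_norm_on {..<q} (\<lambda>j. A $$ (i, j))" by simp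
  qed
  then show "euclid_norm (A *\<^sub>v v) \<le> sqrt (\<Sum>i<p. sq_norm_on {..<q} (\<lambda>j. A $$ (i, j)))"
    using A by (simp add: euclid_norm_sq_norm)
qed

lemma norm_bound_of_op_norm:
  assumes A: "A \<in> carrier_mat p q"
  shows "norm_bound {..<p} {..<q} (op_norm A) (\<lambda>i j. A $$ (i, j))"
  unfolding norm_bound_def
proof (intro allI)
  fix x y :: "nat \<Rightarrow> complex"
  let ?b = "sqrt (sq_norm_on {..<q} y)"
  let ?w = "\<lambda>i. \<Sum>j<q. A $$ (i, j) * y j"
  have w: "sqrt (sq_norm_on {..<p} ?w) \<le> op_norm A * ?b"
  proof (cases "?b = 0")
    case True
    then have "\<forall>j<q. y j = 0" by (auto simp: sq_norm_on_def sum_nonneg_eq_0_iff)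
    then show ?thesis using True by (simp add: sq_norm_on_def)
  next
    case False
    then have b: "?b > 0" by (simp add: less_le)
    define v where "v = vec q (\<lambda>j. of_real (1 / ?b) * y j)"
    have v: "v \<in> carrier_vec q" by (simp add: v_def)
    have "sq_norm_on {..<q} (\<lambda>j. v $ j) = sq_norm_on {..<q} (\<lambda>j. of_real (1 / ?b) * y j)"
      by (simp add: sq_norm_on_def v_def)
    also have "\<dots> = 1" unfolding sq_norm_on_scale using b by (simp add: norm_divide power_divide)
    finally have "euclid_norm v \<le> 1" using v by (simp add: euclid_norm_sq_norm)
    then have "euclid_norm (A *\<^sub>v v) \<le> op_norm A"
      unfolding op_norm_def using A v by (intro cSUP_upper2[OF _ _ order_refl] op_norm_bdd_above[OF A]) auto
    moreover have "euclid_norm (A *\<^sub>v v) = sqrt (sq_norm_on {..<p} ?w) / ?b"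
    proof -
      have "(A *\<^sub>v v) $ i = of_real (1 / ?b) * ?w i" if "i < p" for i
        unfolding mult_mat_vec_entry[OF A v that] sum_distrib_left
        by (intro sum.cong) (auto simp: v_def)
      then have "sq_norm_on {..<p} (\<lambda>i. (A *\<^sub>v v) $ i) = sq_norm_on {..<p} (\<lambda>i. of_real (1 / ?b) * ?w i)"
        by (simp add: sq_norm_on_def)
      also have "\<dots> = (1 / ?b)\<^sup>2 * sq_norm_on {..<p} ?w"
        unfolding sq_norm_on_scale using b by (simp add: norm_divide)
      finally have "euclid_norm (A *\<^sub>v v) = sqrt ((1 / ?b)\<^sup>2 * sq_norm_on {..<p} ?w)"
        using A by (simp add: euclid_norm_sq_norm)
      also have "\<dots> = 1 / ?b * sqrt (sq_norm_on {..<p} ?w)"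
        unfolding real_sqrt_mult using b by simp
      finally show ?thesis by simp
    qed
    ultimately show ?thesis using b by (simp add: pos_divide_le_eq)
  qed
  have "bilin {..<p} {..<q} (\<lambda>i j. A $$ (i, j)) x y = (\<Sum>i<p. x i * ?w i)"
    by (simp add: bilin_def sum_distrib_left mult.assoc)
  then have "cmod (bilin {..<p} {..<q} (\<lambda>i j. A $$ (i, j)) x y) \<le>
      sqrt (sq_norm_on {..<p} x) * sqrt (sq_norm_on {..<p} ?w)"
    using cauchy_schwarz_on by simp
  also have "\<dots> \<le> sqrt (sq_norm_on {..<p} x) * (op_norm A * ?b)"
    by (intro mult_left_mono w) simp
  finally show "cmod (bilin {..<p} {..<q} (\<lambda>i j. A $$ (i, j)) x y) \<le>
      op_norm A * sqrt (sq_norm_on {..<p} x) * ?b"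
    by (simp add: mult_ac)
qed

section \<open>Completion of orthonormal families to bases\<close>

text \<open>The squared entries of an incomplete family sum to less than \<open>card S\<close>, so
  at some coordinate they sum to less than 1. The coordinate vector there has a nonzero residual,
  which is normalized and appended.\<close>

lemma orthonormal_on_extend_basis:
  assumes "orthonormal_on S K u" "finite S" "K \<le> card S"
  obtains w where "orthonormal_on S (card S) w" "\<And>k. k < K \<Longrightarrow> w k = u k"
proof -
  have "\<exists>w. orthonormal_on S (K + d) w \<and> (\<forall>k<K. w k = u k)" if "K + d \<le> card S" for d
    using that
  proof (induction d)
    case 0
    then show ?case using assms by auto
  next
    case (Suc d)
    then obtain w where w: "orthonormal_on S (K + d) w" "\<forall>k<K. w k = u k" by auto
    have "\<not> (\<forall>i\<in>S. (\<Sum>k<K + d. (cmod (w k i))\<^sup>2) \<ge> 1)"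
    proof
      assume "\<forall>i\<in>S. (\<Sum>k<K + d. (cmod (w k i))\<^sup>2) \<ge> 1"
      then have "(\<Sum>i\<in>S. 1) \<le> (\<Sum>i\<in>S. \<Sum>k<K + d. (cmod (w k i))\<^sup>2)" by (intro sum_mono) auto
      then show False using orthonormal_on_card_eq[OF w(1)] Suc.prems by simp
    qed
    then obtain i where i: "i \<in> S" "(\<Sum>k<K + d. (cmod (w k i))\<^sup>2) < 1" by force
    define e where "e l = (if l = i then 1 else 0 :: complex)" for l
    define x where "x = residual S (K + d) w e"
    have e_prod: "(\<Sum>l\<in>S. e l * cnj (w k l)) = cnj (w k i)" for k
      using i(1) assms(2) by (simp add: e_def if_distrib[of "\<lambda>z. z * _"] cong: if_cong)
    have "sq_norm_on S e = (\<Sum>l\<in>S. if l = i then 1 else 0)"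
      unfolding sq_norm_on_def by (intro sum.cong) (auto simp: e_def)
    then have "sq_norm_on S e = 1" using i(1) assms(2) by simp
    then have pos: "sq_norm_on S x > 0"
      unfolding x_def sq_norm_residual[OF w(1)] e_prod using i(2) by simp
    define c where "c = sqrt (sq_norm_on S x)"
    define y where "y l = of_real (1 / c) * x l" for l
    have "orthonormal_on S (Suc (K + d)) (w(K + d := y))"
    proof (rule orthonormal_on_extend[OF w(1)])
      show "sq_norm_on S y = 1"
        unfolding y_def sq_norm_on_scale using pos by (simp add: c_def norm_divide power_divide)
      show "(\<Sum>l\<in>S. y l * cnj (w k l)) = 0" if "k < K + d" for k
        using residual_orthogonal[OF w(1) that, of e]
        by (simp add: y_def x_def mult.assoc flip: sum_divide_distrib)
    qed
    moreover have "\<forall>k<K. (w(K + d := y)) k = u k" using w(2) by simp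
    ultimately show ?case unfolding add_Suc_right by blast
  qed
  from this[of "card S - K"] show thesis using assms(3) that by auto
qed

text \<open>The coordinate sums are at most 1 and add up to \<open>card S\<close>, so all of them
  equal 1. Hence every coordinate vector has zero residual and equals its own expansion.\<close>

lemma orthonormal_basis_complete:
  assumes u: "orthonormal_on S (card S) u" and fin: "finite S" and "i \<in> S" "j \<in> S"
  shows "(\<Sum>k<card S. u k i * cnj (u k j)) = (if i = j then 1 else 0)"
proof -
  define e where "e l = (if l = j then 1 else 0 :: complex)" for l
  have e_prod: "(\<Sum>l\<in>S. e l * cnj (u k l)) = cnj (u k j)" for k
    using \<open>j \<in> S\<close> fin by (simp add: e_def if_distrib[of "\<lambda>z. z * _"] cong: if_cong)
  have "sq_norm_on S e = (\<Sum>l\<in>S. if l = j then 1 else 0)"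
    unfolding sq_norm_on_def by (intro sum.cong) (auto simp: e_def)
  then have e1: "sq_norm_on S e = 1" using \<open>j \<in> S\<close> fin by simp
  have "(\<Sum>i\<in>S. 1 - (\<Sum>k<card S. (cmod (u k i))\<^sup>2)) = 0"
    using orthonormal_on_card_eq[OF u] by (simp add: sum_subtractf)
  then have "1 - (\<Sum>k<card S. (cmod (u k j))\<^sup>2) = 0"
    using orthonormal_on_sum_sq_le[OF u fin] fin \<open>j \<in> S\<close> by (subst (asm) sum_nonneg_eq_0_iff) auto
  then have "sq_norm_on S (residual S (card S) u e) = 0"
    by (simp add: sq_norm_residual[OF u] e_prod e1)
  then have "residual S (card S) u e i = 0"
    using fin \<open>i \<in> S\<close> by (simp add: sq_norm_on_def sum_nonneg_eq_0_iff)
  then have "e i = (\<Sum>k<card S. cnj (u k j) * u k i)" unfolding residual_def e_prod by simp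
  then show ?thesis by (simp add: e_def mult.commute)
qed

subsection \<open>Hermitian matrices and singular values\<close>

lemma eigenvector_exists:
  fixes C :: "complex mat"
  assumes C: "C \<in> carrier_mat m m" and "m > 0"
  obtains x \<mu> where "\<And>a. a < m \<Longrightarrow> (\<Sum>b<m. C $$ (a, b) * x b) = \<mu> * x a" "\<exists>a<m. x a \<noteq> 0"
proof -
  have "degree (char_poly C) = m" using degree_monic_char_poly[OF C] by blast
  then have "\<not> constant (poly (char_poly C))" using \<open>m > 0\<close> by (simp add: constant_degree)
  then obtain \<mu> where "poly (char_poly C) \<mu> = 0" using fundamental_theorem_of_algebra by blast
  then obtain v where v: "eigenvector C v \<mu>"
    using eigenvalue_root_char_poly[OF C] unfolding eigenvalue_def by blast
  then have v': "v \<in> carrier_vec m" "v \<noteq> 0\<^sub>v m" "C *\<^sub>v v = \<mu> \<cdot>\<^sub>v v"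
    using C by (auto simp: eigenvector_def)
  show thesis
  proof (rule that[of "\<lambda>b. v $ b" \<mu>])
    show "(\<Sum>b<m. C $$ (a, b) * v $ b) = \<mu> * v $ a" if "a < m" for a
      using mult_mat_vec_entry[OF C v'(1) that] v'(1) that by (simp add: v'(3))
    show "\<exists>a<m. v $ a \<noteq> 0"
    proof (rule ccontr)
      assume "\<not> ?thesis"
      then have "v = 0\<^sub>v m" using v'(1) by (intro eq_vecI) auto
      then show False using v'(2) by blast
    qed
  qed
qed

text \<open>Deflation: an eigenvector of the compression of \<open>G\<close> to the orthogonal complement of the
  eigenvectors found so far is again an eigenvector of \<open>G\<close>, because \<open>G\<close> is Hermitian.\<close>

lemma hermitian_eigenbasis:
  fixes G :: "nat \<Rightarrow> nat \<Rightarrow> complex"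
  assumes herm: "\<And>i j. i < n \<Longrightarrow> j < n \<Longrightarrow> G i j = cnj (G j i)"
  obtains u \<nu> where "orthonormal_on {..<n} n u"
    "\<And>k i. k < n \<Longrightarrow> i < n \<Longrightarrow> (\<Sum>j<n. G i j * u k j) = \<nu> k * u k i"
proof -
  have "\<exists>u \<nu>. orthonormal_on {..<n} K u \<and> (\<forall>k<K. \<forall>i<n. (\<Sum>j<n. G i j * u k j) = \<nu> k * u k i)"
    if "K \<le> n" for K
    using that
  proof (induction K)
    case 0
    then show ?case by (simp add: orthonormal_on_def)
  next
    case (Suc K)
    then obtain u \<nu> where u: "orthonormal_on {..<n} K u" and
      eig: "\<And>k i. k < K \<Longrightarrow> i < n \<Longrightarrow> (\<Sum>j<n. G i j * u k j) = \<nu> k * u k i" by auto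
    obtain w where w: "orthonormal_on {..<n} n w" and wu: "\<And>k. k < K \<Longrightarrow> w k = u k"
      using orthonormal_on_extend_basis[OF u] Suc.prems by auto
    define m where "m = n - K"
    \<comment> \<open>The matrix of the compression of \<open>G\<close>, with respect to the vectors
      completing the eigenvectors already found to a basis.\<close>
    define C where "C = mat m m (\<lambda>(a, b). \<Sum>i<n. \<Sum>j<n. cnj (w (K + a) i) * G i j * w (K + b) j)"
    have "C \<in> carrier_mat m m" "m > 0" using Suc.prems by (auto simp: C_def m_def)
    then obtain x \<mu> where x: "\<And>a. a < m \<Longrightarrow> (\<Sum>b<m. C $$ (a, b) * x b) = \<mu> * x a" "\<exists>a<m. x a \<noteq> 0"
      by (rule eigenvector_exists) blast
    define v where "v i = (\<Sum>b<m. x b * w (K + b) i)" for i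
    define Gv where "Gv i = (\<Sum>j<n. G i j * v j)" for i
    have v_prod: "(\<Sum>i<n. v i * cnj (w k i)) = (\<Sum>b<m. if K + b = k then x b else 0)" if "k < n" for k
    proof -
      have "(\<Sum>i<n. v i * cnj (w k i)) = (\<Sum>i<n. \<Sum>b<m. x b * (w (K + b) i * cnj (w k i)))"
        by (simp add: v_def sum_distrib_right mult.assoc)
      also have "\<dots> = (\<Sum>b<m. x b * (\<Sum>i<n. w (K + b) i * cnj (w k i)))"
        by (subst sum.swap) (simp add: sum_distrib_left)
      also have "\<dots> = (\<Sum>b<m. if K + b = k then x b else 0)"
        using w that Suc.prems by (intro sum.cong) (auto simp: orthonormal_on_def m_def)
      finally show ?thesis .
    qed
    have v_low: "(\<Sum>i<n. v i * cnj (w k i)) = 0" if "k < K" for k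
      using v_prod[of k] that Suc.prems by simp
    have v_high: "(\<Sum>i<n. v i * cnj (w (K + a) i)) = x a" if "a < m" for a
      using v_prod[of "K + a"] that by (simp add: m_def)
    \<comment> \<open>The image of \<open>v\<close> under \<open>G\<close> and \<mu> times
      \<open>v\<close> have the same coefficients in the basis \<open>w\<close>. On the old
      eigenvectors both vanish, \<open>G\<close> being moved to the other side there because it is
      Hermitian; on the rest this is the eigenvector equation of \<open>C\<close>.\<close>
    have Gv_prod: "(\<Sum>i<n. Gv i * cnj (w k i)) = \<mu> * (\<Sum>i<n. v i * cnj (w k i))" if "k < n" for k
    proof (cases "k < K")
      case True
      have "(\<Sum>i<n. Gv i * cnj (w k i)) = (\<Sum>i<n. \<Sum>j<n. G i j * v j * cnj (w k i))"
        by (simp add: Gv_def sum_distrib_right)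
      also have "\<dots> = (\<Sum>j<n. \<Sum>i<n. v j * cnj (G j i * w k i))"
        by (subst sum.swap, intro sum.cong refl) (simp add: herm[symmetric])
      also have "\<dots> = (\<Sum>j<n. v j * cnj (\<Sum>i<n. G j i * w k i))"
        by (simp add: sum_distrib_left)
      also have "\<dots> = (\<Sum>j<n. cnj (\<nu> k) * (v j * cnj (w k j)))"
        using eig[OF True] wu[OF True] by (intro sum.cong) auto
      also have "\<dots> = cnj (\<nu> k) * (\<Sum>j<n. v j * cnj (w k j))"
        by (rule sum_distrib_left[symmetric])
      also have "\<dots> = 0" using v_low[OF True] by simp
      finally show ?thesis using v_low[OF True] by simp
    next
      case False
      then obtain a where a: "k = K + a" using le_Suc_ex[of K k] by auto
      then have am: "a < m" using that by (simp add: m_def)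
      have "(\<Sum>i<n. Gv i * cnj (w k i)) = (\<Sum>i<n. \<Sum>j<n. \<Sum>b<m. cnj (w k i) * G i j * w (K + b) j * x b)"
        by (simp add: Gv_def v_def sum_distrib_left sum_distrib_right mult_ac)
      also have "\<dots> = (\<Sum>i<n. \<Sum>b<m. \<Sum>j<n. cnj (w k i) * G i j * w (K + b) j * x b)"
        by (intro sum.cong refl sum.swap)
      also have "\<dots> = (\<Sum>b<m. \<Sum>i<n. \<Sum>j<n. cnj (w k i) * G i j * w (K + b) j * x b)"
        by (rule sum.swap)
      also have "\<dots> = (\<Sum>b<m. C $$ (a, b) * x b)"
        using a am by (simp add: C_def sum_distrib_right)
      finally show ?thesis using x(1)[OF am] v_high[OF am] a by simp
    qed
    have Gv: "Gv i = \<mu> * v i" if "i < n" for i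
    proof -
      \<comment> \<open>By completeness of \<open>w\<close>, a vector with all coefficients 0 is
        zero.\<close>
      define z where "z i = Gv i - \<mu> * v i" for i
      have z_prod: "(\<Sum>i<n. z i * cnj (w k i)) = 0" if "k < n" for k
        using Gv_prod[OF that] by (simp add: z_def left_diff_distrib sum_subtractf sum_distrib_left mult.assoc)
      have "(\<Sum>j<n. z j * (if i = j then 1 else 0)) = (\<Sum>j<n. if i = j then z j else 0)"
        by (intro sum.cong) auto
      then have "z i = (\<Sum>j<n. z j * (if i = j then 1 else 0))" using that by simp
      also have "\<dots> = (\<Sum>j<n. z j * (\<Sum>k<n. w k i * cnj (w k j)))"
        using orthonormal_basis_complete[of "{..<n}" w] w that by (intro sum.cong) auto
      also have "\<dots> = (\<Sum>j<n. \<Sum>k<n. w k i * (z j * cnj (w k j)))"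
        by (simp add: sum_distrib_left mult_ac)
      also have "\<dots> = (\<Sum>k<n. w k i * (\<Sum>j<n. z j * cnj (w k j)))"
        by (subst sum.swap) (simp add: sum_distrib_left)
      also have "\<dots> = 0" using z_prod by simp
      finally show ?thesis by (simp add: z_def)
    qed
    have "sq_norm_on {..<n} v > 0"
    proof -
      obtain a where a: "a < m" "x a \<noteq> 0" using x(2) by blast
      have "\<not> (\<forall>i<n. v i = 0)"
      proof
        assume "\<forall>i<n. v i = 0"
        then have "(\<Sum>i<n. v i * cnj (w (K + a) i)) = 0" by simp
        then show False using v_high[OF a(1)] a(2) by simp
      qed
      then obtain i where "i < n" "v i \<noteq> 0" by blast
      then have "0 < (cmod (v i))\<^sup>2" "(cmod (v i))\<^sup>2 \<le> sq_norm_on {..<n} v"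
        unfolding sq_norm_on_def by (auto intro!: member_le_sum)
      then show ?thesis by linarith
    qed
    define c where "c = sqrt (sq_norm_on {..<n} v)"
    define y where "y l = of_real (1 / c) * v l" for l
    have "orthonormal_on {..<n} (Suc K) (u(K := y))"
    proof (rule orthonormal_on_extend[OF u])
      show "sq_norm_on {..<n} y = 1"
        unfolding y_def sq_norm_on_scale using \<open>sq_norm_on {..<n} v > 0\<close>
        by (simp add: c_def norm_divide power_divide)
      show "(\<Sum>l<n. y l * cnj (u k l)) = 0" if "k < K" for k
        using v_low[OF that] wu[OF that] by (simp add: y_def mult.assoc flip: sum_divide_distrib)
    qed
    moreover have "\<forall>k<Suc K. \<forall>i<n. (\<Sum>j<n. G i j * (u(K := y)) k j) = (\<nu>(K := \<mu>)) k * (u(K := y)) k i"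
    proof (intro allI impI)
      fix k i assume k: "k < Suc K" and i: "i < n"
      show "(\<Sum>j<n. G i j * (u(K := y)) k j) = (\<nu>(K := \<mu>)) k * (u(K := y)) k i"
      proof (cases "k = K")
        case True
        have "(\<Sum>j<n. G i j * y j) = of_real (1 / c) * Gv i"
          by (simp add: y_def Gv_def sum_distrib_left mult_ac)
        then show ?thesis using True Gv[OF i] by (simp add: y_def)
      qed (use k i eig in auto)
    qed
    ultimately show ?case by blast
  qed
  then show thesis using that by blast
qed

text \<open>An orthonormal eigenbasis diagonalizes \<open>G\<close> by a similarity, and a
  similarity preserves the characteristic polynomial. This links eigenvectors to the definition of
  \<open>singular_values\<close> with the right multiplicities.\<close>

lemma char_poly_eigenbasis:
  fixes G :: "complex mat"
  assumes G: "G \<in> carrier_mat n n" and u: "orthonormal_on {..<n} n u"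
    and eig: "\<And>k i. k < n \<Longrightarrow> i < n \<Longrightarrow> (\<Sum>j<n. G $$ (i, j) * u k j) = \<nu> k * u k i"
  shows "proots (char_poly G) = image_mset \<nu> (mset_set {..<n})"
proof -
  define U where "U = mat n n (\<lambda>(i, k). u k i)"
  define V where "V = mat n n (\<lambda>(k, i). cnj (u k i))"
  define D where "D = mat n n (\<lambda>(i, k). if i = k then \<nu> k else 0)"
  have carrier: "U \<in> carrier_mat n n" "V \<in> carrier_mat n n" "D \<in> carrier_mat n n"
    by (simp_all add: U_def V_def D_def)
  have entry: "(X * Y) $$ (i, j) = (\<Sum>k<n. X $$ (i, k) * Y $$ (k, j))"
    if "X \<in> carrier_mat n n" "Y \<in> carrier_mat n n" "i < n" "j < n" for X Y :: "complex mat" and i j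
    using that by (auto simp: scalar_prod_def atLeast0LessThan)
  have UV: "U * V = 1\<^sub>m n"
  proof (rule eq_matI)
    fix i j assume "i < dim_row (1\<^sub>m n)" "j < dim_col (1\<^sub>m n)"
    then have ij: "i < n" "j < n" by auto
    then show "(U * V) $$ (i, j) = 1\<^sub>m n $$ (i, j)"
      using orthonormal_basis_complete[of "{..<n}" u i j] u
      by (subst entry) (auto simp: carrier U_def V_def)
  qed (use carrier in auto)
  have VU: "V * U = 1\<^sub>m n"
  proof (rule eq_matI)
    fix i j assume "i < dim_row (1\<^sub>m n)" "j < dim_col (1\<^sub>m n)"
    then have ij: "i < n" "j < n" by auto
    then have "(\<Sum>l<n. u j l * cnj (u i l)) = (if j = i then 1 else 0)"
      using u by (simp add: orthonormal_on_def)
    then show "(V * U) $$ (i, j) = 1\<^sub>m n $$ (i, j)"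
      using ij by (subst entry) (auto simp: carrier U_def V_def mult.commute)
  qed (use carrier in auto)
  have GU: "G * U = U * D"
  proof (rule eq_matI)
    fix i k assume "i < dim_row (U * D)" "k < dim_col (U * D)"
    then have ik: "i < n" "k < n" using carrier by auto
    have "(G * U) $$ (i, k) = \<nu> k * u k i"
      using ik eig[OF ik(2,1)] by (subst entry) (auto simp: carrier G U_def)
    also have "\<dots> = (\<Sum>l<n. if l = k then u l i * \<nu> k else 0)" using ik by simp
    also have "\<dots> = (\<Sum>l<n. U $$ (i, l) * D $$ (l, k))"
      using ik by (intro sum.cong) (auto simp: U_def D_def)
    also have "\<dots> = (U * D) $$ (i, k)" by (rule entry[OF carrier(1,3) ik, symmetric])
    finally show "(G * U) $$ (i, k) = (U * D) $$ (i, k)" .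
  qed (use carrier G in auto)
  have "G = G * (U * V)" using UV G by simp
  also have "\<dots> = G * U * V" using carrier G by (simp add: assoc_mult_mat[of _ n n _ n _ n])
  finally have "G = U * D * V" unfolding GU .
  then have "similar_mat G D"
    unfolding similar_mat_def using similar_mat_witI[OF UV VU _ G carrier(3,1,2)] by blast
  then have "char_poly G = char_poly D" by (rule char_poly_similar)
  also have "\<dots> = (\<Prod>a\<leftarrow>diag_mat D. [:- a, 1:])"
    by (rule char_poly_upper_triangular[OF carrier(3)]) (auto simp: D_def)
  also have "diag_mat D = map \<nu> [0..<n]" by (auto simp: diag_mat_def D_def)
  also have "(\<Prod>a\<leftarrow>map \<nu> [0..<n]. [:- a, 1:]) = (\<Prod>k<n. [:- \<nu> k, 1:])"
    by (simp add: prod.distinct_set_conv_list[symmetric] atLeast0LessThan[symmetric] comp_def)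
  finally have "proots (char_poly G) = (\<Sum>k<n. proots [:- \<nu> k, 1:])"
    by (simp only:) (subst proots_prod, auto)
  also have "\<dots> = image_mset \<nu> (mset_set {..<n})"
    by (induction n) (simp_all add: lessThan_Suc)
  finally show ?thesis .
qed

section \<open>Counting large singular values\<close>

text \<open>Gaussian elimination: fewer equations than unknowns have a nontrivial solution, by
  induction on the number of equations.\<close>

lemma homogeneous_system_solution:
  fixes b :: "nat \<Rightarrow> 'a \<Rightarrow> 'b :: field"
  assumes "finite J" "r < card J"
  obtains c where "\<exists>k\<in>J. c k \<noteq> 0" "\<And>l. l < r \<Longrightarrow> (\<Sum>k\<in>J. b l k * c k) = 0"
proof -
  have "\<exists>c. (\<exists>k\<in>J. c k \<noteq> 0) \<and> (\<forall>l<r. (\<Sum>k\<in>J. b l k * c k) = 0)"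
    using assms
  proof (induction r arbitrary: J b)
    case 0
    then obtain k where "k \<in> J" by fastforce
    then show ?case by (intro exI[of _ "\<lambda>_. 1"]) auto
  next
    case (Suc r)
    show ?case
    proof (cases "\<forall>k\<in>J. b r k = 0")
      case True
      obtain c where "\<exists>k\<in>J. c k \<noteq> 0" "\<forall>l<r. (\<Sum>k\<in>J. b l k * c k) = 0"
        using Suc.IH[of J b] Suc.prems by auto
      then show ?thesis using True by (intro exI[of _ c]) (auto simp: less_Suc_eq)
    next
      case False
      then obtain k0 where k0: "k0 \<in> J" "b r k0 \<noteq> 0" by blast
      let ?J = "J - {k0}"
      \<comment> \<open>Equation \<open>r\<close> is used to eliminate the unknown
        \<open>k0\<close>. Its own reduced coefficients are all 0, so it holds automatically once
        \<open>c' k0\<close> is found by back substitution.\<close>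
      let ?b = "\<lambda>l k. b l k - b l k0 * b r k / b r k0"
      obtain c where c: "\<exists>k\<in>?J. c k \<noteq> 0" "\<forall>l<r. (\<Sum>k\<in>?J. ?b l k * c k) = 0"
      proof -
        have "finite ?J" "r < card ?J" using Suc.prems k0 by (auto simp: card_Diff_singleton)
        then show thesis using Suc.IH[of ?J ?b] that by blast
      qed
      define c' where "c' = c(k0 := - (\<Sum>k\<in>?J. b r k * c k) / b r k0)"
      have split: "(\<Sum>k\<in>J. b l k * c' k) = (\<Sum>k\<in>?J. ?b l k * c k)" for l
      proof -
        have "(\<Sum>k\<in>J. b l k * c' k) = b l k0 * c' k0 + (\<Sum>k\<in>?J. b l k * c' k)"
          by (rule sum.remove) (use Suc.prems k0 in auto)
        moreover have "(\<Sum>k\<in>?J. b l k * c' k) = (\<Sum>k\<in>?J. b l k * c k)"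
          by (intro sum.cong) (auto simp: c'_def)
        moreover have "b l k0 * c' k0 = - (\<Sum>k\<in>?J. b l k0 * b r k / b r k0 * c k)"
          by (simp add: c'_def sum_distrib_left sum_divide_distrib mult.assoc)
        ultimately show ?thesis by (simp add: left_diff_distrib sum_subtractf)
      qed
      have "(\<Sum>k\<in>J. b l k * c' k) = 0" if "l < Suc r" for l
        unfolding split using c(2) that k0(2) by (auto simp: less_Suc_eq)
      moreover have "\<exists>k\<in>J. c' k \<noteq> 0" using c(1) by (auto simp: c'_def)
      ultimately show ?thesis by blast
    qed
  qed
  then show thesis using that by blast
qed

text \<open>The images of the eigenvectors are orthogonal, with \<nu> k the squared length of the
  image of \<open>u k\<close>. If more than \<open>r\<close> of these lengths exceeded \<omega>,
  some nonzero combination \<open>v\<close> of the corresponding eigenvectors would be annihilated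
  by the rank part. On \<open>v\<close> the matrix then agrees with \<open>N\<close>, so it
  stretches \<open>v\<close> by at most \<omega>, whereas by orthogonality it stretches it by
  more.\<close>

lemma card_large_singular_values_le:
  fixes M :: "nat \<Rightarrow> nat \<Rightarrow> complex"
  assumes split: "rank_norm_split S T r \<omega> M" and "0 \<le> \<omega>" and fin: "finite S" "finite T"
    and u: "orthonormal_on T n u"
    and eig: "\<And>k i. k < n \<Longrightarrow> i \<in> T \<Longrightarrow>
        (\<Sum>j\<in>T. (\<Sum>l\<in>S. cnj (M l i) * M l j) * u k j) = \<nu> k * u k i"
  shows "\<And>k. k < n \<Longrightarrow> 0 \<le> Re (\<nu> k)" and "card {k. k < n \<and> \<omega> < sqrt (Re (\<nu> k))} \<le> r"
proof -
  define w where "w k i = (\<Sum>j\<in>T. M i j * u k j)" for k i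
  have inner: "(\<Sum>l\<in>S. w k l * cnj (w k' l)) = (if k = k' then \<nu> k else 0)" if "k < n" "k' < n" for k k'
  proof -
    have "(\<Sum>l\<in>S. w k l * cnj (w k' l)) = (\<Sum>l\<in>S. \<Sum>i\<in>T. \<Sum>j\<in>T. cnj (M l i) * M l j * u k j * cnj (u k' i))"
      by (simp add: w_def sum_distrib_left sum_distrib_right mult_ac)
    also have "\<dots> = (\<Sum>i\<in>T. \<Sum>l\<in>S. \<Sum>j\<in>T. cnj (M l i) * M l j * u k j * cnj (u k' i))"
      by (rule sum.swap)
    also have "\<dots> = (\<Sum>i\<in>T. \<Sum>j\<in>T. \<Sum>l\<in>S. cnj (M l i) * M l j * u k j * cnj (u k' i))"
      by (intro sum.cong refl sum.swap)
    also have "\<dots> = (\<Sum>i\<in>T. (\<Sum>j\<in>T. (\<Sum>l\<in>S. cnj (M l i) * M l j) * u k j) * cnj (u k' i))"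
      by (simp only: sum_distrib_right)
    also have "\<dots> = (\<Sum>i\<in>T. \<nu> k * (u k i * cnj (u k' i)))"
      using eig[OF that(1)] by (intro sum.cong) auto
    also have "\<dots> = \<nu> k * (\<Sum>i\<in>T. u k i * cnj (u k' i))" by (rule sum_distrib_left[symmetric])
    finally show ?thesis using u that by (simp add: orthonormal_on_def)
  qed
  have \<nu>: "\<nu> k = of_real (sq_norm_on S (w k))" if "k < n" for k
    using inner[OF that that] by (simp add: of_real_sq_norm_on)
  then show nonneg: "0 \<le> Re (\<nu> k)" if "k < n" for k using that by simp
  define J where "J = {k. k < n \<and> \<omega> < sqrt (Re (\<nu> k))}"
  have finJ: "finite J" by (simp add: J_def)
  show "card {k. k < n \<and> \<omega> < sqrt (Re (\<nu> k))} \<le> r"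
  proof (rule ccontr)
    assume "\<not> card {k. k < n \<and> \<omega> < sqrt (Re (\<nu> k))} \<le> r"
    then have J: "r < card J" by (simp add: J_def)
    obtain N where R: "low_rank S T r (\<lambda>i j. M i j - N i j)" and N: "norm_bound S T \<omega> N"
      using split unfolding rank_norm_split_def by blast
    obtain x y where xy: "\<And>i j. i \<in> S \<Longrightarrow> j \<in> T \<Longrightarrow> M i j - N i j = (\<Sum>l<r. x l i * y l j)"
      using R unfolding low_rank_def by blast
    obtain c where c: "\<exists>k\<in>J. c k \<noteq> 0" "\<And>l. l < r \<Longrightarrow> (\<Sum>k\<in>J. (\<Sum>j\<in>T. y l j * u k j) * c k) = 0"
      using homogeneous_system_solution[OF finJ J, of "\<lambda>l k. \<Sum>j\<in>T. y l j * u k j"] by blast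
    define v where "v j = (\<Sum>k\<in>J. c k * u k j)" for j
    have Mv: "(\<Sum>j\<in>T. M i j * v j) = (\<Sum>k\<in>J. c k * w k i)" for i
    proof -
      have "(\<Sum>j\<in>T. M i j * v j) = (\<Sum>j\<in>T. \<Sum>k\<in>J. c k * (M i j * u k j))"
        by (simp add: v_def sum_distrib_left mult_ac)
      also have "\<dots> = (\<Sum>k\<in>J. c k * w k i)"
        by (subst sum.swap) (simp add: w_def sum_distrib_left)
      finally show ?thesis .
    qed
    have yv: "(\<Sum>j\<in>T. y l j * v j) = 0" if "l < r" for l
    proof -
      have "(\<Sum>j\<in>T. y l j * v j) = (\<Sum>j\<in>T. \<Sum>k\<in>J. y l j * u k j * c k)"
        by (simp add: v_def sum_distrib_left mult_ac)
      also have "\<dots> = (\<Sum>k\<in>J. (\<Sum>j\<in>T. y l j * u k j) * c k)"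
        by (subst sum.swap) (simp add: sum_distrib_right)
      finally show ?thesis using c(2)[OF that] by simp
    qed
    have MN: "(\<Sum>j\<in>T. M i j * v j) = (\<Sum>j\<in>T. N i j * v j)" if "i \<in> S" for i
    proof -
      have "(\<Sum>j\<in>T. M i j * v j) - (\<Sum>j\<in>T. N i j * v j) = (\<Sum>j\<in>T. (M i j - N i j) * v j)"
        by (simp add: left_diff_distrib sum_subtractf)
      also have "\<dots> = (\<Sum>j\<in>T. \<Sum>l<r. x l i * (y l j * v j))"
        using xy[OF that] by (intro sum.cong) (simp_all add: sum_distrib_right mult.assoc)
      also have "\<dots> = (\<Sum>l<r. x l i * (\<Sum>j\<in>T. y l j * v j))"
        by (subst sum.swap) (simp add: sum_distrib_left)
      also have "\<dots> = 0" using yv by simp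
      finally show ?thesis by simp
    qed
    \<comment> \<open>Pythagoras for an orthogonal family with squared lengths \<open>d k\<close>,
      used once for the eigenvectors and once for their images.\<close>
    have pair: "(\<Sum>i\<in>A. (\<Sum>k\<in>J. c k * z k i) * cnj (\<Sum>k\<in>J. c k * z k i)) = (\<Sum>k\<in>J. of_real ((cmod (c k))\<^sup>2) * d k)"
      if z: "\<And>k k'. k \<in> J \<Longrightarrow> k' \<in> J \<Longrightarrow> (\<Sum>i\<in>A. z k i * cnj (z k' i)) = (if k = k' then d k else 0)"
      for A :: "nat set" and z d
    proof -
      have "(\<Sum>i\<in>A. (\<Sum>k\<in>J. c k * z k i) * cnj (\<Sum>k\<in>J. c k * z k i)) =
          (\<Sum>i\<in>A. \<Sum>k\<in>J. \<Sum>k'\<in>J. c k * cnj (c k') * (z k i * cnj (z k' i)))"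
        unfolding cnj_sum sum_product by (simp add: mult_ac)
      also have "\<dots> = (\<Sum>k\<in>J. \<Sum>i\<in>A. \<Sum>k'\<in>J. c k * cnj (c k') * (z k i * cnj (z k' i)))"
        by (rule sum.swap)
      also have "\<dots> = (\<Sum>k\<in>J. \<Sum>k'\<in>J. \<Sum>i\<in>A. c k * cnj (c k') * (z k i * cnj (z k' i)))"
        by (intro sum.cong refl sum.swap)
      also have "\<dots> = (\<Sum>k\<in>J. \<Sum>k'\<in>J. if k = k' then c k * cnj (c k') * d k else 0)"
        using z by (intro sum.cong refl) (simp add: sum_distrib_left[symmetric])
      also have "\<dots> = (\<Sum>k\<in>J. c k * cnj (c k) * d k)" using finJ by simp
      finally show ?thesis by (simp add: complex_norm_square del: of_real_power)
    qed
    have "complex_of_real (sq_norm_on T v) = (\<Sum>k\<in>J. of_real ((cmod (c k))\<^sup>2) * 1)"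
      unfolding of_real_sq_norm_on v_def
      by (rule pair) (use u in \<open>auto simp: orthonormal_on_def J_def\<close>)
    then have nv: "sq_norm_on T v = (\<Sum>k\<in>J. (cmod (c k))\<^sup>2)"
      by (simp only: mult_1_right of_real_sum[symmetric] of_real_eq_iff)
    have "complex_of_real (sq_norm_on S (\<lambda>i. \<Sum>j\<in>T. M i j * v j)) =
        (\<Sum>k\<in>J. of_real ((cmod (c k))\<^sup>2) * of_real (sq_norm_on S (w k)))"
      unfolding Mv of_real_sq_norm_on[of S "\<lambda>i. \<Sum>k\<in>J. c k * w k i"]
      by (rule pair) (use inner \<nu> in \<open>auto simp: J_def\<close>)
    then have nMv: "sq_norm_on S (\<lambda>i. \<Sum>j\<in>T. M i j * v j) = (\<Sum>k\<in>J. (cmod (c k))\<^sup>2 * sq_norm_on S (w k))"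
      by (simp only: of_real_mult[symmetric] of_real_sum[symmetric] of_real_eq_iff)
    have large: "\<omega>\<^sup>2 < sq_norm_on S (w k)" if "k \<in> J" for k
    proof -
      have "\<omega> < sqrt (sq_norm_on S (w k))" using that \<nu>[of k] by (auto simp: J_def)
      then have "\<omega>\<^sup>2 < (sqrt (sq_norm_on S (w k)))\<^sup>2" using \<open>0 \<le> \<omega>\<close> by (intro power_strict_mono) auto
      then show ?thesis by simp
    qed
    obtain k where k: "k \<in> J" "c k \<noteq> 0" using c(1) by blast
    have "\<omega>\<^sup>2 * sq_norm_on T v = (\<Sum>k\<in>J. (cmod (c k))\<^sup>2 * \<omega>\<^sup>2)"
      by (simp add: nv sum_distrib_left mult.commute)
    also have "\<dots> < (\<Sum>k\<in>J. (cmod (c k))\<^sup>2 * sq_norm_on S (w k))"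
    proof (rule sum_strict_mono_ex1[OF finJ])
      show "\<forall>k\<in>J. (cmod (c k))\<^sup>2 * \<omega>\<^sup>2 \<le> (cmod (c k))\<^sup>2 * sq_norm_on S (w k)"
        using large by (intro ballI mult_left_mono less_imp_le zero_le_power2)
      show "\<exists>k\<in>J. (cmod (c k))\<^sup>2 * \<omega>\<^sup>2 < (cmod (c k))\<^sup>2 * sq_norm_on S (w k)"
        by (rule bexI[OF _ k(1)], rule mult_strict_left_mono[OF large[OF k(1)]]) (use k(2) in simp)
    qed
    also have "\<dots> = sq_norm_on S (\<lambda>i. \<Sum>j\<in>T. N i j * v j)"
      unfolding nMv[symmetric] unfolding sq_norm_on_def using MN by simp
    also have "\<dots> = (sqrt (sq_norm_on S (\<lambda>i. \<Sum>j\<in>T. N i j * v j)))\<^sup>2" by simp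
    also have "\<dots> \<le> (\<omega> * sqrt (sq_norm_on T v))\<^sup>2"
      by (intro power_mono norm_boundD_image[OF N \<open>0 \<le> \<omega>\<close>]) simp
    also have "\<dots> = \<omega>\<^sup>2 * sq_norm_on T v" by (simp add: power_mult_distrib)
    finally show False by simp
  qed
qed

text \<open>Needed for matrices with more columns than rows: their singular values are defined by
  the Gram matrix of the adjoint.\<close>

lemma rank_norm_split_adjoint:
  assumes "rank_norm_split S T r \<omega> M"
  shows "rank_norm_split T S r \<omega> (\<lambda>j i. cnj (M i j))"
proof -
  obtain N where R: "low_rank S T r (\<lambda>i j. M i j - N i j)" and N: "norm_bound S T \<omega> N"
    using assms unfolding rank_norm_split_def by blast
  obtain x y where xy: "\<And>i j. i \<in> S \<Longrightarrow> j \<in> T \<Longrightarrow> M i j - N i j = (\<Sum>l<r. x l i * y l j)"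
    using R unfolding low_rank_def by blast
  have "low_rank T S r (\<lambda>j i. cnj (M i j) - cnj (N i j))"
    unfolding low_rank_def
  proof (intro exI ballI)
    fix j i assume "j \<in> T" "i \<in> S"
    then show "cnj (M i j) - cnj (N i j) = (\<Sum>l<r. cnj (y l j) * cnj (x l i))"
      using arg_cong[OF xy, of i j cnj] by (simp add: mult.commute)
  qed
  moreover have "norm_bound T S \<omega> (\<lambda>j i. cnj (N i j))"
    unfolding norm_bound_def
  proof (intro allI)
    fix x y
    have "bilin T S (\<lambda>j i. cnj (N i j)) x y = cnj (bilin S T N (\<lambda>i. cnj (y i)) (\<lambda>j. cnj (x j)))"
      unfolding bilin_def by (subst sum.swap) (simp add: mult_ac)
    moreover have "cmod (bilin S T N (\<lambda>i. cnj (y i)) (\<lambda>j. cnj (x j))) \<le>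
        \<omega> * sqrt (sq_norm_on S (\<lambda>i. cnj (y i))) * sqrt (sq_norm_on T (\<lambda>j. cnj (x j)))"
      using N unfolding norm_bound_def by blast
    ultimately show "cmod (bilin T S (\<lambda>j i. cnj (N i j)) x y) \<le> \<omega> * sqrt (sq_norm_on T x) * sqrt (sq_norm_on S y)"
      by (simp add: sq_norm_on_def mult_ac)
  qed
  ultimately show ?thesis
    unfolding rank_norm_split_def by (intro exI[of _ "\<lambda>j i. cnj (N i j)"] conjI)
qed

section \<open>Singular values of a split matrix\<close>

lemma mat_adjoint_carrier [simp]: "A \<in> carrier_mat p q \<Longrightarrow> mat_adjoint A \<in> carrier_mat q p"
  unfolding mat_adjoint_def by auto

lemma mat_adjoint_entry:
  fixes A :: "complex mat"
  shows "A \<in> carrier_mat p q \<Longrightarrow> i < q \<Longrightarrow> j < p \<Longrightarrow> mat_adjoint A $$ (i, j) = cnj (A $$ (j, i))"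
  by (simp add: mat_adjoint_def mat_of_rows_index)

text \<open>Stated for a pair of mutually adjoint matrices, described entrywise, so that it applies
  to both Gram matrices in the definition of \<open>singular_values\<close> without forming a double
  adjoint.\<close>

lemma gram_eigenvalues:
  fixes B C :: "complex mat"
  assumes B: "B \<in> carrier_mat p q" and C: "C \<in> carrier_mat q p"
    and BC: "\<And>i j. i < p \<Longrightarrow> j < q \<Longrightarrow> C $$ (j, i) = cnj (B $$ (i, j))"
    and split: "rank_norm_split {..<p} {..<q} r \<omega> (\<lambda>i j. B $$ (i, j))" and "0 \<le> \<omega>"
  obtains \<sigma> where "image_mset (\<lambda>z. sqrt (Re z)) (proots (char_poly (C * B))) = image_mset \<sigma> (mset_set {..<q})"
    "\<And>k. k < q \<Longrightarrow> 0 \<le> \<sigma> k" "card {k. k < q \<and> \<omega> < \<sigma> k} \<le> r"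
proof -
  have G: "C * B \<in> carrier_mat q q" using B C by simp
  have entry: "(C * B) $$ (i, j) = (\<Sum>l<p. cnj (B $$ (l, i)) * B $$ (l, j))" if "i < q" "j < q" for i j
    using that B C BC by (simp add: scalar_prod_def atLeast0LessThan)
  obtain u \<nu> where u: "orthonormal_on {..<q} q u" and
    eig: "\<And>k i. k < q \<Longrightarrow> i < q \<Longrightarrow> (\<Sum>j<q. (C * B) $$ (i, j) * u k j) = \<nu> k * u k i"
  proof (rule hermitian_eigenbasis[of q "\<lambda>i j. (C * B) $$ (i, j)"])
    show "(C * B) $$ (i, j) = cnj ((C * B) $$ (j, i))" if "i < q" "j < q" for i j
      by (simp add: entry that mult.commute)
  qed blast
  have eig': "(\<Sum>j\<in>{..<q}. (\<Sum>l\<in>{..<p}. cnj (B $$ (l, i)) * B $$ (l, j)) * u k j) = \<nu> k * u k i"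
    if "k < q" "i \<in> {..<q}" for k i
    using eig[of k i] that by (simp add: entry)
  note large = card_large_singular_values_le[OF split \<open>0 \<le> \<omega>\<close> finite_lessThan finite_lessThan u eig']
  show thesis
  proof (rule that[of "\<lambda>k. sqrt (Re (\<nu> k))"])
    show "image_mset (\<lambda>z. sqrt (Re z)) (proots (char_poly (C * B))) =
        image_mset (\<lambda>k. sqrt (Re (\<nu> k))) (mset_set {..<q})"
      by (simp add: char_poly_eigenbasis[OF G u eig] multiset.map_comp comp_def)
  qed (use large in auto)
qed

lemma singular_values_of_split:
  assumes A: "A \<in> carrier_mat p q" and split: "rank_norm_split {..<p} {..<q} r \<omega> (\<lambda>i j. A $$ (i, j))"
    and "0 \<le> \<omega>"
  obtains \<sigma> where "singular_values A = image_mset \<sigma> (mset_set {..<min p q})"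
    "\<And>k. k < min p q \<Longrightarrow> 0 \<le> \<sigma> k" "card {k. k < min p q \<and> \<omega> < \<sigma> k} \<le> r"
proof (cases "q \<le> p")
  case True
  then have "singular_values A = image_mset (\<lambda>z. sqrt (Re z)) (proots (char_poly (mat_adjoint A * A)))"
    using A by (simp add: singular_values_def)
  moreover obtain \<sigma> where "image_mset (\<lambda>z. sqrt (Re z)) (proots (char_poly (mat_adjoint A * A))) =
      image_mset \<sigma> (mset_set {..<q})" "\<And>k. k < q \<Longrightarrow> 0 \<le> \<sigma> k" "card {k. k < q \<and> \<omega> < \<sigma> k} \<le> r"
    by (rule gram_eigenvalues[OF A mat_adjoint_carrier[OF A] mat_adjoint_entry[OF A] split \<open>0 \<le> \<omega>\<close>]) (assumption | rule that)+
  ultimately show thesis using True by (intro that[of \<sigma>]) (simp_all add: min_absorb2)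
next
  case False
  then have sv: "singular_values A = image_mset (\<lambda>z. sqrt (Re z)) (proots (char_poly (A * mat_adjoint A)))"
    using A by (simp add: singular_values_def)
  have "rank_norm_split {..<q} {..<p} r \<omega> (\<lambda>j i. cnj (A $$ (i, j)))"
    by (rule rank_norm_split_adjoint[OF split])
  then have split': "rank_norm_split {..<q} {..<p} r \<omega> (\<lambda>j i. mat_adjoint A $$ (j, i))"
    by (rule rank_norm_split_cong[THEN iffD1, rotated]) (simp add: mat_adjoint_entry[OF A])
  have entry: "A $$ (i, j) = cnj (mat_adjoint A $$ (j, i))" if "j < q" "i < p" for i j
    using that by (simp add: mat_adjoint_entry[OF A])
  obtain \<sigma> where "image_mset (\<lambda>z. sqrt (Re z)) (proots (char_poly (A * mat_adjoint A))) =
      image_mset \<sigma> (mset_set {..<p})" "\<And>k. k < p \<Longrightarrow> 0 \<le> \<sigma> k" "card {k. k < p \<and> \<omega> < \<sigma> k} \<le> r"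
    by (rule gram_eigenvalues[OF mat_adjoint_carrier[OF A] A entry split' \<open>0 \<le> \<omega>\<close>]) (assumption | rule that)+
  with False sv show thesis by (intro that[of \<sigma>]) (simp_all add: min_absorb1)
qed

subsection \<open>Corners of GLT sequences\<close>

lemma norm_bound_diag:
  assumes N: "norm_bound S T \<omega> N" and "0 \<le> \<omega>" "0 \<le> B" and d: "\<And>i. i \<in> S \<Longrightarrow> cmod (d i) \<le> B"
  shows "norm_bound S T (B * \<omega>) (\<lambda>i j. d i * N i j)"
  unfolding norm_bound_def
proof (intro allI)
  fix x y
  have "bilin S T (\<lambda>i j. d i * N i j) x y = bilin S T N (\<lambda>i. d i * x i) y"
    by (simp add: bilin_def mult_ac)
  also have "cmod \<dots> \<le> \<omega> * sqrt (sq_norm_on S (\<lambda>i. d i * x i)) * sqrt (sq_norm_on T y)"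
    using N unfolding norm_bound_def by blast
  also have "\<dots> \<le> \<omega> * (B * sqrt (sq_norm_on S x)) * sqrt (sq_norm_on T y)"
  proof -
    have "sq_norm_on S (\<lambda>i. d i * x i) \<le> (\<Sum>i\<in>S. B\<^sup>2 * (cmod (x i))\<^sup>2)"
      unfolding sq_norm_on_def norm_mult power_mult_distrib
      using d by (intro sum_mono mult_right_mono power_mono) auto
    then have "sqrt (sq_norm_on S (\<lambda>i. d i * x i)) \<le> sqrt (B\<^sup>2 * sq_norm_on S x)"
      by (simp add: sq_norm_on_def sum_distrib_left)
    then show ?thesis
      using \<open>0 \<le> B\<close> \<open>0 \<le> \<omega>\<close> by (intro mult_right_mono mult_left_mono) (auto simp: real_sqrt_mult)
  qed
  finally show "cmod (bilin S T (\<lambda>i j. d i * N i j) x y) \<le> B * \<omega> * sqrt (sq_norm_on S x) * sqrt (sq_norm_on T y)"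
    by (simp add: mult_ac)
qed

text \<open>With \<open>d'\<close> equal to \<open>d\<close> but set to 0 where its modulus exceeds
  \<open>B\<close>, one has d M = (d - d') M + d' (M - N) + d' N. The first term has at most
  \<open>l\<close> nonzero rows, the second keeps rank at most \<open>r\<close>, and the third has
  norm at most \<open>B * \<omega>\<close>.\<close>

lemma rank_norm_split_diag:
  assumes split: "rank_norm_split S T r \<omega> M" and "finite S" "0 \<le> \<omega>" "0 \<le> B"
    and l: "card {i \<in> S. cmod (d i) > B} \<le> l"
  shows "rank_norm_split S T (l + r) (B * \<omega>) (\<lambda>i j. d i * M i j)"
proof -
  obtain N where R: "low_rank S T r (\<lambda>i j. M i j - N i j)" and N: "norm_bound S T \<omega> N"
    using split unfolding rank_norm_split_def by blast
  obtain x y where xy: "\<And>i j. i \<in> S \<Longrightarrow> j \<in> T \<Longrightarrow> M i j - N i j = (\<Sum>k<r. x k i * y k j)"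
    using R unfolding low_rank_def by blast
  let ?L = "{i \<in> S. cmod (d i) > B}"
  define d' where "d' i = (if cmod (d i) > B then 0 else d i)" for i
  have "low_rank S T l (\<lambda>i j. (d i - d' i) * M i j)"
  proof (rule low_rankI[OF _ l, where x = "\<lambda>k i. if i = k then d i else 0" and y = M])
    fix i j assume "i \<in> S"
    have "(\<Sum>k\<in>?L. (if i = k then d i else 0) * M k j) = (\<Sum>k\<in>?L. if i = k then d i * M i j else 0)"
      by (intro sum.cong) auto
    also have "\<dots> = (d i - d' i) * M i j" using \<open>i \<in> S\<close> \<open>finite S\<close> by (simp add: d'_def)
    finally show "(d i - d' i) * M i j = (\<Sum>k\<in>?L. (if i = k then d i else 0) * M k j)" ..
  qed (use \<open>finite S\<close> in simp)
  moreover have "low_rank S T r (\<lambda>i j. d' i * (M i j - N i j))"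
    unfolding low_rank_def
    by (rule exI[of _ "\<lambda>k i. d' i * x k i"], rule exI[of _ y]) (simp add: xy sum_distrib_left mult.assoc)
  ultimately have "low_rank S T (l + r) (\<lambda>i j. (d i - d' i) * M i j + d' i * (M i j - N i j))"
    by (rule low_rank_add)
  moreover have "norm_bound S T (B * \<omega>) (\<lambda>i j. d' i * N i j)"
    by (rule norm_bound_diag[OF N \<open>0 \<le> \<omega>\<close> \<open>0 \<le> B\<close>]) (use \<open>0 \<le> B\<close> in \<open>simp add: d'_def\<close>)
  ultimately show ?thesis by (rule rank_norm_splitI) (simp add: algebra_simps)
qed

lemma diag_block_scalar:
  fixes c :: "'b \<Rightarrow> complex"
  shows "diag_block_mat (map (\<lambda>k. c k \<cdot>\<^sub>m 1\<^sub>m s) ks) =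
     mat (length ks * s) (length ks * s) (\<lambda>(i, j). if i = j then c (ks ! (i div s)) else 0)"
proof (induction ks)
  case Nil
  then show ?case by (intro eq_matI) auto
next
  case (Cons k ks)
  show ?case
  proof (rule eq_matI)
    fix i j
    assume ij: "i < dim_row (mat (length (k # ks) * s) (length (k # ks) * s) (\<lambda>(i, j). if i = j then c ((k # ks) ! (i div s)) else 0))"
      "j < dim_col (mat (length (k # ks) * s) (length (k # ks) * s) (\<lambda>(i, j). if i = j then c ((k # ks) ! (i div s)) else 0))"
    have div: "i div s = Suc ((i - s) div s)" if "\<not> i < s"
      using that ij by (cases "s = 0") (auto simp: le_div_geq)
    show "diag_block_mat (map (\<lambda>k. c k \<cdot>\<^sub>m 1\<^sub>m s) (k # ks)) $$ (i, j) =
        mat (length (k # ks) * s) (length (k # ks) * s) (\<lambda>(i, j). if i = j then c ((k # ks) ! (i div s)) else 0) $$ (i, j)"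
      using ij div by (auto simp: Let_def Cons.IH)
  qed (simp_all add: Let_def Cons.IH)
qed

text \<open>Blocks are counted from 0 but sample points from \<open>1 / m\<close>, hence the shift
  by one.\<close>

lemma diag_sampling_mat_scalar:
  "diag_sampling_mat m (\<lambda>x. a x \<cdot>\<^sub>m 1\<^sub>m s) =
     mat (m * s) (m * s) (\<lambda>(i, j). if i = j then a (real (i div s + 1) / real m) else 0)"
  unfolding diag_sampling_mat_def diag_block_scalar
  by (intro eq_matI) (auto simp: nth_upt less_mult_imp_div_less simp del: upt_Suc)

lemma diag_sampling_mult_entry:
  assumes X: "X \<in> carrier_mat (m * s) q" and "i < m * s" "j < q"
  shows "(diag_sampling_mat m (\<lambda>x. a x \<cdot>\<^sub>m 1\<^sub>m s) * X) $$ (i, j) =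
     a (real (i div s + 1) / real m) * X $$ (i, j)"
proof -
  have "(diag_sampling_mat m (\<lambda>x. a x \<cdot>\<^sub>m 1\<^sub>m s) * X) $$ (i, j) =
      (\<Sum>k<m * s. (if i = k then a (real (i div s + 1) / real m) else 0) * X $$ (k, j))"
    using assms by (simp add: diag_sampling_mat_scalar scalar_prod_def atLeast0LessThan)
  also have "\<dots> = (\<Sum>k<m * s. if i = k then a (real (i div s + 1) / real m) * X $$ (i, j) else 0)"
    by (intro sum.cong) auto
  finally show ?thesis using assms(2) by simp
qed

section \<open>Vanishing sequences\<close>

text \<open>Rank is measured against \<open>n\<close> rather than against the dimensions, which
  differ from it by the fixed factors \<open>s\<close> and \<open>t\<close>; so the same notion fits
  the corner of the large matrix and the Hankel matrix.\<close>

definition vanishing :: "nat set \<Rightarrow> (nat \<Rightarrow> nat set) \<Rightarrow> (nat \<Rightarrow> nat set) \<Rightarrow> (nat \<Rightarrow> nat \<Rightarrow> nat \<Rightarrow> complex) \<Rightarrow> bool" where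
  "vanishing I S T X \<longleftrightarrow> (\<forall>\<epsilon>>0. \<exists>N. \<forall>n\<in>I. n \<ge> N \<longrightarrow>
     (\<exists>r. real r \<le> \<epsilon> * real n \<and> rank_norm_split (S n) (T n) r \<epsilon> (X n)))"

lemma vanishing_add:
  assumes "vanishing I S T X" "vanishing I S T Y"
  shows "vanishing I S T (\<lambda>n i j. X n i j + Y n i j)"
  unfolding vanishing_def
proof (intro allI impI)
  fix \<epsilon> :: real assume "\<epsilon> > 0"
  then have e: "\<epsilon> / 2 > 0" by simp
  obtain N1 where N1: "\<forall>n\<in>I. n \<ge> N1 \<longrightarrow> (\<exists>r. real r \<le> \<epsilon> / 2 * real n \<and> rank_norm_split (S n) (T n) r (\<epsilon> / 2) (X n))"
    using assms(1) e unfolding vanishing_def by blast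
  obtain N2 where N2: "\<forall>n\<in>I. n \<ge> N2 \<longrightarrow> (\<exists>r. real r \<le> \<epsilon> / 2 * real n \<and> rank_norm_split (S n) (T n) r (\<epsilon> / 2) (Y n))"
    using assms(2) e unfolding vanishing_def by blast
  show "\<exists>N. \<forall>n\<in>I. n \<ge> N \<longrightarrow> (\<exists>r. real r \<le> \<epsilon> * real n \<and>
      rank_norm_split (S n) (T n) r \<epsilon> (\<lambda>i j. X n i j + Y n i j))"
  proof (rule exI[of _ "max N1 N2"], intro ballI impI)
    fix n assume n: "n \<in> I" "n \<ge> max N1 N2"
    obtain r1 where r1: "real r1 \<le> \<epsilon> / 2 * real n" "rank_norm_split (S n) (T n) r1 (\<epsilon> / 2) (X n)"
      using N1 n by auto
    obtain r2 where r2: "real r2 \<le> \<epsilon> / 2 * real n" "rank_norm_split (S n) (T n) r2 (\<epsilon> / 2) (Y n)"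
      using N2 n by auto
    have "rank_norm_split (S n) (T n) (r1 + r2) \<epsilon> (\<lambda>i j. X n i j + Y n i j)"
      using rank_norm_split_add[OF r1(2) r2(2)] by simp
    moreover have "real (r1 + r2) \<le> \<epsilon> * real n" using r1(1) r2(1) by simp
    ultimately show "\<exists>r. real r \<le> \<epsilon> * real n \<and>
        rank_norm_split (S n) (T n) r \<epsilon> (\<lambda>i j. X n i j + Y n i j)" by blast
  qed
qed

lemma rank_norm_split_zero: "0 \<le> \<omega> \<Longrightarrow> rank_norm_split S T 0 \<omega> (\<lambda>i j. 0)"
  unfolding rank_norm_split_def low_rank_def norm_bound_def
  by (intro exI[of _ "\<lambda>i j. 0"]) (simp add: bilin_def)

lemma vanishing_sum:
  assumes "finite L" "\<And>l. l \<in> L \<Longrightarrow> vanishing I S T (X l)"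
  shows "vanishing I S T (\<lambda>n i j. \<Sum>l\<in>L. X l n i j)"
  using assms
proof (induction rule: finite_induct)
  case empty
  have "\<exists>r. real r \<le> \<epsilon> * real n \<and> rank_norm_split (S n) (T n) r \<epsilon> (\<lambda>i j. 0)" if "\<epsilon> > 0" for \<epsilon> n
    using that by (intro exI[of _ 0]) (simp add: rank_norm_split_zero)
  then show ?case by (simp add: vanishing_def)
next
  case (insert l L)
  then show ?case using vanishing_add[of I S T "X l"] by simp
qed

lemma vanishing_cong:
  assumes "\<And>n i j. n \<in> I \<Longrightarrow> i \<in> S n \<Longrightarrow> j \<in> T n \<Longrightarrow> X n i j = Y n i j" "vanishing I S T X"
  shows "vanishing I S T Y"
proof -
  have "rank_norm_split (S n) (T n) r \<epsilon> (X n) = rank_norm_split (S n) (T n) r \<epsilon> (Y n)" if "n \<in> I" for n r \<epsilon>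
    using assms(1)[OF that] by (rule rank_norm_split_cong)
  then show ?thesis using assms(2) by (simp add: vanishing_def)
qed

text \<open>Each sample point governs \<open>s\<close> scalar rows. The right side counts over the
  whole grid of \<open>2 * n\<close> points, for which the sparsity estimate is available, although
  the corner meets only the later half.\<close>

lemma card_rows_le:
  assumes "0 < s"
  shows "card {i \<in> {n * s..<2 * n * s}. B < cmod (a (real (i div s + 1) / real (2 * n)))} \<le>
    s * card {k \<in> {1..2 * n}. B < cmod (a (real k / real (2 * n)))}" (is "card ?A \<le> s * card ?K")
proof -
  let ?f = "\<lambda>i. (i mod s, i div s + 1)"
  have "card ?A \<le> card ({..<s} \<times> ?K)"
  proof (rule card_inj_on_le[where f = ?f])
    show "inj_on ?f ?A" by (rule inj_onI) (metis Pair_inject add_right_cancel div_mult_mod_eq)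
    show "?f ` ?A \<subseteq> {..<s} \<times> ?K"
      using assms by (auto simp: Suc_le_eq less_mult_imp_div_less)
  qed simp
  then show ?thesis by simp
qed

text \<open>The order of choices matters: the threshold \<open>B\<close> depends on \<open>a\<close>
  and \<epsilon> alone, and the norm tolerance for the Toeplitz corner is chosen afterwards, small
  compared with \<open>B\<close>.\<close>

lemma vanishing_glt_term:
  assumes a: "continuous_ae a" and f: "L1_matrix s t f" and st: "0 < s" "0 < t"
  shows "vanishing I (\<lambda>n. {n * s..<2 * n * s}) (\<lambda>n. {..<n * t}) (\<lambda>n i j.
     (diag_sampling_mat (2 * n) (\<lambda>x. a x \<cdot>\<^sub>m 1\<^sub>m s) * toeplitz_mat s t (2 * n) f) $$ (i, j))"
  unfolding vanishing_def
proof (intro allI impI)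
  fix \<epsilon> :: real assume "\<epsilon> > 0"
  \<comment> \<open>Among \<open>2 * n\<close> samples, each accounting for \<open>s\<close> rows,
    this proportion yields at most \<open>\<epsilon> / 2 * real n\<close> large rows.\<close>
  then have "\<epsilon> / (4 * real s) > 0" using st by simp
  then obtain B N1 where B: "B > 0" and N1: "\<And>n. n \<ge> N1 \<Longrightarrow>
      real (card {i \<in> {1..n}. cmod (a (real i / real n)) > B}) \<le> \<epsilon> / (4 * real s) * real n"
    by (rule continuous_ae_sparsely_unbounded[OF a]) blast
  \<comment> \<open>Multiplication by entries of modulus at most \<open>B\<close> brings the norm
    back to \<epsilon>.\<close>
  define \<delta> where "\<delta> = \<epsilon> / B"
  have "\<delta> > 0" using \<open>\<epsilon> > 0\<close> B by (simp add: \<delta>_def)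
  \<comment> \<open>With this trace bound the conversion at level \<delta> costs rank at most
    \<open>\<epsilon> / 2 * real n\<close>.\<close>
  then have "\<delta> * \<epsilon> / 4 > 0" using \<open>\<epsilon> > 0\<close> by simp
  then obtain N2 where N2: "\<And>n. n \<ge> N2 \<Longrightarrow> trace_bound {n * s..<2 * n * s} {..<n * t} (\<delta> * \<epsilon> / 4 * real n)
      (\<lambda>i j. toeplitz_mat s t (2 * n) f $$ (i, j))"
    by (rule trace_bound_toeplitz_corner[OF f st]) blast
  show "\<exists>N. \<forall>n\<in>I. n \<ge> N \<longrightarrow> (\<exists>r. real r \<le> \<epsilon> * real n \<and>
      rank_norm_split {n * s..<2 * n * s} {..<n * t} r \<epsilon> (\<lambda>i j.
       (diag_sampling_mat (2 * n) (\<lambda>x. a x \<cdot>\<^sub>m 1\<^sub>m s) * toeplitz_mat s t (2 * n) f) $$ (i, j)))"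
  proof (rule exI[of _ "max N1 N2"], intro ballI impI)
    fix n assume n: "n \<ge> max N1 N2"
    let ?S = "{n * s..<2 * n * s}" and ?T = "{..<n * t}"
    let ?d = "\<lambda>i. a (real (i div s + 1) / real (2 * n))"
    let ?M = "\<lambda>i j. toeplitz_mat s t (2 * n) f $$ (i, j)"
    obtain r where r: "rank_norm_split ?S ?T r \<delta> ?M" "real r * \<delta> \<le> 2 * (\<delta> * \<epsilon> / 4 * real n)"
      by (rule rank_norm_split_of_trace_bound[OF N2 \<open>\<delta> > 0\<close>]) (use n in auto)
    have "real r * \<delta> \<le> (\<epsilon> / 2 * real n) * \<delta>" using r(2) by (simp add: mult_ac)
    then have r_le: "real r \<le> \<epsilon> / 2 * real n" using \<open>\<delta> > 0\<close> by (rule mult_right_le_imp_le)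
    define l where "l = card {i \<in> ?S. cmod (?d i) > B}"
    have "real l \<le> real s * real (card {k \<in> {1..2 * n}. B < cmod (a (real k / real (2 * n)))})"
      using card_rows_le[OF st(1), of n B a] unfolding l_def of_nat_mult[symmetric] of_nat_le_iff .
    also have "\<dots> \<le> real s * (\<epsilon> / (4 * real s) * real (2 * n))"
      using n by (intro mult_left_mono N1) auto
    also have "\<dots> = \<epsilon> / 2 * real n" using st by simp
    finally have l_le: "real l \<le> \<epsilon> / 2 * real n" .
    have "rank_norm_split ?S ?T (l + r) (B * \<delta>) (\<lambda>i j. ?d i * ?M i j)"
      by (rule rank_norm_split_diag[OF r(1)]) (use \<open>\<delta> > 0\<close> B in \<open>auto simp: l_def\<close>)
    moreover have "B * \<delta> = \<epsilon>" using B by (simp add: \<delta>_def)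
    moreover have "?d i * ?M i j =
        (diag_sampling_mat (2 * n) (\<lambda>x. a x \<cdot>\<^sub>m 1\<^sub>m s) * toeplitz_mat s t (2 * n) f) $$ (i, j)"
      if "i \<in> ?S" "j \<in> ?T" for i j
      using that by (subst diag_sampling_mult_entry[of _ _ _ "2 * n * t"]) (auto simp: toeplitz_mat_def)
    ultimately have "rank_norm_split ?S ?T (l + r) \<epsilon> (\<lambda>i j.
        (diag_sampling_mat (2 * n) (\<lambda>x. a x \<cdot>\<^sub>m 1\<^sub>m s) * toeplitz_mat s t (2 * n) f) $$ (i, j))"
      using rank_norm_split_cong[of ?S ?T "\<lambda>i j. ?d i * ?M i j"] by (simp only:)
    moreover have "real (l + r) \<le> \<epsilon> * real n" using r_le l_le by simp
    ultimately show "\<exists>r. real r \<le> \<epsilon> * real n \<and> rank_norm_split ?S ?T r \<epsilon> (\<lambda>i j.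
        (diag_sampling_mat (2 * n) (\<lambda>x. a x \<cdot>\<^sub>m 1\<^sub>m s) * toeplitz_mat s t (2 * n) f) $$ (i, j))"
      by blast
  qed
qed

text \<open>A single index \<open>m\<close> of the approximating class with small enough defects
  suffices for a given \<epsilon>. It is fixed first, and only then \<open>n\<close> grows, so the
  finite sum of products for this \<open>m\<close> can be treated term by term.\<close>

lemma vanishing_glt_corner:
  assumes A: "glt I (\<lambda>n. 2 * n) s t A \<kappa>"
  shows "vanishing I (\<lambda>n. {n * s..<2 * n * s}) (\<lambda>n. {..<n * t}) (\<lambda>n i j. A n $$ (i, j))"
  unfolding vanishing_def
proof (intro allI impI)
  let ?S = "\<lambda>n. {n * s..<2 * n * s}" and ?T = "\<lambda>n. {..<n * t}"
  fix \<epsilon> :: real assume "\<epsilon> > 0"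
  have st: "0 < s" "0 < t" using A by (auto simp: glt_def)
  have carrier: "\<And>n. n \<in> I \<Longrightarrow> A n \<in> carrier_mat (2 * n * s) (2 * n * t)" using A by (simp add: glt_def)
  obtain Nm a f where af: "\<And>m i. i \<in> {1..Nm m} \<Longrightarrow> continuous_ae (a m i) \<and> L1_matrix s t (f m i)"
    and acs: "is_acs I (\<lambda>m n. mat_sum (2 * n * s) (2 * n * t)
             (\<lambda>i. diag_sampling_mat (2 * n) (\<lambda>x. a m i x \<cdot>\<^sub>m 1\<^sub>m s) * toeplitz_mat s t (2 * n) (f m i))
             {1..Nm m}) A"
    using A unfolding glt_def by blast
  define P where "P m i n = diag_sampling_mat (2 * n) (\<lambda>x. a m i x \<cdot>\<^sub>m 1\<^sub>m s) * toeplitz_mat s t (2 * n) (f m i)"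
    for m i n
  define B where "B m n = mat_sum (2 * n * s) (2 * n * t) (\<lambda>i. P m i n) {1..Nm m}" for m n
  obtain n0 :: "nat \<Rightarrow> nat" and c \<omega> :: "nat \<Rightarrow> real" where c: "c \<longlonglongrightarrow> 0" and \<omega>: "\<omega> \<longlonglongrightarrow> 0" and
    split: "\<And>m n. n \<in> I \<Longrightarrow> n \<ge> n0 m \<Longrightarrow>
          (\<exists>R N. R \<in> carrier_mat (dim_row (A n)) (dim_col (A n)) \<and>
                 N \<in> carrier_mat (dim_row (A n)) (dim_col (A n)) \<and>
                 A n = B m n + R + N \<and>
                 real (mat_rank R) \<le> c m * real (min (dim_row (A n)) (dim_col (A n))) \<and>
                 op_norm N \<le> \<omega> m)"
    using acs unfolding is_acs_def P_def[symmetric] B_def[symmetric] by blast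
  \<comment> \<open>The smaller dimension of \<open>A n\<close> is at most \<open>2 * n * s\<close>,
    so the rank defect is at most \<open>\<epsilon> / 2 * real n\<close>.\<close>
  have "\<epsilon> / 2 > 0" "\<epsilon> / (4 * real s) > 0" using \<open>\<epsilon> > 0\<close> st by auto
  then have "\<forall>\<^sub>F m in sequentially. \<omega> m < \<epsilon> / 2 \<and> c m < \<epsilon> / (4 * real s)"
    by (intro eventually_conj order_tendstoD(2)[OF \<omega>] order_tendstoD(2)[OF c])
  then obtain m where m: "\<omega> m < \<epsilon> / 2" "c m < \<epsilon> / (4 * real s)"
    unfolding eventually_sequentially by auto
  have "vanishing I ?S ?T (\<lambda>n i j. \<Sum>l\<in>{1..Nm m}. P m l n $$ (i, j))"
    unfolding P_def using af st by (intro vanishing_sum vanishing_glt_term) auto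
  then have "vanishing I ?S ?T (\<lambda>n i j. B m n $$ (i, j))"
    by (rule vanishing_cong[rotated]) (auto simp: B_def mat_sum_def)
  then obtain N1 where N1: "\<forall>n\<in>I. n \<ge> N1 \<longrightarrow> (\<exists>r. real r \<le> \<epsilon> / 2 * real n \<and>
      rank_norm_split (?S n) (?T n) r (\<epsilon> / 2) (\<lambda>i j. B m n $$ (i, j)))"
    using \<open>\<epsilon> / 2 > 0\<close> unfolding vanishing_def by blast
  show "\<exists>N. \<forall>n\<in>I. n \<ge> N \<longrightarrow> (\<exists>r. real r \<le> \<epsilon> * real n \<and> rank_norm_split (?S n) (?T n) r \<epsilon> (\<lambda>i j. A n $$ (i, j)))"
  proof (rule exI[of _ "max N1 (n0 m)"], intro ballI impI)
    fix n assume n: "n \<in> I" "n \<ge> max N1 (n0 m)"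
    note An = carrier[OF n(1)]
    obtain r where r: "real r \<le> \<epsilon> / 2 * real n" "rank_norm_split (?S n) (?T n) r (\<epsilon> / 2) (\<lambda>i j. B m n $$ (i, j))"
      using N1 n by auto
    obtain R N where R: "R \<in> carrier_mat (2 * n * s) (2 * n * t)" and N: "N \<in> carrier_mat (2 * n * s) (2 * n * t)"
      and eq: "A n = B m n + R + N"
      and rank: "real (mat_rank R) \<le> c m * real (min (2 * n * s) (2 * n * t))" and norm: "op_norm N \<le> \<omega> m"
      using split[of n m] n An by auto
    have "norm_bound {..<2 * n * s} {..<2 * n * t} (\<epsilon> / 2) (\<lambda>i j. N $$ (i, j))"
      using norm_bound_mono[OF norm_bound_of_op_norm[OF N], of "\<epsilon> / 2"] norm m(1) by simp
    then have "rank_norm_split {..<2 * n * s} {..<2 * n * t} (mat_rank R) (\<epsilon> / 2) (\<lambda>i j. R $$ (i, j) + N $$ (i, j))"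
      by (rule rank_norm_splitI[OF low_rank_of_mat_rank[OF R]]) simp
    \<comment> \<open>Identity maps as injections: restriction to the corner.\<close>
    then have RN: "rank_norm_split (?S n) (?T n) (mat_rank R) (\<epsilon> / 2) (\<lambda>i j. R $$ (i, j) + N $$ (i, j))"
      by (rule rank_norm_split_reindex[of "{..<2 * n * s}" "{..<2 * n * t}" id "?S n" id "?T n", simplified, rotated 1]) auto
    have "rank_norm_split (?S n) (?T n) (r + mat_rank R) \<epsilon> (\<lambda>i j. B m n $$ (i, j) + (R $$ (i, j) + N $$ (i, j)))"
      using rank_norm_split_add[OF r(2) RN] by simp
    moreover have "B m n $$ (i, j) + (R $$ (i, j) + N $$ (i, j)) = A n $$ (i, j)" if "i \<in> ?S n" "j \<in> ?T n" for i j
      using that R N unfolding eq by (auto simp: B_def mat_sum_def)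
    ultimately have "rank_norm_split (?S n) (?T n) (r + mat_rank R) \<epsilon> (\<lambda>i j. A n $$ (i, j))"
      using rank_norm_split_cong[of "?S n" "?T n" "\<lambda>i j. B m n $$ (i, j) + (R $$ (i, j) + N $$ (i, j))"] by (simp only:)
    moreover have "real (r + mat_rank R) \<le> \<epsilon> * real n"
    proof -
      have "c m * real (min (2 * n * s) (2 * n * t)) \<le> \<epsilon> / (4 * real s) * real (min (2 * n * s) (2 * n * t))"
        using m(2) by (intro mult_right_mono) auto
      also have "\<dots> \<le> \<epsilon> / (4 * real s) * real (2 * n * s)"
        using \<open>\<epsilon> / (4 * real s) > 0\<close> by (intro mult_left_mono of_nat_mono min.cobounded1) simp
      also have "\<dots> = \<epsilon> / 2 * real n" using st by simp
      finally show ?thesis using rank r(1) by simp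
    qed
    ultimately show "\<exists>r. real r \<le> \<epsilon> * real n \<and> rank_norm_split (?S n) (?T n) r \<epsilon> (\<lambda>i j. A n $$ (i, j))"
      by blast
  qed
qed

section \<open>The flipped corner\<close>

lemma glh_mat_carrier:
  assumes A: "A \<in> carrier_mat (2 * n * s) (2 * n * t)"
  shows "glh_mat s t n A \<in> carrier_mat (n * s) (n * t)"
  unfolding glh_mat_def
  by (rule mult_carrier_mat[of _ _ "n * t"])
    (use A in \<open>auto simp: bottom_left_block_def split_block_def Let_def kronecker_def flip_mat_def\<close>)

text \<open>The Kronecker factor is a permutation matrix that reverses the order of the block
  columns and keeps the position inside a block. Counting from 0, block \<open>b\<close> is
  exchanged with block \<open>n - 1 - b\<close>.\<close>

lemma glh_mat_entry:
  assumes A: "A \<in> carrier_mat (2 * n * s) (2 * n * t)" and "0 < t" and i: "i < n * s" and j: "j < n * t"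
  shows "glh_mat s t n A $$ (i, j) = A $$ (n * s + i, (n - 1 - j div t) * t + j mod t)"
proof -
  let ?g = "(n - 1 - j div t) * t + j mod t"
  have jdiv: "j div t < n" using j by (simp add: less_mult_imp_div_less)
  have g: "?g < n * t"
  proof -
    have "?g < Suc (n - 1 - j div t) * t" using \<open>0 < t\<close> by simp
    also have "\<dots> \<le> n * t" using jdiv by (intro mult_le_mono1) auto
    finally show ?thesis .
  qed
  have kron: "kronecker (flip_mat n) (1\<^sub>m t) $$ (l, j) = (if l = ?g then 1 else 0)" if l: "l < n * t" for l
  proof -
    have ldiv: "l div t < n" using l by (simp add: less_mult_imp_div_less)
    have "l div t + j div t + 1 = n \<and> l mod t = j mod t \<longleftrightarrow> l = ?g"
    proof
      assume *: "l div t + j div t + 1 = n \<and> l mod t = j mod t"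
      then have "l div t = n - 1 - j div t" by auto
      then show "l = ?g" using * div_mult_mod_eq[of l t] by simp
    next
      assume "l = ?g"
      then have "l div t = n - 1 - j div t" "l mod t = j mod t" using \<open>0 < t\<close> by auto
      then show "l div t + j div t + 1 = n \<and> l mod t = j mod t" using jdiv by auto
    qed
    then show ?thesis
      using l j jdiv ldiv \<open>0 < t\<close> by (auto simp: kronecker_def flip_mat_def)
  qed
  have block: "bottom_left_block s t n A = mat (n * s) (n * t) (\<lambda>(i, j). A $$ (n * s + i, j))"
    using A by (intro eq_matI) (auto simp: bottom_left_block_def split_block_def Let_def add.commute)
  have "glh_mat s t n A $$ (i, j) = (\<Sum>l<n * t. A $$ (n * s + i, l) * kronecker (flip_mat n) (1\<^sub>m t) $$ (l, j))"
    using i j unfolding glh_mat_def block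
    by (simp add: scalar_prod_def atLeast0LessThan kronecker_def flip_mat_def)
  also have "\<dots> = (\<Sum>l<n * t. if l = ?g then A $$ (n * s + i, ?g) else 0)"
    using kron by (intro sum.cong) auto
  finally show ?thesis using g by simp
qed

lemma vanishing_glh:
  assumes A: "glt I (\<lambda>n. 2 * n) s t A \<kappa>" and H: "\<And>n. n \<in> I \<Longrightarrow> H n = glh_mat s t n (A n)"
  shows "vanishing I (\<lambda>n. {..<n * s}) (\<lambda>n. {..<n * t}) (\<lambda>n i j. H n $$ (i, j))"
  unfolding vanishing_def
proof (intro allI impI)
  fix \<epsilon> :: real assume "\<epsilon> > 0"
  have t: "0 < t" and carrier: "\<And>n. n \<in> I \<Longrightarrow> A n \<in> carrier_mat (2 * n * s) (2 * n * t)"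
    using A by (auto simp: glt_def)
  obtain N where N: "\<forall>n\<in>I. n \<ge> N \<longrightarrow> (\<exists>r. real r \<le> \<epsilon> * real n \<and>
      rank_norm_split {n * s..<2 * n * s} {..<n * t} r \<epsilon> (\<lambda>i j. A n $$ (i, j)))"
    using vanishing_glt_corner[OF A] \<open>\<epsilon> > 0\<close> unfolding vanishing_def by blast
  show "\<exists>N. \<forall>n\<in>I. n \<ge> N \<longrightarrow> (\<exists>r. real r \<le> \<epsilon> * real n \<and>
      rank_norm_split {..<n * s} {..<n * t} r \<epsilon> (\<lambda>i j. H n $$ (i, j)))"
  proof (rule exI[of _ N], intro ballI impI)
    fix n assume n: "n \<in> I" "n \<ge> N"
    obtain r where r: "real r \<le> \<epsilon> * real n"
      "rank_norm_split {n * s..<2 * n * s} {..<n * t} r \<epsilon> (\<lambda>i j. A n $$ (i, j))"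
      using N n by blast
    \<comment> \<open>The Hankel matrix is the corner with shifted row labels and permuted columns,
      so its splitting is obtained by reindexing.\<close>
    let ?f = "\<lambda>i. n * s + i" and ?g = "\<lambda>j. (n - 1 - j div t) * t + j mod t"
    have "rank_norm_split {..<n * s} {..<n * t} r \<epsilon> (\<lambda>i j. A n $$ (?f i, ?g j))"
    proof (rule rank_norm_split_reindex[OF _ _ _ _ _ _ r(2)])
      show "inj_on ?g {..<n * t}"
      proof (rule inj_onI)
        fix j k assume jk: "j \<in> {..<n * t}" "k \<in> {..<n * t}" and eq: "?g j = ?g k"
        have "j div t < n" "k div t < n" using jk by (auto simp: less_mult_imp_div_less)
        moreover have "?g j div t = ?g k div t" "?g j mod t = ?g k mod t" using eq by simp_all
        then have "n - 1 - j div t = n - 1 - k div t" "j mod t = k mod t" using t by simp_all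
        ultimately have "j div t = k div t" "j mod t = k mod t" by auto
        then show "j = k" by (metis div_mult_mod_eq)
      qed
      show "?g ` {..<n * t} \<subseteq> {..<n * t}"
      proof
        fix l assume "l \<in> ?g ` {..<n * t}"
        then obtain j where j: "j < n * t" "l = ?g j" by auto
        have "?g j < Suc (n - 1 - j div t) * t" using t by simp
        also have "\<dots> \<le> n * t" using j(1) less_mult_imp_div_less[of j n t] by (intro mult_le_mono1) auto
        finally show "l \<in> {..<n * t}" using j by simp
      qed
    qed (auto simp: inj_on_def)
    moreover have "A n $$ (?f i, ?g j) = H n $$ (i, j)" if "i \<in> {..<n * s}" "j \<in> {..<n * t}" for i j
      using that glh_mat_entry[OF carrier[OF n(1)] t] H[OF n(1)] by simp
    ultimately have "rank_norm_split {..<n * s} {..<n * t} r \<epsilon> (\<lambda>i j. H n $$ (i, j))"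
      using rank_norm_split_cong[of "{..<n * s}" "{..<n * t}" "\<lambda>i j. A n $$ (?f i, ?g j)"] by (simp only:)
    then show "\<exists>r. real r \<le> \<epsilon> * real n \<and> rank_norm_split {..<n * s} {..<n * t} r \<epsilon> (\<lambda>i j. H n $$ (i, j))"
      using r(1) by blast
  qed
qed

section \<open>From vanishing to the two conclusions\<close>

lemma eventually_along: "eventually P (along I) \<longleftrightarrow> (\<exists>N. \<forall>n\<in>I. n \<ge> N \<longrightarrow> P n)"
  unfolding along_def eventually_inf_principal eventually_sequentially by blast

lemma filterlim_along_scaled:
  assumes "0 < c" "\<And>n. n \<in> I \<Longrightarrow> g n = n * c"
  shows "filterlim g at_top (along I)"
  unfolding filterlim_at_top eventually_along
proof (intro allI exI ballI impI)
  fix Z n assume "n \<in> I" "Z \<le> n"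
  then show "Z \<le> g n" using assms by (metis le_trans mult.right_neutral mult_le_mono2 Suc_leI One_nat_def)
qed

lemma matrix_seq_scaled:
  assumes "infinite I" "0 < s" "0 < t" "\<And>n. n \<in> I \<Longrightarrow> H n \<in> carrier_mat (n * s) (n * t)"
  shows "matrix_seq I H"
  unfolding matrix_seq_def
  using assms(1) filterlim_along_scaled[OF assms(2), of I "\<lambda>n. dim_row (H n)"]
    filterlim_along_scaled[OF assms(3), of I "\<lambda>n. dim_col (H n)"] assms(4) by auto

text \<open>Passes from the scale \<open>n\<close> of \<open>vanishing\<close> to the smaller
  dimension, the scale of both conclusions.\<close>

lemma of_nat_le_scaled_min:
  assumes "real r \<le> \<epsilon> * real n" "0 < s" "0 < t" "0 \<le> \<epsilon>"
  shows "real r \<le> \<epsilon> * real (min (n * s) (n * t))"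
proof -
  have "n \<le> min (n * s) (n * t)" using assms by simp
  then have "\<epsilon> * real n \<le> \<epsilon> * real (min (n * s) (n * t))" using assms(4) by (intro mult_left_mono) auto
  then show ?thesis using assms(1) by linarith
qed

text \<open>Few singular values are large, and on these the test function is only known to be
  bounded; at all others it is close to its value at 0 by continuity.\<close>

lemma zero_distributed_of_vanishing:
  assumes I: "infinite I" "\<And>n. n \<in> I \<Longrightarrow> 0 < n" and st: "0 < s" "0 < t"
    and H: "\<And>n. n \<in> I \<Longrightarrow> H n \<in> carrier_mat (n * s) (n * t)"
    and van: "vanishing I (\<lambda>n. {..<n * s}) (\<lambda>n. {..<n * t}) (\<lambda>n i j. H n $$ (i, j))"
  shows "zero_distributed I H"
  unfolding zero_distributed_def
proof (intro conjI allI impI)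
  show "matrix_seq I H" by (rule matrix_seq_scaled[OF I(1) st H])
  fix F :: "real \<Rightarrow> complex" assume cont: "continuous_on UNIV F" and supp: "bounded {x. F x \<noteq> 0}"
  obtain B where B: "B > 0" "\<And>x. cmod (F x) \<le> B"
  proof -
    obtain K where K: "\<And>x. F x \<noteq> 0 \<Longrightarrow> \<bar>x\<bar> \<le> K" using supp unfolding bounded_real by blast
    have "bounded (F ` {-K..K})"
      by (intro compact_imp_bounded compact_continuous_image continuous_on_subset[OF cont]) auto
    then obtain C where C: "C > 0" "\<And>x. x \<in> {-K..K} \<Longrightarrow> cmod (F x) \<le> C" unfolding bounded_pos by auto
    have "cmod (F x) \<le> C" for x
      using C K[of x] by (cases "F x = 0") (auto simp: abs_le_iff)
    then show thesis using that C(1) by blast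
  qed
  show "((\<lambda>n. (\<Sum>\<sigma>\<in>#singular_values (H n). F \<sigma>) / of_nat (min (dim_row (H n)) (dim_col (H n))))
      \<longlongrightarrow> F 0) (along I)"
    unfolding tendsto_iff
  proof (intro allI impI)
    fix \<epsilon> :: real assume "\<epsilon> > 0"
    have "isCont F 0" using cont by (simp add: continuous_on_eq_continuous_at)
    moreover have "\<epsilon> / 2 > 0" using \<open>\<epsilon> > 0\<close> by simp
    ultimately obtain \<eta> where \<eta>: "\<eta> > 0" "\<And>x. \<bar>x\<bar> < \<eta> \<Longrightarrow> cmod (F x - F 0) < \<epsilon> / 2"
      unfolding continuous_at_eps_delta by (metis dist_norm diff_zero real_norm_def)
    \<comment> \<open>The half of \<eta> makes values up to \<delta> lie strictly inside the
      continuity radius. The other entry limits the large singular values, each with an error of at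
      most \<open>2 * B\<close>, to \<epsilon> / 4 of the average; the small ones contribute at most
      \<epsilon> / 2.\<close>
    define \<delta> where "\<delta> = min (\<eta> / 2) (\<epsilon> / (8 * B))"
    have \<delta>: "\<delta> > 0" "\<delta> < \<eta>" "\<delta> \<le> \<epsilon> / (8 * B)" using \<eta>(1) \<open>\<epsilon> > 0\<close> B(1) by (auto simp: \<delta>_def)
    obtain N where N: "\<forall>n\<in>I. n \<ge> N \<longrightarrow> (\<exists>r. real r \<le> \<delta> * real n \<and>
        rank_norm_split {..<n * s} {..<n * t} r \<delta> (\<lambda>i j. H n $$ (i, j)))"
      using van \<delta>(1) unfolding vanishing_def by blast
    show "\<forall>\<^sub>F n in along I. dist ((\<Sum>\<sigma>\<in>#singular_values (H n). F \<sigma>) /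
        of_nat (min (dim_row (H n)) (dim_col (H n)))) (F 0) < \<epsilon>"
      unfolding eventually_along
    proof (rule exI[of _ N], intro ballI impI)
      fix n assume n: "n \<in> I" "n \<ge> N"
      define d where "d = min (n * s) (n * t)"
      have d: "d > 0" using I(2)[OF n(1)] st by (simp add: d_def)
      obtain r where r: "real r \<le> \<delta> * real n" "rank_norm_split {..<n * s} {..<n * t} r \<delta> (\<lambda>i j. H n $$ (i, j))"
        using N n by blast
      have r_le: "real r \<le> \<delta> * real d"
        unfolding d_def by (rule of_nat_le_scaled_min[OF r(1) st]) (use \<delta>(1) in simp)
      obtain \<sigma> where \<sigma>: "singular_values (H n) = image_mset \<sigma> (mset_set {..<d})"
        "\<And>k. k < d \<Longrightarrow> 0 \<le> \<sigma> k" "card {k. k < d \<and> \<delta> < \<sigma> k} \<le> r"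
        by (rule singular_values_of_split[OF H[OF n(1)] r(2)]) (use \<delta>(1) in \<open>auto simp: d_def\<close>)
      have "(\<Sum>\<sigma>\<in>#singular_values (H n). F \<sigma>) = (\<Sum>k<d. F (\<sigma> k))"
        unfolding \<sigma>(1) multiset.map_comp by (simp add: sum_unfold_sum_mset comp_def)
      then have "(\<Sum>\<sigma>\<in>#singular_values (H n). F \<sigma>) / of_nat d - F 0 = (\<Sum>k<d. F (\<sigma> k) - F 0) / of_nat d"
        using d by (simp add: sum_subtractf field_simps)
      moreover have "cmod (\<Sum>k<d. F (\<sigma> k) - F 0) \<le> (\<Sum>k<d. \<epsilon> / 2 + (if \<delta> < \<sigma> k then 2 * B else 0))"
      proof (rule sum_norm_le)
        fix k assume k: "k \<in> {..<d}"
        show "cmod (F (\<sigma> k) - F 0) \<le> \<epsilon> / 2 + (if \<delta> < \<sigma> k then 2 * B else 0)"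
        proof (cases "\<delta> < \<sigma> k")
          case True
          have "cmod (F (\<sigma> k) - F 0) \<le> B + B"
            using norm_triangle_ineq4[of "F (\<sigma> k)" "F 0"] B(2)[of "\<sigma> k"] B(2)[of 0] by linarith
          then show ?thesis using True \<open>\<epsilon> > 0\<close> by simp
        next
          case False
          then have "\<bar>\<sigma> k\<bar> < \<eta>" using \<sigma>(2)[of k] k \<delta>(2) by simp
          then show ?thesis using False \<eta>(2)[of "\<sigma> k"] by simp
        qed
      qed
      moreover have "(\<Sum>k<d. \<epsilon> / 2 + (if \<delta> < \<sigma> k then 2 * B else 0)) < \<epsilon> * real d"
      proof -
        have "(\<Sum>k<d. if \<delta> < \<sigma> k then 2 * B else 0) = (\<Sum>k\<in>{k \<in> {..<d}. \<delta> < \<sigma> k}. 2 * B)"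
          by (rule sum.inter_filter[symmetric]) simp
        also have "\<dots> = real (card {k. k < d \<and> \<delta> < \<sigma> k}) * (2 * B)" by simp
        also have "\<dots> \<le> real r * (2 * B)" using \<sigma>(3) B(1) by (intro mult_right_mono) auto
        also have "\<dots> \<le> \<delta> * real d * (2 * B)" using r_le B(1) by (intro mult_right_mono) auto
        also have "\<dots> \<le> \<epsilon> / (8 * B) * real d * (2 * B)" using \<delta>(3) B(1) by (intro mult_right_mono) auto
        also have "\<dots> = \<epsilon> / 4 * real d" using B(1) by simp
        finally have "(\<Sum>k<d. if \<delta> < \<sigma> k then 2 * B else 0) \<le> \<epsilon> / 4 * real d" .
        moreover have "0 < \<epsilon> * real d" using d \<open>\<epsilon> > 0\<close> by simp
        moreover have "(\<Sum>k<d. \<epsilon> / 2 + (if \<delta> < \<sigma> k then 2 * B else 0)) =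
            \<epsilon> / 2 * real d + (\<Sum>k<d. if \<delta> < \<sigma> k then 2 * B else 0)"
          by (simp add: sum.distrib)
        ultimately show ?thesis by linarith
      qed
      ultimately have "cmod ((\<Sum>\<sigma>\<in>#singular_values (H n). F \<sigma>) / of_nat d - F 0) < \<epsilon>"
        using d by (simp add: norm_divide pos_divide_less_eq)
      then show "dist ((\<Sum>\<sigma>\<in>#singular_values (H n). F \<sigma>) /
          of_nat (min (dim_row (H n)) (dim_col (H n)))) (F 0) < \<epsilon>"
        using H[OF n(1)] by (simp add: dist_norm d_def)
    qed
  qed
qed

text \<open>All approximants are taken to be zero, as sums over the empty index range. Each matrix
  is then entirely rank part plus norm part, and the tolerance shrinks with
  \<open>m\<close>.\<close>

lemma glt_zero_of_vanishing:
  assumes I: "infinite I" "\<And>n. n \<in> I \<Longrightarrow> 0 < n" and st: "0 < s" "0 < t"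
    and H: "\<And>n. n \<in> I \<Longrightarrow> H n \<in> carrier_mat (n * s) (n * t)"
    and van: "vanishing I (\<lambda>n. {..<n * s}) (\<lambda>n. {..<n * t}) (\<lambda>n i j. H n $$ (i, j))"
  shows "glt I (\<lambda>n. n) s t H (\<lambda>_. 0\<^sub>m s t)"
proof -
  \<comment> \<open>The tolerance \<open>1 / real (Suc m)\<close> serves both as rank fraction and
    as norm bound, and is positive also for \<open>m = 0\<close>.\<close>
  have "\<exists>N. \<forall>n\<in>I. n \<ge> N \<longrightarrow> (\<exists>r. real r \<le> 1 / real (Suc m) * real n \<and>
      rank_norm_split {..<n * s} {..<n * t} r (1 / real (Suc m)) (\<lambda>i j. H n $$ (i, j)))" for m
    using van unfolding vanishing_def by (metis of_nat_0_less_iff zero_less_Suc zero_less_divide_1_iff)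
  then obtain n0 where n0: "\<And>m n. n \<in> I \<Longrightarrow> n \<ge> n0 m \<Longrightarrow> (\<exists>r. real r \<le> 1 / real (Suc m) * real n \<and>
      rank_norm_split {..<n * s} {..<n * t} r (1 / real (Suc m)) (\<lambda>i j. H n $$ (i, j)))" by metis
  have lim: "(\<lambda>m. 1 / real (Suc m)) \<longlonglongrightarrow> 0" by real_asymp
  have split: "\<exists>R N. R \<in> carrier_mat (n * s) (n * t) \<and> N \<in> carrier_mat (n * s) (n * t) \<and>
      H n = 0\<^sub>m (n * s) (n * t) + R + N \<and>
      real (mat_rank R) \<le> 1 / real (Suc m) * real (min (n * s) (n * t)) \<and> op_norm N \<le> 1 / real (Suc m)"
    if n: "n \<in> I" "n \<ge> n0 m" for n m
  proof -
    obtain r where r: "real r \<le> 1 / real (Suc m) * real n"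
      "rank_norm_split {..<n * s} {..<n * t} r (1 / real (Suc m)) (\<lambda>i j. H n $$ (i, j))"
      using n0[OF n] by blast
    obtain N where R: "low_rank {..<n * s} {..<n * t} r (\<lambda>i j. H n $$ (i, j) - N i j)"
      and N: "norm_bound {..<n * s} {..<n * t} (1 / real (Suc m)) N"
      using r(2) unfolding rank_norm_split_def by blast
    obtain x y where xy: "\<And>i j. i < n * s \<Longrightarrow> j < n * t \<Longrightarrow> H n $$ (i, j) - N i j = (\<Sum>k<r. x k i * y k j)"
      using R unfolding low_rank_def by blast
    define R' where "R' = mat (n * s) (n * t) (\<lambda>(i, j). \<Sum>k<r. x k i * y k j)"
    define N' where "N' = mat (n * s) (n * t) (\<lambda>(i, j). N i j)"
    have "norm_bound {..<n * s} {..<n * t} (1 / real (Suc m)) (\<lambda>i j. N' $$ (i, j))"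
    proof -
      have "bilin {..<n * s} {..<n * t} (\<lambda>i j. N' $$ (i, j)) x y = bilin {..<n * s} {..<n * t} N x y" for x y
        by (rule bilin_cong) (auto simp: N'_def)
      then show ?thesis using N unfolding norm_bound_def by simp
    qed
    then have "op_norm N' \<le> 1 / real (Suc m)" by (rule op_norm_le[rotated]) (auto simp: N'_def)
    moreover have "real (mat_rank R') \<le> 1 / real (Suc m) * real (min (n * s) (n * t))"
    proof -
      have "real (mat_rank R') \<le> real r" unfolding R'_def using mat_rank_sum_products_le by simp
      also have "\<dots> \<le> 1 / real (Suc m) * real (min (n * s) (n * t))"
        by (rule of_nat_le_scaled_min[OF r(1) st]) simp
      finally show ?thesis .
    qed
    moreover have "H n = 0\<^sub>m (n * s) (n * t) + R' + N'"
    proof (rule eq_matI)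
      fix i j assume "i < dim_row (0\<^sub>m (n * s) (n * t) + R' + N')" "j < dim_col (0\<^sub>m (n * s) (n * t) + R' + N')"
      then have ij: "i < n * s" "j < n * t" by (simp_all add: N'_def)
      then show "H n $$ (i, j) = (0\<^sub>m (n * s) (n * t) + R' + N') $$ (i, j)"
        by (simp add: R'_def N'_def xy[OF ij, symmetric])
    qed (use H[OF n(1)] in \<open>auto simp: N'_def\<close>)
    ultimately show ?thesis by (intro exI[of _ R'] exI[of _ N']) (simp add: R'_def N'_def)
  qed
  have zero: "mat_sum p q M {1..0} = 0\<^sub>m p q" for p q M
    unfolding mat_sum_def by (intro eq_matI) auto
  have "is_acs I (\<lambda>m n. mat_sum (n * s) (n * t) (\<lambda>i. M m n i) {1..0}) H" for M
    unfolding is_acs_def zero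
  proof (intro conjI allI ballI)
    show "matrix_seq I H" by (rule matrix_seq_scaled[OF I(1) st H])
    show "0\<^sub>m (n * s) (n * t) \<in> carrier_mat (dim_row (H n)) (dim_col (H n))" if "n \<in> I" for n
      using H[OF that] by simp
    show "\<exists>n0 c \<omega>. c \<longlonglongrightarrow> 0 \<and> \<omega> \<longlonglongrightarrow> 0 \<and> (\<forall>m. \<forall>n\<in>I. n \<ge> n0 m \<longrightarrow>
          (\<exists>R N. R \<in> carrier_mat (dim_row (H n)) (dim_col (H n)) \<and>
                 N \<in> carrier_mat (dim_row (H n)) (dim_col (H n)) \<and>
                 H n = 0\<^sub>m (n * s) (n * t) + R + N \<and>
                 real (mat_rank R) \<le> c m * real (min (dim_row (H n)) (dim_col (H n))) \<and>
                 op_norm N \<le> \<omega> m))"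
      by (rule exI[of _ n0], rule exI[of _ "\<lambda>m. 1 / real (Suc m)"], rule exI[of _ "\<lambda>m. 1 / real (Suc m)"])
        (use lim split H in \<open>simp add: carrier_matD[OF H]\<close>)
  qed
  moreover have "(\<lambda>m. mat_sum s t (M m) {1..0} $$ (k, l)) \<longlonglongrightarrow> 0\<^sub>m s t $$ (k, l)" if "k < s" "l < t" for M k l
    using that unfolding zero by simp
  moreover have "measurable_symbol s t (\<lambda>_. 0\<^sub>m s t)" by (simp add: measurable_symbol_def)
  moreover have "filterlim (\<lambda>n. n) at_top (along I)" by (rule filterlim_along_scaled[of 1]) auto
  \<comment> \<open>With zero terms for every \<open>m\<close>, the coefficient functions are mere
    placeholders, chosen as 0.\<close>
  ultimately show ?thesis
    unfolding glt_def using I st H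
    by (intro conjI exI[of _ "\<lambda>_. 0"] exI[of _ "\<lambda>_ _ _. 0"] exI[of _ "\<lambda>_ _ _. 0\<^sub>m s t"]) auto
qed

theorem theorem5p2:
  fixes s t :: nat
    and I :: "nat set"
    and \<kappa> :: "real \<times> real \<Rightarrow> complex mat"
    and A H :: "nat \<Rightarrow> complex mat"
  assumes "0 < s" and "0 < t"
    and "infinite I"
    and "measurable_symbol s t \<kappa>"
    and "\<forall>n\<in>I. A n \<in> carrier_mat (2 * n * s) (2 * n * t)"
    and "glt I (\<lambda>n. 2 * n) s t A \<kappa>"
    and "\<forall>n\<in>I. H n = glh_mat s t n (A n)"
  shows "zero_distributed I H \<and> glt I (\<lambda>n. n) s t H (\<lambda>_. 0\<^sub>m s t)"
proof -
  \<comment> \<open>The GLT hypothesis on \<open>A\<close> includes positivity of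
    \<open>2 * n\<close>, which keeps the index 0, with its empty matrices, out of
    \<open>I\<close>.\<close>
  have pos: "\<And>n. n \<in> I \<Longrightarrow> 0 < n" using assms(6) by (auto simp: glt_def)
  have carrier: "\<And>n. n \<in> I \<Longrightarrow> H n \<in> carrier_mat (n * s) (n * t)"
    using assms(5,7) glh_mat_carrier by simp
  have van: "vanishing I (\<lambda>n. {..<n * s}) (\<lambda>n. {..<n * t}) (\<lambda>n i j. H n $$ (i, j))"
    using vanishing_glh[OF assms(6)] assms(7) by blast
  show ?thesis
    using zero_distributed_of_vanishing[OF assms(3) pos assms(1,2) carrier van]
      glt_zero_of_vanishing[OF assms(3) pos assms(1,2) carrier van] by blast
qed

end
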